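(* Let $k\ge 0$ be an integer, let $P(z)=b_nz^n+b_{n-1}z^{n-1}+\dots+b_0$ be a polynomial with complex constant coefficients, $b_n\neq 0$, of degree $n$, and let $m$ be the number of distinct zeros of $P$. Let $f$ be a zero-order transcendental meromorphic (resp. transcendental entire) function, and let $\alpha(z)$ be a non-zero small function of $f$. Let $$L_k(f,\Delta)(z)=\sum_{j=0}^{k}a_j\bigl(f(q_jz+c_j)-f(z)\bigr),$$ where $a_0,\dots,a_k$, $c_0,\dots,c_k$ and $q_0,\dots,q_k$ are complex constants with all $q_j\neq 0$. If $n>m+5k+6$ (resp. $n>m+2k+2$), then $P(f)L_k(f,\Delta)-\alpha(z)$ has infinitely many zeros.
   Context: Meromorphic means meromorphic in the whole complex plane $\mathbb{C}$. $T(r,f)$ is the Nevanlinna characteristic; zero order means $\limsup_{r\to\infty}\log^+T(r,f)/\log r=0$. A meromorphic function $\alpha$ is a small function of $f$ if $T(r,\alpha)=S(r,f)$, i.e. $T(r,\alpha)=o(T(r,f))$ as $r\to\infty$ outside a possible exceptional set of finite linear measure.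
   Formalization: The formal theorem additionally assumes that L_k(f,Δ) is not identically zero; without this the claim fails, e.g. all a_j = 0 and α = 1 give P(f)L_k(f,Δ) − α = −1, which has no zeros. *)

theory Defs
  imports "HOL-Complex_Analysis.Complex_Analysis" "HOL-Library.Landau_Symbols"
begin

text \<open>
  A meromorphic function on the plane is rendered as a total function \<open>f\<close> with
  \<open>f meromorphic_on UNIV\<close>. Its values at poles and removable singularities are arbitrary, so every
  notion below depends only on the values of \<open>f\<close> off a sparse (closed and discrete) set: identities
  between meromorphic functions are stated with \<open>\<forall>\<^sub>\<approx>\<close>, and zeros and poles through punctured limits.
\<close>

definition identically_zero :: "(complex \<Rightarrow> complex) \<Rightarrow> bool" where
  "identically_zero f \<longleftrightarrow> (\<forall>\<^sub>\<approx>z\<in>UNIV. f z = 0)"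

definition rational_function :: "(complex \<Rightarrow> complex) \<Rightarrow> bool" where
  "rational_function f \<longleftrightarrow>
     (\<exists>p q :: complex poly. q \<noteq> 0 \<and> (\<forall>\<^sub>\<approx>z\<in>UNIV. f z = poly p z / poly q z))"

text \<open>For an entire \<open>f\<close>, not being rational is the same as not being a polynomial.\<close>

definition transcendental :: "(complex \<Rightarrow> complex) \<Rightarrow> bool" where
  "transcendental f \<longleftrightarrow> \<not> rational_function f"

definition log_plus :: "real \<Rightarrow> real" where
  "log_plus x = (if x \<le> 1 then 0 else ln x)"

definition nevanlinna_m :: "real \<Rightarrow> (complex \<Rightarrow> complex) \<Rightarrow> real" where
  "nevanlinna_m r f =
     1 / (2 * pi) * integral {0..2 * pi} (\<lambda>\<theta>. log_plus (norm (f (of_real r * cis \<theta>))))"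

text \<open>The multiplicity of a pole is minus the order \<open>zorder\<close>, which is negative there.\<close>

definition pole_count :: "real \<Rightarrow> (complex \<Rightarrow> complex) \<Rightarrow> nat" where
  "pole_count t f = (\<Sum>z | norm z \<le> t \<and> is_pole f z. nat (- zorder f z))"

definition nevanlinna_N :: "real \<Rightarrow> (complex \<Rightarrow> complex) \<Rightarrow> real" where
  "nevanlinna_N r f =
     integral {0..r} (\<lambda>t. (real (pole_count t f) - real (pole_count 0 f)) / t)
     + real (pole_count 0 f) * ln r"

definition nevanlinna_T :: "real \<Rightarrow> (complex \<Rightarrow> complex) \<Rightarrow> real" where
  "nevanlinna_T r f = nevanlinna_m r f + nevanlinna_N r f"

definition zero_order :: "(complex \<Rightarrow> complex) \<Rightarrow> bool" where
  "zero_order f \<longleftrightarrow> Limsup at_top (\<lambda>r. ereal (log_plus (nevanlinna_T r f) / ln r)) = 0"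

text \<open>\<open>E\<close> is the exceptional set; \<open>lmeasurable\<close> means of finite Lebesgue measure.\<close>

definition small_function_of :: "(complex \<Rightarrow> complex) \<Rightarrow> (complex \<Rightarrow> complex) \<Rightarrow> bool" where
  "small_function_of \<alpha> f \<longleftrightarrow> \<alpha> meromorphic_on UNIV \<and>
     (\<exists>E :: real set. E \<in> lmeasurable \<and>
        (\<lambda>r. nevanlinna_T r \<alpha>) \<in> o[inf at_top (principal (- E))](\<lambda>r. nevanlinna_T r f))"

definition L_op ::
  "nat \<Rightarrow> (nat \<Rightarrow> complex) \<Rightarrow> (nat \<Rightarrow> complex) \<Rightarrow> (nat \<Rightarrow> complex) \<Rightarrow>
    (complex \<Rightarrow> complex) \<Rightarrow> complex \<Rightarrow> complex" where
  "L_op k a q c f z = (\<Sum>j\<le>k. a j * (f (q j * z + c j) - f z))"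

end

theory Submission
  imports Defs "HOL-Computational_Algebra.Fundamental_Theorem_Algebra"
begin

text \<open>
  Write \<open>f = A / B\<close> and the small function as \<open>S / T\<close> with entire functions of order zero and no common
  zeros. For an entire function \<open>u\<close> let \<open>nu u r\<close> be the mean of \<open>ln \<bar>u\<bar>\<close> over the circle of radius \<open>r\<close>,
  expressed through the zeros of \<open>u\<close> by Jensen's formula; it is additive in \<open>u\<close>. Since everything has
  order zero, there are arbitrarily large radii \<open>r\<close> (avoiding any set of finite measure) on which the
  growth measure \<open>\<Phi>\<close> of \<open>A, B, S, T\<close> satisfies \<open>\<Phi> (s r) \<le> 2 \<Phi> r\<close> for a huge factor \<open>s\<close>, and there the
  maximum modulus satisfies \<open>ln M(\<kappa> r, u) \<le> nu u r + o(\<Phi> r)\<close> for all functions \<open>u\<close> built from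
  \<open>A, B, S, T\<close>. This replaces both the logarithmic derivative lemma and its \<open>q\<close>-difference analogue: the
  Wronskian \<open>W\<close> of \<open>u\<close> and \<open>v\<close> trivially satisfies \<open>nu W r \<le> nu u r + nu v r + o(\<Phi> r)\<close>, and comparing
  multiplicities of zeros gives the abc inequality for \<open>u + v = w\<close>. It is applied to the identity
  obtained from \<open>P(f) L(f) - \<alpha>\<close> by clearing denominators; if that function had finitely many zeros, the
  degree of \<open>P\<close> would be at most \<open>m + 3 k + 5\<close>, and at most \<open>m + 1\<close> if \<open>f\<close> is entire.
\<close>

section \<open>Counting zeros\<close>

text \<open>Write PH = B^n P(A / B), Lm for the numerator of L(f) and Sh for the product of the
  shifted denominators. Clearing denominators leads to u = T PH Lm and v = -S B^(n+1) Sh. PH carries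
  all n linear factors A - x B with multiplicity, while the Wronskian counts the zeros of A - x B
  only once per distinct root; this sets n against m. What cannot be truncated is the cost of the
  argument: with M the larger of \<open>nu A\<close> and \<open>nu B\<close>, and b =
  \<open>nu B\<close>, the numerator Lm costs M + (k + 1) b and Sh costs (k + 1) b, up to small
  errors, and zeros common to u and v cost them once more. If A dominates, the bound for u gives n M
  <= (m + 1) M + (3 k + 4) b. If B dominates, the factors A - x B may be small, but then B^(n+1) in
  v is large and (n + 1) b <= (m + 2) M + (3 k + 4) b. Both lead to n <= m + 3 k + 5. For entire f
  one has b = 0, only the first case remains, and n <= m + 1. Since n, m and k are integers, a
  single radius at which all errors together stay below M decides the matter.\<close>

definition nz_entire :: "(complex \<Rightarrow> complex) \<Rightarrow> bool" where
  "nz_entire u \<longleftrightarrow> u holomorphic_on UNIV \<and> (\<exists>z. u z \<noteq> 0)"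

lemma nz_entire_analytic: "nz_entire u \<Longrightarrow> u analytic_on A"
  using analytic_on_holomorphic nz_entire_def by blast

lemma nz_entire_holo: "nz_entire u \<Longrightarrow> u holomorphic_on A"
  using holomorphic_on_subset nz_entire_def by blast

lemma nz_entire_meromorphic: "nz_entire u \<Longrightarrow> u meromorphic_on A"
  by (simp add: analytic_on_imp_meromorphic_on nz_entire_analytic)

lemma nz_entire_eventually:
  assumes "nz_entire u"
  shows   "eventually (\<lambda>w. u w \<noteq> 0) (at z)"
proof -
  obtain b where "u b \<noteq> 0" "u holomorphic_on UNIV"
    using assms nz_entire_def by auto
  thus ?thesis
    using non_zero_neighbour_alt[of u UNIV z b] by (auto simp: connected_UNIV)
qed

lemma nz_entire_frequently: "nz_entire u \<Longrightarrow> frequently (\<lambda>w. u w \<noteq> 0) (at z)"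
  by (simp add: eventually_frequently nz_entire_eventually)

lemma nz_entire_finite_zeros:
  assumes "nz_entire u"
  shows   "finite {z\<in>cball 0 r. u z = 0}"
proof -
  have "\<forall>\<^sub>\<approx>z\<in>UNIV. u z \<noteq> 0"
    using nz_entire_eventually[OF assms] by (simp add: eventually_cosparse_open_eq)
  then have "{z. u z = 0} sparse_in UNIV"
    by (simp add: eventually_cosparse)
  then have "{z. u z = 0} sparse_in cball 0 r"
    using sparse_in_subset by blast
  then have "finite (cball 0 r \<inter> {z. u z = 0})"
    using sparse_in_compact_finite by fastforce
  moreover have "cball 0 r \<inter> {z. u z = 0} = {z\<in>cball 0 r. u z = 0}" by blast
  ultimately show ?thesis by simp
qed

lemma nz_entire_countable_zeros:
  assumes "nz_entire u"
  shows   "countable {z. u z = 0}"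
proof -
  have "{z. u z = 0} = (\<Union>n::nat. {z\<in>cball 0 (real n). u z = 0})"
  proof (intro equalityI subsetI)
    fix z assume "z \<in> {z. u z = 0}"
    moreover obtain n where "norm z \<le> real n" using real_arch_simple by blast
    ultimately show "z \<in> (\<Union>n::nat. {z\<in>cball 0 (real n). u z = 0})" by auto
  qed auto
  thus ?thesis
    using nz_entire_finite_zeros[OF assms]
    by (simp only: countable_UN countable_finite countableI_type)
qed

lemma nz_entire_zorder:
  assumes "nz_entire u"
  shows   zorder_nonneg: "zorder u z \<ge> 0" 
    and   zorder_eq_0: "zorder u z = 0 \<longleftrightarrow> u z \<noteq> 0"
    and   zorder_pos: "zorder u z > 0 \<longleftrightarrow> u z = 0"
proof -
  have "u holomorphic_on UNIV" "\<exists>w\<in>UNIV. u w \<noteq> 0" using assms by (auto simp: nz_entire_def)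
  from zorder_exist_zero[OF this(1) open_UNIV connected_UNIV UNIV_I this(2), of z]
  have "if u z = 0 then zorder u z > 0 else zorder u z = 0" by blast
  thus "zorder u z \<ge> 0" "zorder u z = 0 \<longleftrightarrow> u z \<noteq> 0" "zorder u z > 0 \<longleftrightarrow> u z = 0"
    by (auto split: if_splits)
qed

lemma nz_entire_mult:
  assumes "nz_entire u" "nz_entire v"
  shows   "nz_entire (\<lambda>z. u z * v z)"
proof -
  have "eventually (\<lambda>z. u z \<noteq> 0 \<and> v z \<noteq> 0) (at 0)"
    using assms nz_entire_eventually eventually_conj by blast
  then have "frequently (\<lambda>z. u z \<noteq> 0 \<and> v z \<noteq> 0) (at 0)"
    by (simp add: eventually_frequently)
  then obtain z where "u z \<noteq> 0 \<and> v z \<noteq> 0"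
    using frequently_ex by blast
  thus ?thesis using assms by (auto simp: nz_entire_def intro!: holomorphic_intros)
qed

lemma nz_entire_const: "c \<noteq> 0 \<Longrightarrow> nz_entire (\<lambda>_. c)"
  by (auto simp: nz_entire_def)

lemma nz_entire_linear: "nz_entire (\<lambda>z. z - a)"
  unfolding nz_entire_def by (auto intro!: holomorphic_intros exI[of _ "a+1"])

lemma nz_entire_power: "nz_entire u \<Longrightarrow> nz_entire (\<lambda>z. u z ^ n)"
  by (auto simp: nz_entire_def intro!: holomorphic_intros)

lemma nz_entire_prod:
  "(\<And>i. i \<in> I \<Longrightarrow> nz_entire (u i)) \<Longrightarrow> nz_entire (\<lambda>z. \<Prod>i\<in>I. u i z)"
  by (induction I rule: infinite_finite_induct) (simp_all add: nz_entire_const nz_entire_mult)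

lemma nz_entire_affine:
  assumes "nz_entire u" "q \<noteq> 0"
  shows   "nz_entire (\<lambda>z. u (q * z + c))"
proof -
  obtain w where w: "u w \<noteq> 0" "u holomorphic_on UNIV" using assms by (auto simp: nz_entire_def)
  have "(u \<circ> (\<lambda>z. q * z + c)) holomorphic_on UNIV"
    by (rule holomorphic_on_compose_gen[where t = UNIV]) (auto intro!: holomorphic_intros w)
  moreover have "u (q * ((w - c) / q) + c) \<noteq> 0" using w assms by simp
  ultimately show ?thesis
    unfolding nz_entire_def o_def by blast
qed

lemma zorder_mult':
  assumes "nz_entire u" "nz_entire v"
  shows   "zorder (\<lambda>z. u z * v z) z = zorder u z + zorder v z"
  by (intro zorder_mult nz_entire_meromorphic nz_entire_frequently assms)

lemma zorder_power':
  assumes "nz_entire u"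
  shows   "zorder (\<lambda>z. u z ^ n) z = n * zorder u z"
  by (intro zorder_power nz_entire_meromorphic nz_entire_frequently assms)

lemma zorder_prod':
  assumes "\<And>i. i \<in> I \<Longrightarrow> nz_entire (u i)"
  shows   "zorder (\<lambda>z. \<Prod>i\<in>I. u i z) z = (\<Sum>i\<in>I. zorder (u i) z)"
  by (intro zorder_prod nz_entire_meromorphic nz_entire_eventually nz_entire_prod assms)

lemma zorder_const': "c \<noteq> 0 \<Longrightarrow> zorder (\<lambda>_. c) z = 0"
  using zorder_eq_0[OF nz_entire_const] by blast

lemma zorder_linear': "zorder (\<lambda>w. w - a) z = (if z = a then 1 else 0)"
proof (cases "z = a")
  case True
  thus ?thesis by (auto intro!: zorder_eqI[of UNIV _ "\<lambda>_. 1"])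
next
  case False
  thus ?thesis using zorder_eq_0[OF nz_entire_linear] by auto
qed

section \<open>Weighted counts of zeros and the right-hand side of Jensen's formula\<close>

definition wt :: "real \<Rightarrow> complex \<Rightarrow> real" where
  "wt r z = (if z = 0 then ln r else ln (r / norm z))"

text \<open>The integrated counting function N(r, 1/u): \<open>wt r z\<close> is the integral of 1/t
  from |z| to r. A zero at the origin has weight ln r, in accordance with the term n(0) ln
  r.\<close>

definition zcount :: "(complex \<Rightarrow> complex) \<Rightarrow> real \<Rightarrow> real" where
  "zcount u r = (\<Sum>z | norm z \<le> r \<and> u z = 0. of_int (zorder u z) * wt r z)"

text \<open>Here \<open>zor_poly u 0 0\<close> is the first non-vanishing Taylor coefficient at 0.
  Compared with the circle mean itself, this form needs no integrability, makes sense when zeros lie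
  on the circle, and reduces additivity to additivity of orders.\<close>

definition nu :: "(complex \<Rightarrow> complex) \<Rightarrow> real \<Rightarrow> real" where
  "nu u r = ln (norm (zor_poly u 0 0)) + zcount u r"

lemma wt_nonneg: "norm z \<le> r \<Longrightarrow> 1 \<le> r \<Longrightarrow> wt r z \<ge> 0"
  by (auto simp: wt_def)

lemma nz_entire_finite_zeros':
  "nz_entire u \<Longrightarrow> finite {z. norm z \<le> r \<and> u z = 0}"
  using nz_entire_finite_zeros[of u r] by simp

text \<open>Points of Z where u does not vanish have order 0 and add nothing, so the counts of
  several functions can be taken over one finite set.\<close>

lemma zcount_superset:
  assumes "nz_entire u" "finite Z" "{z. norm z \<le> r \<and> u z = 0} \<subseteq> Z" "Z \<subseteq> cball 0 r"
  shows   "zcount u r = (\<Sum>z\<in>Z. of_int (zorder u z) * wt r z)"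
  unfolding zcount_def 
proof (rule sum.mono_neutral_left[OF assms(2,3)], safe)
  fix z assume z: "z \<in> Z" "real_of_int (zorder u z) * wt r z \<noteq> 0"
  then have "zorder u z \<noteq> 0" by auto
  then show "u z = 0" using zorder_eq_0[OF assms(1), of z] by blast
  show "norm z \<le> r" using z assms by auto
qed

text \<open>For r >= 1 all weights are nonnegative, the one at the origin included, so a comparison
  of divisors passes to the counts.\<close>

lemma zcount_mono_ord:
  assumes "nz_entire u" "nz_entire v" "1 \<le> r" "\<And>z. zorder u z \<le> zorder v z"
  shows   "zcount u r \<le> zcount v r"
proof -
  have *: "u z = 0 \<Longrightarrow> v z = 0" for z
    using assms(4)[of z] zorder_pos[OF assms(1), of z] zorder_pos[OF assms(2), of z] by auto
  define Z where "Z = {z. norm z \<le> r \<and> v z = 0}"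
  have "zcount u r = (\<Sum>z\<in>Z. of_int (zorder u z) * wt r z)"
    by (rule zcount_superset) (use assms * nz_entire_finite_zeros' in \<open>auto simp: Z_def\<close>)
  also have "\<dots> \<le> (\<Sum>z\<in>Z. of_int (zorder v z) * wt r z)"
    by (intro sum_mono mult_right_mono) (use assms in \<open>auto simp: Z_def wt_nonneg\<close>)
  finally show ?thesis by (simp add: zcount_def Z_def)
qed

lemma zcount_mult:
  assumes "nz_entire u" "nz_entire v"
  shows   "zcount (\<lambda>z. u z * v z) r = zcount u r + zcount v r"
proof -
  define Z where "Z = {z. norm z \<le> r \<and> u z * v z = 0}"
  have fin: "finite Z"
    unfolding Z_def using nz_entire_finite_zeros'[OF nz_entire_mult[OF assms]] .
  have "zcount u r = (\<Sum>z\<in>Z. of_int (zorder u z) * wt r z)"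
    by (rule zcount_superset) (use assms fin in \<open>auto simp: Z_def\<close>)
  moreover have "zcount v r = (\<Sum>z\<in>Z. of_int (zorder v z) * wt r z)"
    by (rule zcount_superset) (use assms fin in \<open>auto simp: Z_def\<close>)
  moreover have "zcount (\<lambda>z. u z * v z) r = (\<Sum>z\<in>Z. of_int (zorder u z + zorder v z) * wt r z)"
    by (simp only: zcount_def Z_def zorder_mult' assms)
  ultimately show ?thesis
    by (simp add: sum.distrib algebra_simps)
qed

lemma zor_poly_nz:
  assumes "nz_entire u"
  shows   "zor_poly u z z \<noteq> 0" "isCont (zor_poly u z) z"
          "\<exists>r>0. \<forall>w\<in>cball z r. u w = zor_poly u z w * (w - z) ^ nat (zorder u z)"
          "zor_poly u z analytic_on {z}"
proof -
  have "u holomorphic_on UNIV" "\<exists>w\<in>UNIV. u w \<noteq> 0" using assms by (auto simp: nz_entire_def)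
  from conjunct2[OF zorder_exist_zero[OF this(1) open_UNIV connected_UNIV UNIV_I this(2), of z]]
  obtain r where r: "r > 0" "zor_poly u z holomorphic_on cball z r"
    "\<And>w. w\<in>cball z r \<Longrightarrow> u w = zor_poly u z w * (w - z) ^ nat (zorder u z) \<and> zor_poly u z w \<noteq> 0"
    by blast
  show "zor_poly u z z \<noteq> 0" using r(1) r(3)[of z] by simp
  have "continuous_on (ball z r) (zor_poly u z)"
    using holomorphic_on_imp_continuous_on[OF r(2)] continuous_on_subset ball_subset_cball by blast
  then show "isCont (zor_poly u z) z"
    using r(1) by (simp add: continuous_on_eq_continuous_at)
  show "\<exists>r>0. \<forall>w\<in>cball z r. u w = zor_poly u z w * (w - z) ^ nat (zorder u z)"
    using r(1,3) by blast
  show "zor_poly u z analytic_on {z}"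
    unfolding analytic_at using r(1,2) by (meson ball_subset_cball centre_in_ball holomorphic_on_subset open_ball)
qed

text \<open>The product formula holds in a punctured neighbourhood and extends to the centre by
  continuity.\<close>

lemma zor_poly_mult:
  assumes "nz_entire u" "nz_entire v"
  shows   "zor_poly (\<lambda>z. u z * v z) z z = zor_poly u z z * zor_poly v z z"
proof -
  have an: "isolated_singularity_at u z" "not_essential u z" "isolated_singularity_at v z" "not_essential v z"
    using nz_entire_meromorphic assms meromorphic_at_iff by blast+
  have "eventually (\<lambda>w. zor_poly (\<lambda>z. u z * v z) z w = zor_poly u z w * zor_poly v z w) (at z)"
    by (rule zor_poly_times) (use an nz_entire_frequently[OF nz_entire_mult[OF assms]] in auto)
  moreover have "((\<lambda>w. zor_poly u z w * zor_poly v z w) \<longlongrightarrow> zor_poly u z z * zor_poly v z z) (at z)"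
    using zor_poly_nz(2)[OF assms(1), of z] zor_poly_nz(2)[OF assms(2), of z]
    by (intro tendsto_intros) (auto simp: isCont_def)
  ultimately have "(zor_poly (\<lambda>z. u z * v z) z \<longlongrightarrow> zor_poly u z z * zor_poly v z z) (at z)"
    by (simp add: filterlim_cong)
  moreover have "(zor_poly (\<lambda>z. u z * v z) z \<longlongrightarrow> zor_poly (\<lambda>z. u z * v z) z z) (at z)"
    using zor_poly_nz(2)[OF nz_entire_mult[OF assms], of z] by (simp add: isCont_def)
  ultimately show ?thesis
    using tendsto_unique at_neq_bot by metis
qed

lemma nu_mult:
  assumes "nz_entire u" "nz_entire v"
  shows   "nu (\<lambda>z. u z * v z) r = nu u r + nu v r"
  using zor_poly_nz(1)[OF assms(1), of 0] zor_poly_nz(1)[OF assms(2), of 0]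
  by (simp add: nu_def zcount_mult assms zor_poly_mult norm_mult ln_mult)

lemma nu_const: 
  assumes "c \<noteq> 0"
  shows   "nu (\<lambda>_. c) r = ln (norm c)"
proof -
  obtain e where "e > 0" "\<forall>w\<in>cball 0 e. c = zor_poly (\<lambda>_. c) 0 w * (w - 0) ^ nat (zorder (\<lambda>_. c) 0)"
    using zor_poly_nz(3)[OF nz_entire_const[OF assms], of 0] by auto
  hence "zor_poly (\<lambda>_. c) 0 0 = c"
    using zorder_const'[OF assms] by (auto dest!: bspec[of _ _ 0])
  thus ?thesis using assms by (simp add: nu_def zcount_def)
qed

lemma nu_power:
  assumes "nz_entire u"
  shows   "nu (\<lambda>z. u z ^ n) r = real n * nu u r"
  by (induction n) (use assms in \<open>simp_all add: nu_mult nz_entire_power nu_const algebra_simps\<close>)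

lemma nu_prod:
  assumes "\<And>i. i \<in> I \<Longrightarrow> nz_entire (u i)"
  shows   "nu (\<lambda>z. \<Prod>i\<in>I. u i z) r = (\<Sum>i\<in>I. nu (u i) r)"
  using assms
  by (induction I rule: infinite_finite_induct) (simp_all add: nu_mult nz_entire_prod nu_const)

section \<open>Poisson--Jensen estimates\<close>

text \<open>All three claims are about the Blaschke factor r (z - a) / (r^2 - cnj a z); the first
  two follow from the identity that writes the difference of squared moduli as (r^2 - |a|^2) (r^2 -
  |z|^2).\<close>

lemma blaschke_factor_norm:
  fixes a z :: complex
  assumes "norm a < r" "norm z \<le> r"
  shows   "norm (of_real r * (z - a)) \<le> norm (of_real r ^ 2 - cnj a * z)"
          "norm z = r \<Longrightarrow> norm (of_real r * (z - a)) = norm (of_real r ^ 2 - cnj a * z)"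
          "of_real r ^ 2 - cnj a * z \<noteq> 0"
proof -
  have r: "r > 0" using assms norm_ge_zero[of a] by linarith
  have id: "(norm (of_real r ^ 2 - cnj a * z))\<^sup>2 - (norm (of_real r * (z - a)))\<^sup>2
        = (r\<^sup>2 - (norm a)\<^sup>2) * (r\<^sup>2 - (norm z)\<^sup>2)"
    unfolding cmod_power2 by (simp add: power2_eq_square algebra_simps)
  have "(norm a)\<^sup>2 \<le> r\<^sup>2" "(norm z)\<^sup>2 \<le> r\<^sup>2"
    using assms by (auto intro!: power_mono)
  then have "(norm (of_real r * (z - a)))\<^sup>2 \<le> (norm (of_real r ^ 2 - cnj a * z))\<^sup>2"
    using id by (smt (verit) mult_nonneg_nonneg)
  thus "norm (of_real r * (z - a)) \<le> norm (of_real r ^ 2 - cnj a * z)"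
    using power2_le_imp_le norm_ge_zero by blast
  show "norm (of_real r * (z - a)) = norm (of_real r ^ 2 - cnj a * z)" if "norm z = r"
  proof -
    have "(norm (of_real r * (z - a)))\<^sup>2 = (norm (of_real r ^ 2 - cnj a * z))\<^sup>2"
      using id that by simp
    thus ?thesis by simp
  qed
  have "norm (cnj a * z) = norm a * norm z" by (simp add: norm_mult)
  also have "\<dots> \<le> norm a * r" using assms(2) by (intro mult_left_mono) auto
  also have "\<dots> < r * r" using assms(1) r by simp
  finally have "norm (cnj a * z) \<noteq> norm (complex_of_real r ^ 2)"
    unfolding norm_power using r by (simp add: power2_eq_square)
  thus "of_real r ^ 2 - cnj a * z \<noteq> 0" by auto
qed

text \<open>\<open>exp h\<close> is the quotient of \<open>u\<close> by the Blaschke product of its zeros.\<close>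

lemma blaschke_majorant:
  assumes u: "nz_entire u" and r: "r > 0" and nz: "\<And>z. norm z = r \<Longrightarrow> u z \<noteq> 0"
  obtains h where "h holomorphic_on cball 0 r" "Re (h 0) = nu u r"
    "\<And>z. norm z \<le> r \<Longrightarrow> norm (u z) \<le> exp (Re (h z))"
    "\<And>z. norm z = r \<Longrightarrow> norm (u z) = exp (Re (h z))"
proof -
  define Z where "Z = {z. norm z \<le> r \<and> u z = 0}"
  define k where "k = (\<lambda>a. nat (zorder u a))"
  have finZ: "finite Z" unfolding Z_def using u by (rule nz_entire_finite_zeros')
  have k: "zorder u a = int (k a)" for a using zorder_nonneg[OF u] by (simp add: k_def)
  have Zr: "norm a < r" if "a \<in> Z" for a
    using that nz[of a] by (auto simp: Z_def order.order_iff_strict)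
  \<comment> \<open>The factorization needs an open disc around the closed one without further
    zeros. Its radius is the next larger modulus of a zero, capped at r + 1 so that \<open>X\<close>
    is non-empty.\<close>
  have "\<exists>R>r. \<forall>z\<in>ball 0 R. u z = 0 \<longrightarrow> z \<in> Z"
  proof -
    define X where "X = insert (r + 1) (norm ` ({z. norm z \<le> r + 1 \<and> u z = 0} - Z))"
    have X: "finite X" "X \<noteq> {}" "\<And>x. x \<in> X \<Longrightarrow> x > r"
      using nz_entire_finite_zeros'[OF u] by (auto simp: X_def Z_def)
    have "Min X > r" using X by auto
    moreover have "z \<in> Z" if "z \<in> ball 0 (Min X)" "u z = 0" for z
    proof (rule ccontr)
      assume "z \<notin> Z"
      moreover have "norm z \<le> r + 1" using that X Min_le[of X "r+1"] by (auto simp: X_def)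
      ultimately have "norm z \<in> X" using that by (auto simp: X_def)
      thus False using Min_le[of X "norm z"] X that by auto
    qed
    ultimately show ?thesis by blast
  qed
  then obtain R0 where R0: "R0 > r" "\<And>z. norm z < R0 \<Longrightarrow> u z = 0 \<Longrightarrow> z \<in> Z" by auto
  define q where "q = (\<lambda>z. \<Prod>a\<in>Z. (z - a) ^ k a)"
  have q_ent: "nz_entire q"
    unfolding q_def by (intro nz_entire_prod nz_entire_power nz_entire_linear)
  have q0: "q z = 0 \<longleftrightarrow> z \<in> Z" for z
  proof -
    have "k z > 0" if "z \<in> Z" using zorder_pos[OF u, of z] that by (auto simp: k_def Z_def)
    thus ?thesis using finZ by (auto simp: q_def)
  qed
  have q_ord: "zorder q z = zorder u z" if "norm z < R0" for z
  proof -
    have "zorder q z = (\<Sum>a\<in>Z. zorder (\<lambda>z. (z - a) ^ k a) z)"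
      unfolding q_def by (intro zorder_prod' nz_entire_power nz_entire_linear)
    also have "\<dots> = (\<Sum>a\<in>Z. if z = a then int (k a) else 0)"
      by (intro sum.cong refl) (simp add: zorder_power' nz_entire_linear zorder_linear')
    also have "\<dots> = (if z \<in> Z then int (k z) else 0)"
      using finZ by simp
    also have "\<dots> = zorder u z"
      using R0(2)[of z] that zorder_eq_0[OF u, of z] k by auto
    finally show ?thesis .
  qed
  have uq: "q z = 0 \<longleftrightarrow> u z = 0" if "z \<in> ball 0 R0" for z
    using q0 R0(2)[of z] that by (auto simp: Z_def)
  have q_ord': "zorder q z = zorder u z" if "z \<in> ball 0 R0" for z
    using q_ord[of z] that by simp
  obtain g where g: "g holomorphic_on ball 0 R0" "\<And>z. z \<in> ball 0 R0 \<Longrightarrow> g z \<noteq> 0"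
      "\<And>z. z \<in> ball 0 R0 \<Longrightarrow> u z = g z * q z"
    by (rule holomorphic_zorder_factorization[OF nz_entire_holo[OF u, of "ball 0 R0"] open_ball connected_ball
            nz_entire_holo[OF q_ent] uq q_ord']) (assumption | rule that)+
  \<comment> \<open>Replacing z - a by the reflected factor (r^2 - cnj a z) / r keeps the modulus on
    the circle but removes the zero. The function g p, which is u p / q off the zeros, has the
    logarithm h.\<close>
  define p where "p = (\<lambda>z. \<Prod>a\<in>Z. ((of_real r ^ 2 - cnj a * z) / of_real r) ^ k a)"
  \<comment> \<open>The half-planes keep the reflected factors away from 0 and preserve convexity,
    so a holomorphic logarithm exists on an open set containing the closed disc.\<close>
  define S where "S = ball 0 R0 \<inter> {z. \<forall>a\<in>Z. Re (cnj a * z) < r\<^sup>2}"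
  have "S = ball 0 R0 \<inter> (\<Inter>a\<in>Z. {z. Re (cnj a * z) < r\<^sup>2})" by (auto simp: S_def)
  moreover have "{z. Re (cnj a * z) < r\<^sup>2} = {z. a \<bullet> z < r\<^sup>2}" for a
    by (auto simp: inner_complex_def)
  ultimately have S: "open S" "convex S"
    using finZ by (auto intro!: convex_Int convex_INT open_Int open_INT convex_halfspace_lt open_halfspace_lt)
  have cS: "cball 0 r \<subseteq> S"
  proof
    fix z assume z: "z \<in> cball (0::complex) r"
    have "Re (cnj a * z) < r\<^sup>2" if "a \<in> Z" for a
    proof -
      have "Re (cnj a * z) \<le> norm (cnj a * z)" by (rule complex_Re_le_cmod)
      also have "\<dots> = norm a * norm z" by (simp add: norm_mult)
      also have "\<dots> \<le> norm a * r" using z by (intro mult_left_mono) auto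
      also have "\<dots> < r\<^sup>2" using Zr[OF that] r by (simp add: power2_eq_square)
      finally show ?thesis .
    qed
    thus "z \<in> S" using z R0(1) by (auto simp: S_def)
  qed
  have p_nz: "p z \<noteq> 0" if "z \<in> S" for z
  proof -
    have "of_real r ^ 2 - cnj a * z \<noteq> 0" if "a \<in> Z" for a
    proof
      assume "of_real r ^ 2 - cnj a * z = 0"
      then have "cnj a * z = of_real (r\<^sup>2)" by (simp add: algebra_simps)
      then have "Re (cnj a * z) = r\<^sup>2" by (simp only: Re_complex_of_real)
      thus False using \<open>z \<in> S\<close> that unfolding S_def by force
    qed
    thus ?thesis using r finZ by (auto simp: p_def)
  qed
  have gp: "(\<lambda>z. g z * p z) holomorphic_on S"
  proof -
    have "p holomorphic_on S"
      unfolding p_def by (intro holomorphic_intros) (use r in auto)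
    moreover have "g holomorphic_on S" using g(1) by (rule holomorphic_on_subset) (auto simp: S_def)
    ultimately show ?thesis by (intro holomorphic_intros)
  qed
  have gpnz: "g z * p z \<noteq> 0" if "z \<in> S" for z
    using that g(2) p_nz by (auto simp: S_def)
  have S0: "0 \<in> S" using cS r by auto
  obtain h where h: "h holomorphic_on S" "\<And>z. z \<in> S \<Longrightarrow> exp (h z) = g z * p z"
    using holomorphic_logarithm_exists[OF S(2,1) gp gpnz S0] by metis
  have main: "norm (u z) = exp (Re (h z)) * (\<Prod>a\<in>Z. (norm (of_real r * (z - a)) / norm (of_real r ^ 2 - cnj a * z)) ^ k a)"
    if "norm z \<le> r" for z
  proof -
    have zS: "z \<in> S" using cS that by auto
    have "u z = g z * p z * (q z / p z)"
      using g(3)[of z] p_nz[OF zS] zS by (simp add: S_def)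
    also have "q z / p z = (\<Prod>a\<in>Z. (of_real r * (z - a) / (of_real r ^ 2 - cnj a * z)) ^ k a)"
      unfolding q_def p_def prod_dividef[symmetric] 
      by (intro prod.cong refl) (simp add: mult.commute flip: power_divide)
    finally have "norm (u z) = norm (exp (h z)) * norm (\<Prod>a\<in>Z. (of_real r * (z - a) / (of_real r ^ 2 - cnj a * z)) ^ k a)"
      by (simp add: h(2)[OF zS] norm_mult)
    thus ?thesis
      by (simp add: prod_norm[symmetric] norm_power norm_divide norm_exp_eq_Re)
  qed
  show ?thesis
  proof
    show "h holomorphic_on cball 0 r" using h(1) cS holomorphic_on_subset by blast
    show "norm (u z) \<le> exp (Re (h z))" if "norm z \<le> r" for z
    proof -
      have "(\<Prod>a\<in>Z. (norm (of_real r * (z - a)) / norm (of_real r ^ 2 - cnj a * z)) ^ k a) \<le> 1"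
        using blaschke_factor_norm[OF Zr that]
        by (intro prod_le_1 conjI power_le_one) (auto simp: divide_le_eq_1)
      thus ?thesis using main[OF that] by (simp add: mult_left_le)
    qed
    show "norm (u z) = exp (Re (h z))" if z: "norm z = r" for z
    proof -
      have "(\<Prod>a\<in>Z. (norm (of_real r * (z - a)) / norm (of_real r ^ 2 - cnj a * z)) ^ k a) = 1"
      proof (intro prod.neutral ballI)
        fix a assume a: "a \<in> Z"
        have "norm z \<le> r" using z by simp
        from blaschke_factor_norm[OF Zr[OF a] this] z
        show "(norm (of_real r * (z - a)) / norm (of_real r ^ 2 - cnj a * z)) ^ k a = 1" by simp
      qed
      thus ?thesis using main[of z] z by simp
    qed
    \<comment> \<open>The leading coefficient of u at 0 is the limit of u(z) / z^ord; it consists of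
      g(0) and the factors of q belonging to non-zero roots.\<close>
    have zp: "zor_poly u 0 0 = g 0 * (\<Prod>a\<in>Z-{0}. (0 - a) ^ k a)"
    proof (rule zor_poly_zero_eqI[where A = UNIV and g = "\<lambda>x. x" and F = "at 0"])
      have "isCont g 0"
        using holomorphic_on_imp_continuous_on[OF g(1)] r R0(1) by (simp add: continuous_on_eq_continuous_at)
      then have "isCont (\<lambda>z. g z * (\<Prod>a\<in>Z-{0}. (z - a) ^ k a)) 0"
        by (intro continuous_intros)
      then have "((\<lambda>z. g z * (\<Prod>a\<in>Z-{0}. (z - a) ^ k a)) \<longlongrightarrow> g 0 * (\<Prod>a\<in>Z-{0}. (0 - a) ^ k a)) (at 0)"
        by (simp add: isCont_def)
      moreover have "eventually (\<lambda>z. g z * (\<Prod>a\<in>Z-{0}. (z - a) ^ k a) = u z / (z - 0) ^ nat (zorder u 0)) (at 0)"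
      proof -
        have "eventually (\<lambda>z::complex. z \<in> ball 0 R0 - {0}) (at 0)"
          using r R0(1) by (intro eventually_at_in_open) auto
        thus ?thesis
        proof eventually_elim
          case (elim z)
          have "q z = z ^ nat (zorder u 0) * (\<Prod>a\<in>Z-{0}. (z - a) ^ k a)"
          proof (cases "0 \<in> Z")
            case True
            thus ?thesis using finZ by (simp add: q_def prod.remove[of Z 0] k_def)
          next
            case False
            hence "zorder u 0 = 0" using r zorder_eq_0[OF u, of 0] by (auto simp: Z_def)
            thus ?thesis using False by (simp add: q_def)
          qed
          thus ?case using g(3)[of z] elim by simp
        qed
      qed
      ultimately show "((\<lambda>z. u z / (z - 0) ^ nat (zorder u 0)) \<longlongrightarrow> g 0 * (\<Prod>a\<in>Z-{0}. (0 - a) ^ k a)) (at 0)"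
        by (rule Lim_transform_eventually)
    qed (use u in \<open>auto simp: nz_entire_def filterlim_ident\<close>)
    have g0: "g 0 \<noteq> 0" using g(2) r R0(1) by auto
    have "ln (norm (zor_poly u 0 0)) = ln (norm (g 0)) + (\<Sum>a\<in>Z-{0}. k a * ln (norm a))"
    proof -
      have "norm (zor_poly u 0 0) = norm (g 0) * (\<Prod>x\<in>Z - {0}. norm x ^ k x)"
        by (simp add: zp norm_mult prod_norm[symmetric] norm_power)
      moreover have "ln (\<Prod>x\<in>Z - {0}. norm x ^ k x) = (\<Sum>x\<in>Z - {0}. ln (norm x ^ k x))"
        by (rule ln_prod) (use finZ in auto)
      moreover have "(\<Prod>x\<in>Z - {0}. norm x ^ k x) > 0" by (rule prod_pos) auto
      ultimately show ?thesis using g0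
        by (simp add: ln_mult ln_realpow)
    qed
    moreover have "(\<Sum>a\<in>Z. k a * wt r a) = (\<Sum>a\<in>Z. k a * ln r) - (\<Sum>a\<in>Z. k a * (if a = 0 then 0 else ln (norm a)))"
      unfolding sum_subtractf[symmetric]
      by (intro sum.cong refl) (use r in \<open>auto simp: wt_def ln_div algebra_simps\<close>)
    moreover have "(\<Sum>a\<in>Z. k a * (if a = 0 then 0 else ln (norm a))) = (\<Sum>a\<in>Z-{0}. k a * ln (norm a))"
      using finZ by (intro sum.mono_neutral_cong_right) auto
    moreover have "zcount u r = (\<Sum>a\<in>Z. k a * wt r a)"
      unfolding zcount_def Z_def[symmetric] k by simp
    moreover have "Re (h 0) = ln (norm (g 0)) + (\<Sum>a\<in>Z. k a * ln r)"
    proof -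
      have "exp (Re (h 0)) = norm (g 0) * norm (p 0)"
        using h(2)[OF S0] by (metis norm_exp_eq_Re norm_mult)
      also have "norm (p 0) = (\<Prod>a\<in>Z. r ^ k a)"
        using r by (simp add: p_def prod_norm[symmetric] norm_power norm_divide power2_eq_square norm_mult)
      finally have "Re (h 0) = ln (norm (g 0) * (\<Prod>a\<in>Z. r ^ k a))"
        by (metis ln_exp)
      also have "\<dots> = ln (norm (g 0)) + (\<Sum>a\<in>Z. k a * ln r)"
      proof -
        have "ln (\<Prod>a\<in>Z. r ^ k a) = (\<Sum>a\<in>Z. ln (r ^ k a))"
          by (rule ln_prod) (use finZ r in auto)
        moreover have "(\<Prod>a\<in>Z. r ^ k a) > 0" by (rule prod_pos) (use r in auto)
        ultimately show ?thesis
          using r g0 by (simp add: ln_mult ln_realpow)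
      qed
      finally show ?thesis .
    qed
    ultimately show "Re (h 0) = nu u r"
      by (simp add: nu_def)
  qed
qed

section \<open>Poisson's formula, Harnack's inequality and zero-free radii\<close>

lemma poisson_formula:
  fixes h :: "complex \<Rightarrow> complex"
  assumes h: "h holomorphic_on cball 0 r" and z: "norm z < r"
  shows   "((\<lambda>t. Re (h (of_real r * cis t)) * ((r\<^sup>2 - (norm z)\<^sup>2) / (norm (of_real r * cis t - z))\<^sup>2))
             has_integral (2 * pi * Re (h z))) {0..2 * pi}"
proof -
  have r: "r > 0" using z norm_ge_zero[of z] by linarith
  have den: "of_real r ^ 2 - cnj z * w \<noteq> 0" if "w \<in> cball 0 r" for w
    using blaschke_factor_norm(3)[OF z, of w] that by simp
  have 1: "((\<lambda>w. h w / (w - z)) has_contour_integral (2 * of_real pi * \<i> * h z)) (circlepath 0 r)"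
    by (rule Cauchy_integral_circlepath_simple) (use h z in auto)
  \<comment> \<open>For z \<noteq> 0 this integrand has its pole at the reflected point r^2 / cnj z
    outside the disc. Added to Cauchy's kernel it produces the real Poisson kernel.\<close>
  have 2: "((\<lambda>w. h w * cnj z / (of_real r ^ 2 - cnj z * w)) has_contour_integral 0) (circlepath 0 r)"
    by (rule Cauchy_theorem_convex_simple[where S = "cball 0 r"])
       (use h den r in \<open>auto intro!: holomorphic_intros simp: path_image_circlepath\<close>)
  have "((\<lambda>w. h w / (w - z) + h w * cnj z / (of_real r ^ 2 - cnj z * w)) has_contour_integral
          (2 * of_real pi * \<i> * h z)) (part_circlepath 0 r 0 (2 * pi))"
    using has_contour_integral_add[OF 1 2] by (simp add: circlepath_def)
  then have "((\<lambda>t. (\<lambda>w. h w / (w - z) + h w * cnj z / (of_real r ^ 2 - cnj z * w)) (0 + of_real r * cis t) * of_real r * \<i> * cis t)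
      has_integral (2 * of_real pi * \<i> * h z)) {0..2 * pi}"
    by (subst (asm) has_contour_integral_part_circlepath_iff) auto
  from has_integral_mult_right[OF this, of "- \<i>"]
  have "((\<lambda>t. h (of_real r * cis t) * of_real ((r\<^sup>2 - (norm z)\<^sup>2) / (norm (of_real r * cis t - z))\<^sup>2))
      has_integral (of_real (2 * pi) * h z)) {0..2 * pi}"
  proof (rule has_integral_eq_rhs[OF has_integral_eq, rotated])
    fix t assume "t \<in> {0..2 * pi}"
    define w where "w = of_real r * cis t"
    have w: "norm w = r" using r by (simp add: w_def norm_mult)
    have wc: "w * cnj w = of_real r ^ 2" 
      using complex_norm_square[of w] w by simp
    have wz: "w - z \<noteq> 0" "cnj w - cnj z \<noteq> 0" "w \<noteq> 0" using w z r by auto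
    have d: "of_real r ^ 2 - cnj z * w = w * (cnj w - cnj z)" by (simp add: wc[symmetric] algebra_simps)
    have "(h w / (w - z) + h w * cnj z / (of_real r ^ 2 - cnj z * w)) * w =
      h w * ((w * (cnj w - cnj z) + cnj z * (w - z)) / ((w - z) * (cnj w - cnj z)))"
    proof -
      have "(H / x + H * c / (w * y)) * w = H * ((w * y + c * x) / (x * y))" if "x \<noteq> 0" "y \<noteq> 0" for H x y c :: complex
        using that wz(3) by (simp add: field_simps)
      from this[OF wz(1,2)] show ?thesis unfolding d .
    qed
    also have "w * (cnj w - cnj z) + cnj z * (w - z) = of_real (r\<^sup>2 - (norm z)\<^sup>2)"
      using wc complex_norm_square[of z] by (simp add: algebra_simps)
    also have "(w - z) * (cnj w - cnj z) = of_real ((norm (w - z))\<^sup>2)"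
      using complex_norm_square[of "w - z"] by simp
    finally show "- \<i> * ((\<lambda>w. h w / (w - z) + h w * cnj z / (of_real r ^ 2 - cnj z * w)) (0 + of_real r * cis t) * of_real r * \<i> * cis t)
      = h (of_real r * cis t) * of_real ((r\<^sup>2 - (norm z)\<^sup>2) / (norm (of_real r * cis t - z))\<^sup>2)"
      by (simp add: w_def mult_ac)
  qed simp
  from has_integral_Re[OF this] show ?thesis
    by (simp del: of_real_divide of_real_diff of_real_power)
qed

lemma mean_value_Re:
  assumes "h holomorphic_on cball 0 r" "r > 0"
  shows   "((\<lambda>t. Re (h (of_real r * cis t))) has_integral (2 * pi * Re (h 0))) {0..2 * pi}"
  using poisson_formula[OF assms(1), of 0] assms(2) by (simp add: norm_mult)

lemma circle_continuous:
  assumes "continuous_on (sphere 0 r) h" "r > 0"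
  shows   "continuous_on X (\<lambda>t. h (of_real r * cis t))"
  by (rule continuous_on_compose2[OF assms(1)])
     (use assms in \<open>auto intro!: continuous_intros simp: norm_mult\<close>)

lemma poisson_kernel_bounds:
  assumes "norm w = r" "norm z < r"
  shows   "(r\<^sup>2 - (norm z)\<^sup>2) / (norm (w - z))\<^sup>2 \<le> (r + norm z) / (r - norm z)"
          "(r - norm z) / (r + norm z) \<le> (r\<^sup>2 - (norm z)\<^sup>2) / (norm (w - z))\<^sup>2"
proof -
  have d: "r - norm z > 0" "r + norm z > 0" using assms norm_ge_zero[of z] by linarith+
  have 1: "r - norm z \<le> norm (w - z)" "norm (w - z) \<le> r + norm z"
    using assms norm_triangle_ineq2[of w z] norm_triangle_ineq4[of w z] by auto
  have sq: "(r - norm z)\<^sup>2 \<le> (norm (w - z))\<^sup>2" "(norm (w - z))\<^sup>2 \<le> (r + norm z)\<^sup>2"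
    using 1 d by (auto intro!: power_mono)
  have e: "r\<^sup>2 - (norm z)\<^sup>2 = (r - norm z) * (r + norm z)" by (simp add: power2_eq_square algebra_simps)
  have pos: "(norm (w - z))\<^sup>2 > 0" using sq(1) d by (smt (verit) zero_less_power)
  have "(r\<^sup>2 - (norm z)\<^sup>2) / (norm (w - z))\<^sup>2 \<le> (r\<^sup>2 - (norm z)\<^sup>2) / (r - norm z)\<^sup>2"
    using sq d pos by (intro divide_left_mono) (auto simp: e)
  also have "\<dots> = (r + norm z) / (r - norm z)"
    unfolding e using d by (simp add: power2_eq_square)
  finally show "(r\<^sup>2 - (norm z)\<^sup>2) / (norm (w - z))\<^sup>2 \<le> (r + norm z) / (r - norm z)" .
  have "(r - norm z) / (r + norm z) = (r\<^sup>2 - (norm z)\<^sup>2) / (r + norm z)\<^sup>2"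
    unfolding e using d by (simp add: power2_eq_square)
  also have "\<dots> \<le> (r\<^sup>2 - (norm z)\<^sup>2) / (norm (w - z))\<^sup>2"
    using sq d pos by (intro divide_left_mono) (auto simp: e)
  finally show "(r - norm z) / (r + norm z) \<le> (r\<^sup>2 - (norm z)\<^sup>2) / (norm (w - z))\<^sup>2" .
qed

lemma holomorphic_cball_sphere: "h holomorphic_on cball 0 r \<Longrightarrow> continuous_on (sphere 0 r) h"
  by (meson continuous_on_subset holomorphic_on_imp_continuous_on sphere_cball)

text \<open>Negative boundary values are discarded before the kernel is estimated from above. What
  remains is a proximity function when Re h is the logarithm of a modulus on the circle.\<close>

lemma poisson_le:
  assumes h: "h holomorphic_on cball 0 r" and z: "norm z < r"
  shows   "Re (h z) \<le> (r + norm z) / (r - norm z) * 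
             (1 / (2 * pi) * integral {0..2 * pi} (\<lambda>t. max 0 (Re (h (of_real r * cis t)))))"
proof -
  have r: "r > 0" using z norm_ge_zero[of z] by linarith
  have cont: "continuous_on {0..2 * pi} (\<lambda>t. max 0 (Re (h (of_real r * cis t))))"
    by (intro continuous_intros circle_continuous holomorphic_cball_sphere h r)
  have "2 * pi * Re (h z) \<le> (r + norm z) / (r - norm z) * integral {0..2 * pi} (\<lambda>t. max 0 (Re (h (of_real r * cis t))))"
    (is "_ \<le> ?c * ?I")
  proof (rule has_integral_le[OF poisson_formula[OF h z]])
    show "((\<lambda>t. (r + norm z) / (r - norm z) * max 0 (Re (h (of_real r * cis t)))) has_integral
        (r + norm z) / (r - norm z) * integral {0..2 * pi} (\<lambda>t. max 0 (Re (h (of_real r * cis t))))) {0..2 * pi}"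
      by (intro has_integral_mult_right integrable_integral integrable_continuous_real cont)
  next
    fix t
    have w: "norm (of_real r * cis t) = r" using r by (simp add: norm_mult)
    have nn: "0 \<le> (r\<^sup>2 - (norm z)\<^sup>2) / (norm (of_real r * cis t - z))\<^sup>2"
      using z by (intro divide_nonneg_nonneg) (auto intro!: power_mono)
    have "Re (h (of_real r * cis t)) * ((r\<^sup>2 - (norm z)\<^sup>2) / (norm (of_real r * cis t - z))\<^sup>2) \<le> 
      max 0 (Re (h (of_real r * cis t))) * ((r\<^sup>2 - (norm z)\<^sup>2) / (norm (of_real r * cis t - z))\<^sup>2)"
      by (intro mult_right_mono nn) auto
    also have "\<dots> \<le> max 0 (Re (h (of_real r * cis t))) * ((r + norm z) / (r - norm z))"
      by (intro mult_left_mono poisson_kernel_bounds w z) auto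
    finally show "Re (h (of_real r * cis t)) * ((r\<^sup>2 - (norm z)\<^sup>2) / (norm (of_real r * cis t - z))\<^sup>2) \<le>
      (r + norm z) / (r - norm z) * max 0 (Re (h (of_real r * cis t)))" by (simp add: mult.commute)
  qed
  moreover have "X \<le> c * (1 / (2 * pi) * Y)" if "2 * pi * X \<le> c * Y" for X Y c :: real
  proof -
    have "X \<le> c * Y / (2 * pi)" using that by (simp add: pos_le_divide_eq mult.commute)
    thus ?thesis by simp
  qed
  ultimately show ?thesis by blast
qed

text \<open>The lower bound for the kernel can be integrated because the boundary values are
  nonnegative, and their mean is \<open>Re (h 0)\<close>.\<close>

lemma harnack_ge:
  assumes h: "h holomorphic_on cball 0 r" and z: "norm z < r"
    and nn: "\<And>w. norm w = r \<Longrightarrow> Re (h w) \<ge> 0"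
  shows   "(r - norm z) / (r + norm z) * Re (h 0) \<le> Re (h z)"
proof -
  have r: "r > 0" using z norm_ge_zero[of z] by linarith
  have "(r - norm z) / (r + norm z) * (2 * pi * Re (h 0)) \<le> 2 * pi * Re (h z)"
  proof (rule has_integral_le[OF has_integral_mult_right[OF mean_value_Re[OF h r]] poisson_formula[OF h z]])
    fix t
    have w: "norm (of_real r * cis t) = r" using r by (simp add: norm_mult)
    show "(r - norm z) / (r + norm z) * Re (h (of_real r * cis t)) \<le>
      Re (h (of_real r * cis t)) * ((r\<^sup>2 - (norm z)\<^sup>2) / (norm (of_real r * cis t - z))\<^sup>2)"
      using mult_left_mono[OF poisson_kernel_bounds(2)[OF w z] nn[OF w]] by (simp add: mult.commute)
  qed
  then have "2 * pi * ((r - norm z) / (r + norm z) * Re (h 0)) \<le> 2 * pi * Re (h z)"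
    by (simp only: mult.left_commute)
  thus ?thesis by (subst (asm) mult_le_cancel_left_pos) auto
qed

text \<open>Finitely many zeros occupy only finitely many moduli of the interval.\<close>

lemma generic_radius:
  assumes "nz_entire u" "a < b" "0 \<le> a"
  obtains R where "a < R" "R < b" "\<And>z. norm z = R \<Longrightarrow> u z \<noteq> 0"
proof -
  have "finite (norm ` {z. norm z \<le> b \<and> u z = 0})"
    using nz_entire_finite_zeros'[OF assms(1)] by blast
  moreover have "infinite {a<..<b}" using assms(2) by (simp add: infinite_Ioo)
  ultimately have "infinite ({a<..<b} - norm ` {z. norm z \<le> b \<and> u z = 0})"
    using Diff_infinite_finite by blast
  then obtain R where "R \<in> {a<..<b} - norm ` {z. norm z \<le> b \<and> u z = 0}"
    using infinite_imp_nonempty by blast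
  then have R: "a < R" "R < b" "R \<notin> norm ` {z. norm z \<le> b \<and> u z = 0}" by auto
  moreover have "u z \<noteq> 0" if "norm z = R" for z
    using R that by (auto simp: image_iff)
  ultimately show ?thesis using that by blast
qed

section \<open>Convexity of the counting function and bounds for the maximum modulus\<close>

lemma zcount_extend:
  assumes "nz_entire u" "r \<le> R"
  shows   "zcount u r = (\<Sum>z | norm z \<le> R \<and> u z = 0. of_int (zorder u z) * (if norm z \<le> r then wt r z else 0))"
  unfolding zcount_def
  by (rule sum.mono_neutral_cong_left) (use nz_entire_finite_zeros'[OF assms(1)] assms in auto)

text \<open>Convexity of \<open>zcount\<close> in ln r: the number n of zeros up to R bounds the
  slope on [r, R] from above and the slope on [R, s] from below. The inequality is multiplied out
  because either logarithm may be 0.\<close>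

lemma zcount_slope:
  assumes u: "nz_entire u" and r: "1 \<le> r" "r \<le> R" "R \<le> s"
  shows   "(zcount u R - zcount u r) * ln (s / R) \<le> (zcount u s - zcount u R) * ln (R / r)"
proof -
  define Z where "Z = {z. norm z \<le> R \<and> u z = 0}"
  define n where "n = (\<Sum>z\<in>Z. real_of_int (zorder u z))"
  have "zcount u R - zcount u r = (\<Sum>z\<in>Z. of_int (zorder u z) * (wt R z - (if norm z \<le> r then wt r z else 0)))"
    unfolding zcount_extend[OF u r(2)] unfolding zcount_def Z_def[symmetric]
    by (simp add: sum_subtractf[symmetric] right_diff_distrib)
  also have "\<dots> \<le> (\<Sum>z\<in>Z. of_int (zorder u z) * ln (R / r))"
  proof (intro sum_mono mult_left_mono)
    fix z assume z: "z \<in> Z"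
    show "wt R z - (if norm z \<le> r then wt r z else 0) \<le> ln (R / r)"
    proof (cases "norm z \<le> r")
      case True
      thus ?thesis using r by (auto simp: wt_def ln_div)
    next
      case False
      hence "z \<noteq> 0" "r < norm z" using r by auto
      moreover have "R / norm z \<le> R / r" using False r by (intro divide_left_mono mult_pos_pos) auto
      ultimately show ?thesis using False r by (auto simp: wt_def)
    qed
  qed (use zorder_nonneg[OF u] in auto)
  also have "\<dots> = n * ln (R / r)" by (simp add: n_def sum_distrib_right)
  finally have 1: "zcount u R - zcount u r \<le> n * ln (R / r)" .
  have fin: "finite {z. norm z \<le> s \<and> u z = 0}" using nz_entire_finite_zeros'[OF u] .
  have "zcount u R + n * ln (s / R) = (\<Sum>z\<in>Z. of_int (zorder u z) * (wt R z + ln (s / R)))"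
    unfolding zcount_def Z_def[symmetric] n_def by (simp add: sum.distrib distrib_left sum_distrib_right)
  also have "\<dots> = (\<Sum>z\<in>Z. of_int (zorder u z) * wt s z)"
    by (intro sum.cong refl arg_cong2[of _ _ _ _ "(*)"]) (use r in \<open>auto simp: wt_def ln_div\<close>)
  also have "\<dots> \<le> zcount u s"
    unfolding zcount_def using r fin zorder_nonneg[OF u]
    by (intro sum_mono2) (auto simp: Z_def intro!: mult_nonneg_nonneg wt_nonneg)
  finally have 2: "n * ln (s / R) \<le> zcount u s - zcount u R" by simp
  have "(zcount u R - zcount u r) * ln (s / R) \<le> n * ln (R / r) * ln (s / R)"
    using 1 r by (intro mult_right_mono) auto
  also have "\<dots> = n * ln (s / R) * ln (R / r)" by simp
  also have "\<dots> \<le> (zcount u s - zcount u R) * ln (R / r)"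
    using 2 r by (intro mult_right_mono) auto
  finally show ?thesis .
qed

lemma zcount_mono:
  assumes u: "nz_entire u" and r: "1 \<le> r" "r \<le> R"
  shows   "zcount u r \<le> zcount u R"
proof -
  have "zcount u r = (\<Sum>z | norm z \<le> R \<and> u z = 0. of_int (zorder u z) * (if norm z \<le> r then wt r z else 0))"
    by (rule zcount_extend[OF u r(2)])
  also have "\<dots> \<le> zcount u R"
    unfolding zcount_def
  proof (intro sum_mono mult_left_mono)
    fix z assume "z \<in> {z. norm z \<le> R \<and> u z = 0}"
    moreover have "r / norm z \<le> R / norm z" using r by (intro divide_right_mono) auto
    ultimately show "(if norm z \<le> r then wt r z else 0) \<le> wt R z"
      using r wt_nonneg[of z R] by (auto simp: wt_def)
  qed (use zorder_nonneg[OF u] in auto)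
  finally show ?thesis .
qed

lemma nu_mono: "nz_entire u \<Longrightarrow> 1 \<le> r \<Longrightarrow> r \<le> R \<Longrightarrow> nu u r \<le> nu u R"
  using zcount_mono by (simp add: nu_def)

lemma jensen:
  assumes "nz_entire u" "r > 0" "\<And>z. norm z = r \<Longrightarrow> u z \<noteq> 0"
  shows   "((\<lambda>t. ln (norm (u (of_real r * cis t)))) has_integral 2 * pi * nu u r) {0..2 * pi}"
proof -
  obtain h where h: "h holomorphic_on cball 0 r" "Re (h 0) = nu u r"
    "\<And>z. norm z = r \<Longrightarrow> norm (u z) = exp (Re (h z))"
    using blaschke_majorant[OF assms] by metis
  show ?thesis
    using mean_value_Re[OF h(1) assms(2)] h(2,3) assms(2) by (simp add: norm_mult)
qed

lemma log_plus_exp: "log_plus (exp x) = max 0 x"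
  by (simp add: log_plus_def max_def)

text \<open>The Blaschke majorant has boundary values ln |u|, and the mean of their positive part is
  \<open>nevanlinna_m r u\<close>.\<close>

lemma poisson_entire:
  assumes "nz_entire u" "r > 0" "\<And>z. norm z = r \<Longrightarrow> u z \<noteq> 0" "norm z < r"
  shows   "norm (u z) \<le> exp ((r + norm z) / (r - norm z) * nevanlinna_m r u)"
proof -
  obtain h where h: "h holomorphic_on cball 0 r" 
    "\<And>z. norm z \<le> r \<Longrightarrow> norm (u z) \<le> exp (Re (h z))"
    "\<And>z. norm z = r \<Longrightarrow> norm (u z) = exp (Re (h z))"
    using blaschke_majorant[OF assms(1-3)] by metis
  have "nevanlinna_m r u = 1 / (2 * pi) * integral {0..2 * pi} (\<lambda>t. max 0 (Re (h (of_real r * cis t))))"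
    unfolding nevanlinna_m_def using h(3) assms(2) by (simp add: norm_mult log_plus_exp)
  with poisson_le[OF h(1) assms(4)] h(2)[of z] assms(4) show ?thesis
    by (smt (verit) exp_le_cancel_iff)
qed

lemma nu_le_sphere:
  assumes "nz_entire u" "r > 0" "\<And>z. norm z = r \<Longrightarrow> u z \<noteq> 0"
    and "\<And>z. norm z = r \<Longrightarrow> norm (u z) \<le> exp S"
  shows   "nu u r \<le> S"
proof -
  have "2 * pi * nu u r \<le> 2 * pi * S"
  proof (rule has_integral_le[OF jensen[OF assms(1-3)]])
    show "((\<lambda>_. S) has_integral 2 * pi * S) {0..2 * pi}"
      using has_integral_const_real[of S 0 "2 * pi"] by simp
    fix t
    have "norm (of_real r * cis t) = r" using assms(2) by (simp add: norm_mult)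
    from assms(3,4)[OF this] show "ln (norm (u (of_real r * cis t))) \<le> S"
      by (metis exp_gt_zero ln_exp ln_le_cancel_iff zero_less_norm_iff)
  qed
  thus ?thesis by simp
qed

text \<open>Zeros may lie on the circle of radius r; since \<open>nu\<close> is increasing, a
  zero-free radius below R can be used instead.\<close>

lemma nu_le:
  assumes "nz_entire u" "1 \<le> r" "r < R" and "\<And>z. norm z \<le> R \<Longrightarrow> norm (u z) \<le> exp S"
  shows   "nu u r \<le> S"
proof -
  obtain s where s: "r < s" "s < R" "\<And>z. norm z = s \<Longrightarrow> u z \<noteq> 0"
    using generic_radius[OF assms(1,3)] assms(2) by auto
  have "nu u r \<le> nu u s" using nu_mono[OF assms(1,2)] s(1) by simp
  also have "\<dots> \<le> S"
    by (rule nu_le_sphere[OF assms(1) _ s(3)]) (use s assms in auto)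
  finally show ?thesis .
qed

text \<open>Harnack's inequality applies to S - Re h, which is nonnegative on the circle and equals
  S - \<open>nu u R\<close> at the centre. Thus ln |u| exceeds its mean only by a fraction 2 \<rho>
  / R of S - \<open>nu u R\<close>.\<close>

lemma harnack_entire:
  assumes u: "nz_entire u" and R: "R > 0" "\<And>z. norm z = R \<Longrightarrow> u z \<noteq> 0"
    and S: "\<And>z. norm z = R \<Longrightarrow> norm (u z) \<le> exp S" and z: "norm z \<le> \<rho>" "\<rho> < R"
  shows   "norm (u z) \<le> exp (nu u R + 2 * \<rho> / R * (S - nu u R))"
proof -
  obtain h where h: "h holomorphic_on cball 0 R" "Re (h 0) = nu u R"
    "\<And>z. norm z \<le> R \<Longrightarrow> norm (u z) \<le> exp (Re (h z))"
    "\<And>z. norm z = R \<Longrightarrow> norm (u z) = exp (Re (h z))"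
    using blaschke_majorant[OF u R] by metis
  have nuS: "nu u R \<le> S" by (rule nu_le_sphere[OF u R S])
  have "(R - norm z) / (R + norm z) * Re (of_real S - h 0) \<le> Re (of_real S - h z)"
  proof (rule harnack_ge)
    show "(\<lambda>z. of_real S - h z) holomorphic_on cball 0 R" by (intro holomorphic_intros h)
    show "norm z < R" using z by simp
    show "Re (of_real S - h w) \<ge> 0" if "norm w = R" for w
      using h(4)[OF that] S[OF that] by simp
  qed
  moreover have "(R - norm z) / (R + norm z) = 1 - 2 * norm z / (R + norm z)"
  proof -
    have "R + norm z \<noteq> 0" using R(1) norm_ge_zero[of z] by linarith
    thus ?thesis by (simp add: field_simps)
  qed
  moreover have "2 * norm z / (R + norm z) \<le> 2 * \<rho> / R"
    using z R(1) norm_ge_zero[of z] by (intro frac_le) linarith+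
  then have "2 * norm z / (R + norm z) * (S - nu u R) \<le> 2 * \<rho> / R * (S - nu u R)"
    using nuS by (intro mult_right_mono) auto
  ultimately have "Re (h z) \<le> nu u R + 2 * \<rho> / R * (S - nu u R)"
    using h(2) by (simp add: algebra_simps)
  moreover have "norm (u z) \<le> exp (Re (h z))" using h(3) z by auto
  ultimately show ?thesis by (meson exp_le_cancel_iff order_trans)
qed

text \<open>There are two losses. Passing from r to a radius between K r and 2 K r costs ln (2 K) /
  ln (s / (2 K)) by convexity; passing from the mean there to the modulus on the disc of radius
  \<kappa> r costs 2 \<kappa> / K by Harnack. Both are small if K is large and s is much larger
  still.\<close>

lemma growth_bound:
  assumes u: "nz_entire u" and r: "1 \<le> r" and K: "1 \<le> \<kappa>" "2 * \<kappa> \<le> K" "2 * K < s"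
    and S: "\<And>z. norm z \<le> 2 * s * r \<Longrightarrow> norm (u z) \<le> exp S" and z: "norm z \<le> \<kappa> * r"
  shows   "norm (u z) \<le> exp (nu u r + (ln (2 * K) / ln (s / (2 * K)) + 2 * \<kappa> / K) * (S - nu u 1))"
proof -
  have Kr: "K * r < 2 * K * r" "0 \<le> K * r" using K r by auto
  obtain R where R: "K * r < R" "R < 2 * K * r" "\<And>z. norm z = R \<Longrightarrow> u z \<noteq> 0"
    using generic_radius[OF u Kr] by blast
  have "1 * r \<le> K * r" "\<kappa> * r \<le> K * r" "2 * K * r \<le> s * r" using K r by (intro mult_right_mono; simp)+
  with R(1,2) r have ord: "r \<le> R" "1 \<le> R" "R \<le> s * r" "\<kappa> * r < R" "0 < R" by linarith+
  have sp: "0 < s" "0 < s * r" using K r by (auto intro: mult_pos_pos)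
  have sr: "nu u (s * r) \<le> S"
    by (rule nu_le[OF u _ _ S]) (use ord sp r in auto)
  have RS: "nu u R \<le> S"
    using nu_mono[OF u ord(2,3)] sr by linarith
  have nu1: "nu u 1 \<le> nu u R" using nu_mono[OF u _ ord(2)] by simp
  have lnpos: "ln (s / (2 * K)) > 0" using K by simp
  have le1: "ln (s / (2 * K)) \<le> ln (s * r / R)"
  proof -
    have "s / (2 * K) = s * r / (2 * K * r)" using r by simp
    also have "\<dots> \<le> s * r / R" using R(2) ord sp K r by (intro divide_left_mono mult_pos_pos) auto
    finally show ?thesis using ord sp K by simp
  qed
  have le2: "ln (R / r) \<le> ln (2 * K)"
  proof -
    have "R / r \<le> 2 * K" "0 < R / r" using R(2) r ord by (simp_all add: divide_le_eq)
    thus ?thesis by simp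
  qed
  have nn: "0 \<le> nu u R - nu u r" using nu_mono[OF u r ord(1)] by simp
  have "(nu u R - nu u r) * ln (s / (2 * K)) \<le> (nu u R - nu u r) * ln (s * r / R)"
    using le1 nn by (intro mult_left_mono)
  also have "\<dots> \<le> (nu u (s * r) - nu u R) * ln (R / r)"
    using zcount_slope[OF u r ord(1,3)] by (simp add: nu_def)
  also have "\<dots> \<le> (S - nu u 1) * ln (2 * K)"
    using sr nu1 RS le2 ord r nu_mono[OF u ord(2,3)] by (intro mult_mono) auto
  finally have "nu u R - nu u r \<le> ln (2 * K) / ln (s / (2 * K)) * (S - nu u 1)"
    using lnpos by (simp add: field_simps)
  moreover have "2 * (\<kappa> * r) / R * (S - nu u R) \<le> 2 * \<kappa> / K * (S - nu u 1)"
  proof (rule mult_mono)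
    have "2 * (\<kappa> * r) / R \<le> 2 * (\<kappa> * r) / (K * r)"
      using R(1) ord K r by (intro divide_left_mono mult_pos_pos) auto
    thus "2 * (\<kappa> * r) / R \<le> 2 * \<kappa> / K" using r by simp
  qed (use nu1 RS K in auto)
  moreover have "norm (u z) \<le> exp (nu u R + 2 * (\<kappa> * r) / R * (S - nu u R))"
  proof (rule harnack_entire[OF u ord(5) R(3) S z ord(4)])
    fix w assume "norm w = R"
    thus "norm w \<le> 2 * s * r" using ord sp by auto
  qed
  ultimately show ?thesis
    by (smt (verit) exp_le_cancel_iff distrib_right)
qed

section \<open>Canonical products of order zero\<close>

text \<open>Bounds of the shape exp x - 1 are stable under products, because (exp x - 1) (exp y - 1)
  + (exp x - 1) + (exp y - 1) collapses to exp (x + y) - 1.\<close>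

lemma norm_mult_minus_1_le:
  fixes u v :: complex
  assumes "norm (u - 1) \<le> exp x - 1" "norm (v - 1) \<le> exp y - 1"
  shows   "norm (u * v - 1) \<le> exp (x + y) - 1"
proof -
  have "u * v - 1 = (u - 1) * (v - 1) + (u - 1) + (v - 1)" by (simp add: algebra_simps)
  then have "norm (u * v - 1) \<le> norm (u - 1) * norm (v - 1) + norm (u - 1) + norm (v - 1)"
    by (metis norm_mult norm_triangle_le norm_triangle_ineq add_mono order_refl)
  also have "\<dots> \<le> (exp x - 1) * (exp y - 1) + (exp x - 1) + (exp y - 1)"
    using assms order_trans[OF norm_ge_zero assms(1)] by (intro add_mono mult_mono) auto
  also have "\<dots> = exp (x + y) - 1" by (simp add: exp_add algebra_simps)
  finally show ?thesis .
qed

lemma norm_prod_power_minus_1_le: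
  fixes f :: "'a \<Rightarrow> complex"
  shows "norm ((\<Prod>a\<in>S. (1 - f a) ^ k a) - 1) \<le> exp (\<Sum>a\<in>S. real (k a) * norm (f a)) - 1"
proof (induction S rule: infinite_finite_induct)
  case (insert a S)
  have "norm ((1 - x) ^ m - 1) \<le> exp (real m * norm x) - 1" for x :: complex and m
  proof (induction m)
    case (Suc m)
    have "norm ((1 - x) - 1) \<le> exp (norm x) - 1"
    proof -
      have "norm ((1 - x) - 1) = norm x" by simp
      with exp_ge_add_one_self[of "norm x"] show ?thesis by linarith
    qed
    from norm_mult_minus_1_le[OF this Suc.IH] show ?case by (simp add: algebra_simps)
  qed simp
  from norm_mult_minus_1_le[OF this insert.IH] insert.hyps show ?case by simp
qed auto

text \<open>This trades a logarithm for an arbitrarily small power. For x > 1 it comes from ln y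
  \<le> y - 1 at y = (2 x) powr \<delta>.\<close>

lemma ln_1_plus_le_powr:
  fixes x \<delta> :: real
  assumes "x \<ge> 0" "0 < \<delta>" "\<delta> \<le> 1"
  shows   "ln (1 + x) \<le> 2 * x powr \<delta> / \<delta>"
proof (cases "x \<le> 1")
  case True
  have "ln (1 + x) \<le> x" using ln_add_one_self_le_self assms by auto
  also have "\<dots> \<le> x powr \<delta>"
  proof (cases "x = 0")
    case False
    thus ?thesis using powr_mono'[of \<delta> 1 x] assms True by simp
  qed auto
  also have "\<dots> \<le> 2 * x powr \<delta> / \<delta>"
  proof -
    have "x powr \<delta> * \<delta> \<le> x powr \<delta> * 2" using assms by (intro mult_left_mono) auto
    thus ?thesis using assms by (simp add: field_simps)
  qed
  finally show ?thesis .
next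
  case False
  have "\<delta> * ln (2 * x) = ln ((2 * x) powr \<delta>)" using False by (simp add: ln_powr)
  also have "\<dots> \<le> (2 * x) powr \<delta> - 1" using False by (intro ln_le_minus_one) auto
  also have "\<dots> \<le> 2 powr \<delta> * x powr \<delta>" using False by (simp add: powr_mult)
  also have "\<dots> \<le> 2 powr 1 * x powr \<delta>" using assms by (intro mult_right_mono powr_mono) auto
  finally have "ln (2 * x) \<le> 2 * x powr \<delta> / \<delta>" using assms by (simp add: field_simps)
  moreover have "ln (1 + x) \<le> ln (2 * x)" using False by simp
  ultimately show ?thesis by linarith
qed

text \<open>The Weierstrass test on each disc; the majorant may depend on the disc and binds only
  for large j, so the factors vanishing inside the disc do no harm.\<close>

lemma entire_infinite_product:
  fixes G :: "nat \<Rightarrow> complex \<Rightarrow> complex"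
  assumes hol: "\<And>j. G j holomorphic_on UNIV"
    and M: "\<And>R. R > 0 \<Longrightarrow> \<exists>M. summable M \<and> (\<forall>\<^sub>F j in sequentially. \<forall>z\<in>cball 0 R. norm (G j z - 1) \<le> M j)"
  shows "convergent_prod (\<lambda>j. G j z)" "(\<lambda>z. \<Prod>j. G j z) holomorphic_on UNIV"
proof -
  have conv: "convergent_prod (\<lambda>j. G j z)" for z
  proof -
    obtain M where M: "summable M" "\<forall>\<^sub>F j in sequentially. \<forall>w\<in>cball 0 (norm z + 1). norm (G j w - 1) \<le> M j"
      using M[of "norm z + 1"] by (meson add_nonneg_pos norm_ge_zero zero_less_one)
    have "summable (\<lambda>j. norm (G j z - 1))"
      by (rule summable_comparison_test_ev[OF _ M(1)]) (use M(2) in \<open>auto elim!: eventually_mono\<close>)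
    thus ?thesis
      by (intro abs_convergent_prod_imp_convergent_prod summable_imp_abs_convergent_prod)
  qed
  thus "convergent_prod (\<lambda>j. G j z)" .
  have lim: "uniform_limit (cball 0 R) (\<lambda>N z. \<Prod>j<N. G j z) (\<lambda>z. \<Prod>j. G j z) sequentially" if R: "R > 0" for R
  proof -
    obtain M where M: "summable M" "\<forall>\<^sub>F j in sequentially. \<forall>w\<in>cball 0 R. norm (G j w - 1) \<le> M j"
      using M[OF R] by blast
    have "uniformly_convergent_on (cball 0 R) (\<lambda>N z. \<Prod>j<N. G j z)"
    proof (rule uniformly_convergent_on_prod')
      show "continuous_on (cball 0 R) (G n)" for n
        using hol holomorphic_on_imp_continuous_on holomorphic_on_subset by blast
      show "uniformly_convergent_on (cball 0 R) (\<lambda>N z. \<Sum>j<N. norm (G j z - 1))"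
        by (rule Weierstrass_m_test'_ev[OF _ M(1)]) (use M(2) in simp)
    qed auto
    then obtain g where g: "uniform_limit (cball 0 R) (\<lambda>N z. \<Prod>j<N. G j z) g sequentially"
      by (auto simp: uniformly_convergent_on_def)
    also have "?this \<longleftrightarrow> ?thesis"
    proof (intro uniform_limit_cong)
      fix z :: complex assume "z \<in> cball 0 R"
      from tendsto_uniform_limitI[OF g this]
      \<comment> \<open>\<open>convergent_prod_LIMSEQ\<close> is about products over j \<le> n,
        hence the shift by one.\<close>
      have "(\<lambda>n. \<Prod>j<Suc n. G j z) \<longlonglongrightarrow> g z" by (rule LIMSEQ_Suc)
      moreover have "(\<lambda>n. \<Prod>j<Suc n. G j z) \<longlonglongrightarrow> (\<Prod>j. G j z)"
        using convergent_prod_LIMSEQ[OF conv[of z]] unfolding lessThan_Suc_atMost by simp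
      ultimately show "g z = (\<Prod>j. G j z)"
        using LIMSEQ_unique by blast
    qed auto
    finally show ?thesis .
  qed
  show "(\<lambda>z. \<Prod>j. G j z) holomorphic_on UNIV"
  proof (rule holomorphic_uniform_sequence)
    show "(\<lambda>z. \<Prod>j<n. G j z) holomorphic_on UNIV" for n
      by (intro holomorphic_intros hol)
    fix z :: complex
    have "uniform_limit (cball z 1) (\<lambda>N z. \<Prod>j<N. G j z) (\<lambda>z. \<Prod>j. G j z) sequentially"
      by (rule uniform_limit_on_subset[OF lim[of "norm z + 1"]])
         (auto simp: cball_subset_cball_iff intro: add_nonneg_pos)
    thus "\<exists>d>0. cball z d \<subseteq> UNIV \<and> uniform_limit (cball z d) (\<lambda>N z. \<Prod>j<N. G j z) (\<lambda>z. \<Prod>j. G j z) sequentially"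
      by (intro exI[of _ 1]) auto
  qed auto
qed

lemma power_powr: "x > 0 \<Longrightarrow> ((x::real) ^ j) powr \<delta> = (x powr \<delta>) ^ j"
  by (simp add: powr_realpow[symmetric] powr_powr mult.commute)

text \<open>A Weierstrass product of genus zero: the counting function grows slower than every
  power, so no convergence factors are needed. Grouping the zeros in dyadic annuli avoids an
  enumeration with multiplicity; block j has at most n(2^(j+1)) zeros, all of modulus above
  2^j.\<close>

lemma canonical_product:
  fixes d :: "complex \<Rightarrow> nat"
  assumes fin: "\<And>R. finite {z. norm z \<le> R \<and> d z \<noteq> 0}"
    and growth: "\<And>\<epsilon>. \<epsilon> > 0 \<Longrightarrow> \<exists>C. \<forall>R\<ge>1. real (\<Sum>z | norm z \<le> R \<and> d z \<noteq> 0. d z) \<le> C * R powr \<epsilon>"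
  obtains B where "nz_entire B" "\<And>z. zorder B z = int (d z)"
    "\<And>\<epsilon>. \<epsilon> > 0 \<Longrightarrow> \<exists>C. \<forall>z. norm (B z) \<le> exp (C * (1 + norm z) powr \<epsilon>)"
proof -
  define n where "n = (\<lambda>R. real (\<Sum>z | norm z \<le> R \<and> d z \<noteq> 0. d z))"
  have growth': "\<exists>C. \<forall>R\<ge>1. n R \<le> C * R powr \<epsilon>" if "\<epsilon> > 0" for \<epsilon>
    using growth[OF that] by (simp only: n_def)
  define S where "S = (\<lambda>j. {z. (2::real) ^ j < norm z \<and> norm z \<le> 2 ^ Suc j \<and> d z \<noteq> 0})"
  define S0 where "S0 = {z. norm z \<le> 1 \<and> d z \<noteq> 0}"
  \<comment> \<open>Zeros in the closed unit disc go into a polynomial, because a zero at the origin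
    admits no factor 1 - z / a and the annuli start at modulus 1.\<close>
  define P where "P = (\<lambda>z. \<Prod>a\<in>S0. (z - a) ^ d a)"
  define G where "G = (\<lambda>j z. \<Prod>a\<in>S j. (1 - z / a) ^ d a)"
  have finS: "finite (S j)" for j by (rule finite_subset[OF _ fin[of "2 ^ Suc j"]]) (auto simp: S_def)
  have finS0: "finite S0" unfolding S0_def by (rule fin)
  have nz: "a \<noteq> 0" if "a \<in> S j" for a j using that by (auto simp: S_def)
  have sumS: "(\<Sum>a\<in>S j. real (d a)) \<le> n (2 ^ Suc j)" for j
    unfolding n_def of_nat_sum by (intro sum_mono2 fin) (auto simp: S_def)
  have n_nonneg: "n R \<ge> 0" for R unfolding n_def by (rule of_nat_0_le_iff)
  have lin_ent: "nz_entire (\<lambda>z. 1 - z / a)" for a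
    unfolding nz_entire_def by (auto intro!: exI[of _ 0] holomorphic_intros)
  have lin_ord: "zorder (\<lambda>z. 1 - z / a) z = (if z = a then 1 else 0)" if "a \<noteq> 0" for a z
  proof -
    have "(\<lambda>z. 1 - z / a) = (\<lambda>z. (- 1 / a) * (z - a))" using that by (auto simp: field_simps)
    moreover have "zorder (\<lambda>z. (- 1 / a) * (z - a)) z = zorder (\<lambda>z. z - a) z"
      using that by (intro zorder_cmult) auto
    ultimately show ?thesis by (simp add: zorder_linear')
  qed
  have G_ent: "nz_entire (G j)" for j
    unfolding G_def by (intro nz_entire_prod nz_entire_power lin_ent)
  have P_ent: "nz_entire P"
    unfolding P_def by (intro nz_entire_prod nz_entire_power nz_entire_linear)
  have G_ord: "zorder (G j) z = (if z \<in> S j then int (d z) else 0)" for j z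
  proof -
    have "zorder (G j) z = (\<Sum>a\<in>S j. zorder (\<lambda>z. (1 - z / a) ^ d a) z)"
      unfolding G_def by (intro zorder_prod' nz_entire_power lin_ent)
    also have "\<dots> = (\<Sum>a\<in>S j. if z = a then int (d a) else 0)"
      by (intro sum.cong refl) (simp add: zorder_power' lin_ent lin_ord nz)
    finally show ?thesis using finS by simp
  qed
  have P_ord: "zorder P z = (if z \<in> S0 then int (d z) else 0)" for z
  proof -
    have "zorder P z = (\<Sum>a\<in>S0. zorder (\<lambda>z. (z - a) ^ d a) z)"
      unfolding P_def by (intro zorder_prod' nz_entire_power nz_entire_linear)
    also have "\<dots> = (\<Sum>a\<in>S0. if z = a then int (d a) else 0)"
      by (intro sum.cong refl) (simp add: zorder_power' nz_entire_linear zorder_linear')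
    finally show ?thesis using finS0 by simp
  qed
  have quot: "norm (z / a) \<le> norm z / 2 ^ j" if "a \<in> S j" for z a j
    using that by (auto simp: S_def norm_divide intro!: divide_left_mono mult_pos_pos)
  have G_minus_1: "norm (G j z - 1) \<le> exp (n (2 ^ Suc j) * (norm z / 2 ^ j)) - 1" for j z
  proof -
    have "norm (G j z - 1) \<le> exp (\<Sum>a\<in>S j. real (d a) * norm (z / a)) - 1"
      unfolding G_def by (rule norm_prod_power_minus_1_le)
    also have "(\<Sum>a\<in>S j. real (d a) * norm (z / a)) \<le> (\<Sum>a\<in>S j. real (d a) * (norm z / 2 ^ j))"
      by (intro sum_mono mult_left_mono quot) auto
    also have "\<dots> \<le> n (2 ^ Suc j) * (norm z / 2 ^ j)"
      unfolding sum_distrib_right[symmetric] by (intro mult_right_mono sumS) auto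
    finally show ?thesis by simp
  qed
  have G_bound: "norm (G j z) \<le> exp (n (2 ^ Suc j) * ln (1 + norm z / 2 ^ j))" for j z
  proof -
    have pos: "0 < 1 + norm z / 2 ^ j" by (rule add_pos_nonneg) auto
    have "norm (G j z) = (\<Prod>a\<in>S j. norm (1 - z / a) ^ d a)"
      by (simp add: G_def prod_norm[symmetric] norm_power)
    also have "\<dots> \<le> (\<Prod>a\<in>S j. exp (real (d a) * ln (1 + norm z / 2 ^ j)))"
    proof (intro prod_mono conjI)
      fix a assume a: "a \<in> S j"
      have "norm (1 - z / a) \<le> 1 + norm (z / a)" by (metis norm_one norm_triangle_ineq4)
      also have "\<dots> \<le> 1 + norm z / 2 ^ j" using quot[OF a] by simp
      finally have "norm (1 - z / a) ^ d a \<le> (1 + norm z / 2 ^ j) ^ d a" by (intro power_mono) auto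
      also have "\<dots> = exp (real (d a) * ln (1 + norm z / 2 ^ j))"
        using pos by (simp add: exp_of_nat_mult)
      finally show "norm (1 - z / a) ^ d a \<le> exp (real (d a) * ln (1 + norm z / 2 ^ j))" .
    qed auto
    also have "\<dots> = exp ((\<Sum>a\<in>S j. real (d a)) * ln (1 + norm z / 2 ^ j))"
      by (simp add: exp_sum finS sum_distrib_right)
    also have "\<dots> \<le> exp (n (2 ^ Suc j) * ln (1 + norm z / 2 ^ j))"
      using sumS by (intro iffD2[OF exp_le_cancel_iff] mult_right_mono) auto
    finally show ?thesis .
  qed
  have M: "\<exists>M. summable M \<and> (\<forall>\<^sub>F j in sequentially. \<forall>z\<in>cball 0 R. norm (G j z - 1) \<le> M j)" if R: "R > 0" for R
  proof -
    \<comment> \<open>Any positive exponent below 1 would do: n(2^(j+1)) / 2^j then decays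
      geometrically, here with ratio 2^(-1/2).\<close>
    obtain C where C: "\<And>R. R \<ge> 1 \<Longrightarrow> n R \<le> C * R powr (1 / 2)"
      using growth'[of "1 / 2"] by auto
    define q where "q = (2 :: real) powr (- 1 / 2)"
    have q: "0 < q" "q < 1" using powr_less_mono[of "-1/2" 0 "2::real"] by (auto simp: q_def)
    define D where "D = \<bar>C\<bar> * 2 powr (1 / 2) * R"
    have bound: "n (2 ^ Suc j) * (norm z / 2 ^ j) \<le> D * q ^ j" if "z \<in> cball 0 R" for z j
    proof -
      have "n (2 ^ Suc j) * (norm z / 2 ^ j) \<le> \<bar>C\<bar> * (2 ^ Suc j) powr (1 / 2) * (R / 2 ^ j)"
      proof (rule mult_mono)
        have "n (2 ^ Suc j) \<le> C * (2 ^ Suc j) powr (1 / 2)" by (intro C) (simp add: one_le_power del: power_Suc)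
        also have "\<dots> \<le> \<bar>C\<bar> * (2 ^ Suc j) powr (1 / 2)" by (intro mult_right_mono) auto
        finally show "n (2 ^ Suc j) \<le> \<bar>C\<bar> * (2 ^ Suc j) powr (1 / 2)" .
      qed (use that R in \<open>auto intro!: divide_right_mono\<close>)
      also have "((2::real) ^ Suc j) powr (1 / 2) = 2 powr (1 / 2) * (2 powr (1 / 2)) ^ j"
        by (simp add: powr_mult power_powr)
      also have "\<bar>C\<bar> * (2 powr (1 / 2) * (2 powr (1 / 2)) ^ j) * (R / 2 ^ j) = D * (2 powr (1 / 2) / 2) ^ j"
        by (simp add: D_def power_divide)
      also have "2 powr (1 / 2) / (2::real) = q"
        unfolding q_def using powr_diff[of 2 "1/2" "1::real"] by simp
      finally show ?thesis .
    qed
    have "(\<lambda>j. D * q ^ j) \<longlonglongrightarrow> 0"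
      using q by (intro tendsto_mult_right_zero LIMSEQ_realpow_zero) auto
    then have "\<forall>\<^sub>F j in sequentially. D * q ^ j < 1"
      by (rule order_tendstoD) simp
    then have "\<forall>\<^sub>F j in sequentially. \<forall>z\<in>cball 0 R. norm (G j z - 1) \<le> 2 * (D * q ^ j)"
    proof eventually_elim
      case (elim j)
      have D0: "0 \<le> D * q ^ j" using q R by (simp add: D_def)
      show ?case
      proof
        fix z :: complex assume z: "z \<in> cball 0 R"
        have "norm (G j z - 1) \<le> exp (D * q ^ j) - 1"
          using G_minus_1[of j z] bound[OF z, of j] by (smt (verit) exp_le_cancel_iff)
        also have "\<dots> \<le> D * q ^ j + (D * q ^ j)\<^sup>2"
          using exp_bound[of "D * q ^ j"] D0 elim by simp
        also have "\<dots> \<le> 2 * (D * q ^ j)"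
          using D0 elim by (simp add: power2_eq_square mult_left_le)
        finally show "norm (G j z - 1) \<le> 2 * (D * q ^ j)" .
      qed
    qed
    moreover have "summable (\<lambda>j. 2 * (D * q ^ j))"
      using q by (intro summable_mult summable_geometric) auto
    ultimately show ?thesis by blast
  qed
  have M': "\<exists>M. summable M \<and> (\<forall>\<^sub>F j in sequentially. \<forall>z\<in>cball 0 R. norm (G (j + N) z - 1) \<le> M j)" if R: "R > 0" for R N
  proof -
    obtain M where "summable M" "\<forall>\<^sub>F j in sequentially. \<forall>z\<in>cball 0 R. norm (G j z - 1) \<le> M j"
      using M[OF R] by blast
    thus ?thesis
      by (intro exI[of _ "\<lambda>j. M (j + N)"] conjI)
         (auto simp: summable_iff_shift intro: eventually_compose_filterlim[OF _ filterlim_add_const_nat_at_top])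
  qed
  \<comment> \<open>Tails of the product: \<open>T N\<close> has no zeros in |z| < 2^N, so the order
    at such a point is decided by P and the first N blocks.\<close>
  define T where "T = (\<lambda>N z. \<Prod>j. G (j + N) z)"
  have G_hol: "G j holomorphic_on UNIV" for j using G_ent nz_entire_holo by blast
  have T_conv: "convergent_prod (\<lambda>j. G (j + N) z)" and T_hol: "T N holomorphic_on UNIV" for N z
    unfolding T_def by (rule entire_infinite_product[of "\<lambda>j. G (j + N)", OF G_hol M']; assumption)+
  have T_nz: "T N z \<noteq> 0" if "norm z < 2 ^ N" for N z
  proof
    assume "T N z = 0"
    moreover have "(\<lambda>j. G (j + N) z) has_prod T N z"
      unfolding T_def using T_conv by blast
    ultimately obtain j where "G (j + N) z = 0" by (auto simp: has_prod_eq_0_iff)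
    then have "z \<in> S (j + N)" using G_ord[of "j + N" z] zorder_pos[OF G_ent, of "j + N" z] by (auto split: if_splits)
    then have "2 ^ (j + N) < norm z" by (simp add: S_def)
    moreover have "(2::real) ^ N \<le> 2 ^ (j + N)" by (intro power_increasing) auto
    ultimately show False using that by linarith
  qed
  have T_ent: "nz_entire (T N)" for N
    unfolding nz_entire_def using T_hol T_nz[of 0 N] by auto
  \<comment> \<open>An initial segment can be split off where it does not vanish, and a punctured
    neighbourhood is enough to determine an order.\<close>
  have T_split: "eventually (\<lambda>w. T 0 w = T N w * (\<Prod>j<N. G j w)) (at z)" for N z
  proof -
    have "eventually (\<lambda>w. (\<Prod>j<N. G j w) \<noteq> 0) (at z)"
      by (intro nz_entire_eventually nz_entire_prod G_ent)
    thus ?thesis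
    proof eventually_elim
      case (elim w)
      show ?case
        unfolding T_def using prodinf_split_initial_segment[of "\<lambda>j. G j w" N] T_conv[of 0 w] elim by simp
    qed
  qed
  define B where "B = (\<lambda>z. P z * T 0 z)"
  show ?thesis
  proof
    show "nz_entire B" unfolding B_def by (intro nz_entire_mult P_ent T_ent)
    show "zorder B z = int (d z)" for z
    proof -
      obtain N where N: "norm z < 2 ^ N" using real_arch_pow[of 2 "norm z"] by auto
      have "zorder (T 0) z = zorder (\<lambda>w. T N w * (\<Prod>j<N. G j w)) z"
        by (rule zorder_cong[OF T_split refl])
      also have "\<dots> = zorder (T N) z + zorder (\<lambda>w. \<Prod>j<N. G j w) z"
        by (intro zorder_mult' T_ent nz_entire_prod G_ent)
      also have "zorder (T N) z = 0" using zorder_eq_0[OF T_ent] T_nz[OF N] by blast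
      also have "zorder (\<lambda>w. \<Prod>j<N. G j w) z = (\<Sum>j<N. if z \<in> S j then int (d z) else 0)"
        by (simp add: zorder_prod' G_ent G_ord)
      finally have T0: "zorder (T 0) z = (\<Sum>j<N. if z \<in> S j then int (d z) else 0)" by simp
      have "zorder B z = zorder P z + zorder (T 0) z"
        unfolding B_def by (intro zorder_mult' T_ent P_ent)
      also have "\<dots> = int (d z)"
      proof (cases "d z = 0 \<or> norm z \<le> 1")
        case True
        have "z \<notin> S j" for j
        proof
          assume "z \<in> S j"
          then have "2 ^ j < norm z" "d z \<noteq> 0" by (auto simp: S_def)
          moreover have "(1::real) \<le> 2 ^ j" by simp
          ultimately show False using True by linarith
        qed
        thus ?thesis using True by (auto simp: P_ord T0 S0_def)
      next
        case False
        define i where "i = (LEAST i. norm z \<le> 2 ^ Suc i)"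
        have "(2::real) ^ N \<le> 2 ^ Suc N" by simp
        with N have ex: "norm z \<le> 2 ^ Suc N" by linarith
        have i1: "norm z \<le> 2 ^ Suc i" unfolding i_def by (rule LeastI[of _ N]) (use ex in simp)
        have i2: "2 ^ i < norm z"
        proof (cases i)
          case 0
          thus ?thesis using False by simp
        next
          case (Suc i')
          have "\<not> norm z \<le> 2 ^ Suc i'" using not_less_Least[of i' "\<lambda>i. norm z \<le> 2 ^ Suc i"] Suc
            by (simp add: i_def)
          thus ?thesis using Suc by simp
        qed
        have "z \<in> S j \<longleftrightarrow> j = i" for j
        proof
          assume "z \<in> S j"
          then have "2 ^ j < norm z" "norm z \<le> 2 ^ Suc j" by (auto simp: S_def)
          then have "(2::real) ^ j < 2 ^ Suc i" "(2::real) ^ i < 2 ^ Suc j" using i1 i2 by linarith+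
          then have "j < Suc i" "i < Suc j" by (simp_all only: power_strict_increasing_iff[of "2::real"] one_less_numeral_iff semiring_norm(76))
          thus "j = i" by simp
        next
          assume "j = i"
          thus "z \<in> S j" using i1 i2 False by (simp add: S_def)
        qed
        moreover have "i < N"
        proof -
          have "(2::real) ^ i < 2 ^ N" using i2 N by linarith
          thus ?thesis by simp
        qed
        ultimately show ?thesis using False by (simp add: T0 P_ord S0_def)
      qed
      finally show ?thesis .
    qed
  next
    fix \<epsilon> :: real assume e: "\<epsilon> > 0"
    \<comment> \<open>The count is estimated with exponent \<delta> and the logarithm with 2
      \<delta>, so block j contributes a constant times 2^(j \<delta>) (|z| / 2^j)^(2 \<delta>), a
      geometric sequence in j with ratio 2^(-\<delta>).\<close>
    define \<delta> where "\<delta> = min (\<epsilon> / 2) (1 / 2)"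
    have \<delta>: "0 < \<delta>" "2 * \<delta> \<le> \<epsilon>" "2 * \<delta> \<le> 1" using e by (auto simp: \<delta>_def)
    obtain C where C: "\<And>R. R \<ge> 1 \<Longrightarrow> n R \<le> C * R powr \<delta>"
      using growth'[OF \<delta>(1)] by auto
    define q where "q = (2 :: real) powr (- \<delta>)"
    have q: "0 < q" "q < 1" using powr_less_mono[of "-\<delta>" 0 "2::real"] \<delta> by (auto simp: q_def)
    define D where "D = \<bar>C\<bar> * 2 powr \<delta> / \<delta>"
    have D0: "D \<ge> 0" using \<delta> by (simp add: D_def)
    define x where "x = (\<lambda>z::complex. (1 + norm z) powr \<epsilon>)"
    have term_le: "n (2 ^ Suc j) * ln (1 + norm z / 2 ^ j) \<le> D * x z * q ^ j" for j z
    proof -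
      have "n (2 ^ Suc j) * ln (1 + norm z / 2 ^ j) \<le> \<bar>C\<bar> * (2 ^ Suc j) powr \<delta> * (2 * (norm z / 2 ^ j) powr (2 * \<delta>) / (2 * \<delta>))"
      proof (rule mult_mono)
        have "n (2 ^ Suc j) \<le> C * (2 ^ Suc j) powr \<delta>" by (intro C) (simp add: one_le_power del: power_Suc)
        also have "\<dots> \<le> \<bar>C\<bar> * (2 ^ Suc j) powr \<delta>" by (intro mult_right_mono) auto
        finally show "n (2 ^ Suc j) \<le> \<bar>C\<bar> * (2 ^ Suc j) powr \<delta>" .
        show "ln (1 + norm z / 2 ^ j) \<le> 2 * (norm z / 2 ^ j) powr (2 * \<delta>) / (2 * \<delta>)"
          by (rule ln_1_plus_le_powr) (use \<delta> in auto)
      qed auto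
      also have "\<dots> = D * norm z powr (2 * \<delta>) * ((2 ^ j) powr \<delta> / (2 ^ j) powr (2 * \<delta>))"
        using \<delta> by (simp add: D_def powr_mult powr_divide mult_ac)
      also have "(2 ^ j) powr \<delta> / (2 ^ j) powr (2 * \<delta>) = q ^ j"
        by (simp add: q_def powr_diff[symmetric] power_powr[symmetric])
      also have "norm z powr (2 * \<delta>) \<le> x z"
      proof -
        have "norm z powr (2 * \<delta>) \<le> (1 + norm z) powr (2 * \<delta>)" using \<delta> by (intro powr_mono2) auto
        also have "\<dots> \<le> x z" unfolding x_def using \<delta> by (intro powr_mono) auto
        finally show ?thesis .
      qed
      finally show ?thesis using D0 q by (simp add: mult_left_mono mult_right_mono)
    qed
    have T_bound: "norm (T 0 z) \<le> exp (D * x z / (1 - q))" for z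
    proof -
      have "(\<lambda>N. \<Prod>j\<le>N. G j z) \<longlonglongrightarrow> T 0 z"
        unfolding T_def using convergent_prod_LIMSEQ[OF T_conv[of 0 z]] by simp
      then have "(\<lambda>N. norm (\<Prod>j\<le>N. G j z)) \<longlonglongrightarrow> norm (T 0 z)" by (rule tendsto_norm)
      moreover have "norm (\<Prod>j\<le>N. G j z) \<le> exp (D * x z / (1 - q))" for N
      proof -
        have "norm (\<Prod>j\<le>N. G j z) = (\<Prod>j\<le>N. norm (G j z))" by (simp add: prod_norm)
        also have "\<dots> \<le> (\<Prod>j\<le>N. exp (D * x z * q ^ j))"
        proof (intro prod_mono conjI)
          fix j
          show "norm (G j z) \<le> exp (D * x z * q ^ j)"
            using G_bound[of j z] term_le[of j z] by (meson exp_le_cancel_iff order_trans)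
        qed auto
        also have "\<dots> = exp (D * x z * (\<Sum>j\<le>N. q ^ j))" by (simp add: exp_sum sum_distrib_left)
        also have "(\<Sum>j\<le>N. q ^ j) \<le> (\<Sum>j. q ^ j)"
          using q by (intro sum_le_suminf summable_geometric) auto
        also have "(\<Sum>j. q ^ j) = 1 / (1 - q)" using q by (intro suminf_geometric) auto
        finally show ?thesis using D0 by (simp add: mult_left_mono x_def)
      qed
      ultimately show ?thesis by (intro LIMSEQ_le_const2[of _ "norm (T 0 z)"]) auto
    qed
    define m where "m = (\<Sum>a\<in>S0. d a)"
    have P_bound: "norm (P z) \<le> exp (2 * real m / \<delta> * x z)" for z
    proof -
      have "norm (P z) = (\<Prod>a\<in>S0. norm (z - a) ^ d a)" by (simp add: P_def prod_norm[symmetric] norm_power)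
      also have "\<dots> \<le> (\<Prod>a\<in>S0. (1 + norm z) ^ d a)"
      proof (intro prod_mono conjI power_mono)
        fix a assume "a \<in> S0"
        thus "norm (z - a) \<le> 1 + norm z" using norm_triangle_ineq4[of z a] by (auto simp: S0_def)
      qed auto
      also have "\<dots> = (1 + norm z) ^ m" by (simp add: m_def power_sum)
      also have "\<dots> = exp (real m * ln (1 + norm z))"
        by (simp add: exp_of_nat_mult add_pos_nonneg)
      also have "real m * ln (1 + norm z) \<le> real m * (2 * x z / \<delta>)"
      proof (intro mult_left_mono)
        have "ln (1 + norm z) \<le> 2 * norm z powr \<delta> / \<delta>" by (rule ln_1_plus_le_powr) (use \<delta> in auto)
        also have "norm z powr \<delta> \<le> (1 + norm z) powr \<delta>" using \<delta> by (intro powr_mono2) auto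
        also have "\<dots> \<le> x z" unfolding x_def using \<delta> by (intro powr_mono) auto
        finally show "ln (1 + norm z) \<le> 2 * x z / \<delta>" using \<delta> by (simp add: divide_right_mono)
      qed auto
      finally show ?thesis by (simp add: mult_ac)
    qed
    show "\<exists>C. \<forall>z. norm (B z) \<le> exp (C * (1 + norm z) powr \<epsilon>)"
    proof (intro exI allI)
      fix z
      have "norm (B z) \<le> exp (2 * real m / \<delta> * x z) * exp (D * x z / (1 - q))"
        unfolding B_def norm_mult using P_bound T_bound by (intro mult_mono) auto
      also have "\<dots> = exp ((2 * real m / \<delta> + D / (1 - q)) * x z)"
        by (simp add: exp_add[symmetric] algebra_simps)
      finally show "norm (B z) \<le> exp ((2 * real m / \<delta> + D / (1 - q)) * (1 + norm z) powr \<epsilon>)"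
        by (simp add: x_def)
    qed
  qed
qed

section \<open>The Nevanlinna characteristic of a quotient of entire functions\<close>

text \<open>Extended by 0 off the poles, so that it can serve as the divisor of a
  denominator.\<close>

definition pord :: "(complex \<Rightarrow> complex) \<Rightarrow> complex \<Rightarrow> nat" where
  "pord f z = (if is_pole f z then nat (- zorder f z) else 0)"

lemma pord_eq_0_iff:
  assumes "f meromorphic_on UNIV"
  shows   "pord f z = 0 \<longleftrightarrow> \<not> is_pole f z"
  using isolated_pole_imp_neg_zorder[of f z] assms by (auto simp: pord_def meromorphic_on_altdef)

lemma finite_poles:
  assumes "f meromorphic_on UNIV"
  shows   "finite {z. norm z \<le> R \<and> is_pole f z}"
proof -
  have "{z. is_pole f z} sparse_in UNIV"
    using meromorphic_on_imp_not_pole_cosparse[OF assms] by (simp add: eventually_cosparse)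
  then have "{z. is_pole f z} sparse_in cball 0 R"
    using sparse_in_subset by blast
  then have "finite (cball 0 R \<inter> {z. is_pole f z})"
    using sparse_in_compact_finite by fastforce
  moreover have "cball 0 R \<inter> {z. is_pole f z} = {z. norm z \<le> R \<and> is_pole f z}" by auto
  ultimately show ?thesis by simp
qed

text \<open>What a single pole of modulus s contributes to the integral of n(t) / t.\<close>

lemma has_integral_counting_term:
  assumes "0 < s" "s \<le> (r::real)"
  shows   "((\<lambda>t. if s \<le> t then 1 / t else 0) has_integral ln (r / s)) {0..r}"
proof -
  have "((\<lambda>t. 1 / t) has_integral (ln r - ln s)) {s..r}"
    by (rule fundamental_theorem_of_calculus)
       (use assms in \<open>auto intro!: derivative_eq_intros simp: has_real_derivative_iff_has_vector_derivative[symmetric]\<close>)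
  then have "((\<lambda>t. if t \<in> {s..r} then 1 / t else 0) has_integral (ln r - ln s)) {0..r}"
    using assms by (subst has_integral_restrict) auto
  then have "((\<lambda>t. if s \<le> t then 1 / t else 0) has_integral (ln r - ln s)) {0..r}"
    by (rule has_integral_eq[rotated]) auto
  thus ?thesis using assms by (simp add: ln_div)
qed

text \<open>Exchanging the finite sum over poles with the integral over t turns N into a weighted
  sum of the same form as \<open>zcount\<close>.\<close>

lemma nevanlinna_N_eq:
  assumes "f meromorphic_on UNIV" "r > 0"
  shows   "nevanlinna_N r f = (\<Sum>z | norm z \<le> r \<and> is_pole f z. real (pord f z) * wt r z)"
proof -
  define P where "P = {z. norm z \<le> r \<and> is_pole f z}"
  have fin: "finite P" unfolding P_def by (rule finite_poles[OF assms(1)])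
  have pc: "real (pole_count t f) = (\<Sum>z\<in>P. real (pord f z) * (if norm z \<le> t then 1 else 0))"
    if "t \<le> r" for t
    unfolding pole_count_def of_nat_sum
    by (rule sum.mono_neutral_cong_left) (use fin that in \<open>auto simp: P_def pord_def\<close>)
  have pc0: "real (pole_count 0 f) = (\<Sum>z\<in>P. real (pord f z) * (if z = 0 then 1 else 0))"
    using pc[of 0] assms(2) by simp
  have "((\<lambda>t. \<Sum>z\<in>P-{0}. real (pord f z) * (if norm z \<le> t then 1 / t else 0)) has_integral
          (\<Sum>z\<in>P-{0}. real (pord f z) * ln (r / norm z))) {0..r}"
    by (intro has_integral_sum has_integral_mult_right has_integral_counting_term)
       (use fin in \<open>auto simp: P_def\<close>)
  also have "?this \<longleftrightarrow> ((\<lambda>t. (real (pole_count t f) - real (pole_count 0 f)) / t) has_integral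
          (\<Sum>z\<in>P-{0}. real (pord f z) * ln (r / norm z))) {0..r}"
  proof (rule has_integral_cong)
    fix t assume t: "t \<in> {0..r}"
    have "real (pole_count t f) - real (pole_count 0 f) =
      (\<Sum>z\<in>P. real (pord f z) * ((if norm z \<le> t then 1 else 0) - (if z = 0 then 1 else 0)))"
      using t by (subst pc, simp, subst pc0) (simp add: sum_subtractf[symmetric] right_diff_distrib)
    also have "\<dots> = (\<Sum>z\<in>P-{0}. real (pord f z) * (if norm z \<le> t then 1 else 0))"
      using fin t by (intro sum.mono_neutral_cong_right) auto
    finally have eq: "real (pole_count t f) - real (pole_count 0 f) = \<dots>" .
    show "(\<Sum>z\<in>P-{0}. real (pord f z) * (if norm z \<le> t then 1 / t else 0)) =
      (real (pole_count t f) - real (pole_count 0 f)) / t"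
      unfolding eq sum_divide_distrib by (intro sum.cong refl) auto
  qed
  finally have "integral {0..r} (\<lambda>t. (real (pole_count t f) - real (pole_count 0 f)) / t) =
     (\<Sum>z\<in>P-{0}. real (pord f z) * ln (r / norm z))"
    by (rule integral_unique)
  moreover have "(\<Sum>z\<in>P. real (pord f z) * wt r z) =
     (\<Sum>z\<in>P-{0}. real (pord f z) * ln (r / norm z)) + real (pole_count 0 f) * ln r"
  proof -
    have "(\<Sum>z\<in>P. real (pord f z) * wt r z) = (\<Sum>z\<in>P. real (pord f z) * (if z = 0 then 0 else ln (r / norm z)))
      + (\<Sum>z\<in>P. real (pord f z) * (if z = 0 then 1 else 0)) * ln r"
      unfolding sum_distrib_right sum.distrib[symmetric] by (intro sum.cong refl) (simp add: wt_def)
    also have "(\<Sum>z\<in>P. real (pord f z) * (if z = 0 then 0 else ln (r / norm z))) =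
      (\<Sum>z\<in>P-{0}. real (pord f z) * ln (r / norm z))"
      using fin by (intro sum.mono_neutral_cong_right) auto
    finally show ?thesis by (simp only: pc0)
  qed
  ultimately show ?thesis
    by (simp add: nevanlinna_N_def P_def)
qed

lemma nevanlinna_N_nonneg:
  assumes "f meromorphic_on UNIV" "r \<ge> 1"
  shows   "nevanlinna_N r f \<ge> 0"
  using assms by (subst nevanlinna_N_eq) (auto intro!: sum_nonneg mult_nonneg_nonneg wt_nonneg)

text \<open>No regularity of f is required, since the integral of a non-integrable function is 0 by
  convention.\<close>

lemma nevanlinna_m_nonneg: "nevanlinna_m r f \<ge> 0"
proof -
  have "integral {0..2 * pi} (\<lambda>\<theta>. log_plus (norm (f (of_real r * cis \<theta>)))) \<ge> 0"
  proof (cases "(\<lambda>\<theta>. log_plus (norm (f (of_real r * cis \<theta>)))) integrable_on {0..2 * pi}")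
    case True
    thus ?thesis by (rule integral_nonneg) (auto simp: log_plus_def)
  qed (simp add: not_integrable_integral)
  thus ?thesis by (simp add: nevanlinna_m_def)
qed

text \<open>Each pole of modulus at most \<rho> has weight at least ln (r / \<rho>) in N. A pole at
  the origin has weight ln r, and there \<rho> \<ge> 1 is used.\<close>

lemma pole_number_le_nevanlinna_T:
  assumes f: "f meromorphic_on UNIV" and "1 \<le> \<rho>" "\<rho> \<le> r"
  shows   "real (\<Sum>z | norm z \<le> \<rho> \<and> pord f z \<noteq> 0. pord f z) * ln (r / \<rho>) \<le> nevanlinna_T r f"
proof -
  have "real (\<Sum>z | norm z \<le> \<rho> \<and> pord f z \<noteq> 0. pord f z) * ln (r / \<rho>) =
     (\<Sum>z | norm z \<le> \<rho> \<and> is_pole f z. real (pord f z) * ln (r / \<rho>))"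
    by (simp add: pord_eq_0_iff[OF f] sum_distrib_right del: neq0_conv)
  also have "\<dots> \<le> (\<Sum>z | norm z \<le> \<rho> \<and> is_pole f z. real (pord f z) * wt r z)"
  proof (intro sum_mono mult_left_mono)
    fix z assume z: "z \<in> {z. norm z \<le> \<rho> \<and> is_pole f z}"
    show "ln (r / \<rho>) \<le> wt r z"
    proof (cases "z = 0")
      case True
      have "r / \<rho> \<le> r" using assms by (simp add: divide_le_eq mult_le_cancel_left1)
      thus ?thesis using True assms by (simp add: wt_def)
    next
      case False
      have "r / \<rho> \<le> r / norm z" using z False assms by (intro divide_left_mono mult_pos_pos) auto
      thus ?thesis using False assms by (simp add: wt_def)
    qed
  qed auto
  also have "\<dots> \<le> (\<Sum>z | norm z \<le> r \<and> is_pole f z. real (pord f z) * wt r z)"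
    using assms finite_poles[OF f] by (intro sum_mono2) (auto intro!: mult_nonneg_nonneg wt_nonneg)
  also have "\<dots> = nevanlinna_N r f"
    using assms by (subst nevanlinna_N_eq[OF f]) auto
  also have "\<dots> \<le> nevanlinna_T r f"
    using nevanlinna_m_nonneg[of r f] by (simp add: nevanlinna_T_def)
  finally show ?thesis .
qed

text \<open>An interval longer than the measure of E does not fit into E.\<close>

lemma lmeasurable_avoid:
  assumes "E \<in> lmeasurable"
  obtains r where "a \<le> r" "r \<le> a + measure lebesgue E + 1" "r \<notin> E"
proof -
  have "\<not> {a..a + measure lebesgue E + 1} \<subseteq> E"
  proof
    assume "{a..a + measure lebesgue E + 1} \<subseteq> E"
    then have "measure lebesgue {a..a + measure lebesgue E + 1} \<le> measure lebesgue E"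
      using assms by (intro measure_mono_fmeasurable) auto
    moreover have "measure lebesgue {a..a + measure lebesgue E + 1} = measure lebesgue E + 1"
      using measure_nonneg[of lebesgue E] by simp
    ultimately show False by simp
  qed
  then obtain r where "r \<in> {a..a + measure lebesgue E + 1}" "r \<notin> E" by blast
  thus ?thesis using that[of r] by (simp del: add.assoc)
qed

text \<open>T is controlled only off E, so the number of poles up to R is compared with T at a
  radius r outside E slightly above 2 R, where ln (r / R) \<ge> ln 2.\<close>

lemma pole_number_growth:
  assumes f: "f meromorphic_on UNIV" and E: "E \<in> lmeasurable"
    and T: "\<And>\<epsilon>. \<epsilon> > 0 \<Longrightarrow> eventually (\<lambda>r. r \<notin> E \<longrightarrow> nevanlinna_T r f \<le> r powr \<epsilon>) at_top"
    and e: "\<epsilon> > 0"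
  shows   "\<exists>C. \<forall>R\<ge>1. real (\<Sum>z | norm z \<le> R \<and> pord f z \<noteq> 0. pord f z) \<le> C * R powr \<epsilon>"
proof -
  define n where "n = (\<lambda>R. real (\<Sum>z | norm z \<le> R \<and> pord f z \<noteq> 0. pord f z))"
  have n_mono: "n R \<le> n R'" if "R \<le> R'" for R R'
    unfolding n_def using that finite_poles[OF f]
    by (intro of_nat_mono sum_mono2) (auto simp: pord_eq_0_iff[OF f] simp del: neq0_conv)
  obtain r0 where r0: "\<And>r. r \<ge> r0 \<Longrightarrow> r \<notin> E \<Longrightarrow> nevanlinna_T r f \<le> r powr \<epsilon>"
    using T[OF e] by (auto simp: eventually_at_top_linorder)
  \<comment> \<open>For R > R0 the radius r found outside E is at least r0 and at most 3 R, because
    R exceeds the measure of E by at least 1.\<close>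
  define R0 where "R0 = Max {1, r0, measure lebesgue E + 1}"
  have R0: "R0 \<ge> 1" "R0 \<ge> r0" "R0 \<ge> measure lebesgue E + 1" by (auto simp: R0_def)
  define C where "C = max (n R0) (3 powr \<epsilon> / ln 2)"
  have "n R \<le> C * R powr \<epsilon>" if R: "R \<ge> 1" for R
  proof (cases "R \<le> R0")
    case True
    have "n R \<le> n R0 * 1" using n_mono[OF True] by simp
    also have "\<dots> \<le> C * R powr \<epsilon>"
      using R e by (intro mult_mono ge_one_powr_ge_zero) (auto simp: C_def n_def le_max_iff_disj)
    finally show ?thesis .
  next
    case False
    obtain r where r: "2 * R \<le> r" "r \<le> 2 * R + measure lebesgue E + 1" "r \<notin> E"
      using lmeasurable_avoid[OF E] .
    have "n R * ln 2 \<le> n R * ln (r / R)"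
    proof (intro mult_left_mono)
      have "2 \<le> r / R" using r(1) R by (simp add: le_divide_eq)
      thus "ln 2 \<le> ln (r / R)" by simp
    qed (simp only: n_def of_nat_0_le_iff)
    also have "\<dots> \<le> nevanlinna_T r f"
      unfolding n_def using r R by (intro pole_number_le_nevanlinna_T f) auto
    also have "\<dots> \<le> r powr \<epsilon>" using r False R0 R by (intro r0) auto
    also have "\<dots> \<le> (3 * R) powr \<epsilon>" using r False R0 R e by (intro powr_mono2) auto
    also have "\<dots> = 3 powr \<epsilon> * R powr \<epsilon>" using R by (simp add: powr_mult)
    finally have "n R \<le> 3 powr \<epsilon> / ln 2 * R powr \<epsilon>" by (simp add: field_simps)
    also have "\<dots> \<le> C * R powr \<epsilon>" by (intro mult_right_mono) (auto simp: C_def)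
    finally show ?thesis .
  qed
  thus ?thesis unfolding n_def by blast
qed

section \<open>Meromorphic functions as reduced quotients of entire functions\<close>

definition quot_rep :: "(complex \<Rightarrow> complex) \<Rightarrow> (complex \<Rightarrow> complex) \<Rightarrow> (complex \<Rightarrow> complex) \<Rightarrow> bool" where
  "quot_rep f A B \<longleftrightarrow> f meromorphic_on UNIV \<and> nz_entire A \<and> nz_entire B \<and>
     (\<forall>z. zorder B z = int (pord f z)) \<and> (\<forall>z. A z = 0 \<longrightarrow> B z \<noteq> 0) \<and> (\<forall>\<^sub>\<approx>z\<in>UNIV. f z = A z / B z)"

text \<open>The values of f at poles and removable singularities are arbitrary; these circles avoid
  such points, so integrals over them can be rewritten through A and B.\<close>

definition clean_radius :: "(complex \<Rightarrow> complex) \<Rightarrow> (complex \<Rightarrow> complex) \<Rightarrow> (complex \<Rightarrow> complex) \<Rightarrow> real \<Rightarrow> bool" where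
  "clean_radius f A B r \<longleftrightarrow> (\<forall>z. norm z = r \<longrightarrow> A z \<noteq> 0 \<and> B z \<noteq> 0 \<and> f z = A z / B z)"

text \<open>Sparse sets are countable, so the remaining radii form a null set that can be added to
  any exceptional set.\<close>

lemma countable_not_clean:
  assumes "quot_rep f A B"
  shows   "countable {r. \<not> clean_radius f A B r}"
proof -
  have "{z. f z \<noteq> A z / B z} sparse_in UNIV"
    using assms by (simp add: quot_rep_def eventually_cosparse)
  then have "countable {z. f z \<noteq> A z / B z}"
    using sparse_imp_countable[of UNIV "{z. f z \<noteq> A z / B z}"] by simp
  then have "countable (norm ` ({z. f z \<noteq> A z / B z} \<union> {z. A z = 0} \<union> {z. B z = 0}))"
    using assms nz_entire_countable_zeros by (auto simp: quot_rep_def)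
  thus ?thesis
    by (rule countable_subset[rotated]) (auto simp: clean_radius_def image_iff)
qed

text \<open>A is f B with its removable singularities filled in. At a pole of f the two orders
  cancel exactly, so A does not vanish at a zero of B.\<close>

lemma quot_rep_exists:
  assumes f: "f meromorphic_on UNIV" "\<not> identically_zero f"
    and B: "nz_entire B" "\<And>z. zorder B z = int (pord f z)"
  obtains A where "quot_rep f A B"
proof -
  define g where "g = (\<lambda>z. f z * B z)"
  have f_nz: "eventually (\<lambda>w. f w \<noteq> 0) (at z)" for z
  proof -
    have "eventually (\<lambda>z. f z \<noteq> 0) (cosparse UNIV)"
      using meromorphic_imp_constant_or_avoid[OF f(1), of 0] f(2) by (auto simp: identically_zero_def)
    thus ?thesis by (simp add: eventually_cosparse_open_eq)
  qed
  have f_fr: "frequently (\<lambda>w. f w \<noteq> 0) (at z)" for z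
    using f_nz[of z] by (simp add: eventually_frequently)
  have f_mero: "f meromorphic_on {z}" for z using f(1) meromorphic_on_subset by blast
  have g_mero: "g meromorphic_on UNIV"
    unfolding g_def by (intro meromorphic_intros f nz_entire_meromorphic B)
  have g_sing: "isolated_singularity_at g z" "not_essential g z" for z
    using g_mero by (auto simp: meromorphic_on_altdef)
  have g_nz: "eventually (\<lambda>w. g w \<noteq> 0) (at z)" for z
    using f_nz[of z] nz_entire_eventually[OF B(1), of z] by eventually_elim (simp add: g_def)
  have g_ord: "zorder g z = zorder f z + int (pord f z)" for z
    unfolding g_def B(2)[symmetric]
    by (intro zorder_mult f_mero f_fr nz_entire_meromorphic nz_entire_frequently B)
  have g_ord0: "zorder g z \<ge> 0" for z
    using zorder_neg_imp_is_pole[OF f_mero f_nz, of z] by (force simp: g_ord pord_def)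
  have not_pole: "\<not> is_pole g z" for z
    using isolated_pole_imp_neg_zorder[OF g_sing(1)] g_ord0[of z] by force
  define A where "A = remove_sings g"
  have A_an: "A analytic_on {z}" for z
  proof -
    obtain c where "g \<midarrow>z\<rightarrow> c" using g_sing(2)[of z] not_pole[of z] by (auto simp: not_essential_def)
    thus ?thesis unfolding A_def by (rule remove_sings_analytic_at[OF g_sing(1)])
  qed
  have A_hol: "A holomorphic_on UNIV"
    using A_an analytic_on_analytic_at analytic_imp_holomorphic by blast
  have A_eq: "\<forall>\<^sub>\<approx>z\<in>UNIV. A z = g z" unfolding A_def by (rule eventually_remove_sings_eq[OF g_mero])
  have A_eq_at: "eventually (\<lambda>w. A w = g w) (at z)" for z
    using A_eq by (simp add: eventually_cosparse_open_eq)
  have A_nz: "nz_entire A"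
  proof -
    have "eventually (\<lambda>w. A w \<noteq> 0) (at 0)"
      using A_eq_at[of 0] g_nz[of 0] by eventually_elim simp
    then have "frequently (\<lambda>w. A w \<noteq> 0) (at 0)" by (simp add: eventually_frequently)
    thus ?thesis using A_hol frequently_ex unfolding nz_entire_def by blast
  qed
  have "B z \<noteq> 0" if "A z = 0" for z
  proof
    assume "B z = 0"
    then have "pord f z > 0" using zorder_pos[OF B(1), of z] B(2)[of z] by simp
    then have "is_pole f z" "int (pord f z) = - zorder f z" 
      by (auto simp: pord_def split: if_splits)
    then have "zorder g z = 0" by (simp add: g_ord)
    moreover have "zorder A z = zorder g z" unfolding A_def using g_sing(1) by simp
    ultimately show False using zorder_eq_0[OF A_nz, of z] that by simp
  qed
  moreover have "\<forall>\<^sub>\<approx>z\<in>UNIV. f z = A z / B z"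
  proof -
    have "\<forall>\<^sub>\<approx>z\<in>UNIV. B z \<noteq> 0" using nz_entire_eventually[OF B(1)] by (simp add: eventually_cosparse_open_eq)
    with A_eq show ?thesis by eventually_elim (simp add: g_def)
  qed
  ultimately have "quot_rep f A B" using f(1) A_nz B by (simp add: quot_rep_def)
  thus ?thesis by (rule that)
qed

lemma log_plus_eq: "x > 0 \<Longrightarrow> log_plus x = max 0 (ln x)"
  by (auto simp: log_plus_def max_def)

lemma nevanlinna_N_quot:
  assumes "quot_rep f A B" "r > 0"
  shows   "nevanlinna_N r f = zcount B r"
proof -
  have "B z = 0 \<longleftrightarrow> is_pole f z" for z
    using assms pord_eq_0_iff[of f z] zorder_eq_0[of B z] by (auto simp: quot_rep_def)
  thus ?thesis
    using assms by (subst nevanlinna_N_eq) (auto simp: quot_rep_def zcount_def)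
qed

lemma circle_continuous_entire:
  assumes "nz_entire u" "r > 0"
  shows   "continuous_on X (\<lambda>t. u (of_real r * cis t))"
  by (intro circle_continuous holomorphic_on_imp_continuous_on nz_entire_holo assms)

text \<open>On a clean circle the integrand is continuous in the angle, so the integral in
  \<open>nevanlinna_m\<close> is a genuine one.\<close>

lemma proximity_integrable:
  assumes q: "quot_rep f A B" and r: "r > 0" and c: "clean_radius f A B r"
  shows   "((\<lambda>t. log_plus (norm (f (of_real r * cis t)))) has_integral (2 * pi * nevanlinna_m r f)) {0..2 * pi}"
proof -
  have n: "norm (of_real r * cis t) = r" for t using r by (simp add: norm_mult)
  have f: "A (of_real r * cis t) \<noteq> 0" "B (of_real r * cis t) \<noteq> 0"
          "f (of_real r * cis t) = A (of_real r * cis t) / B (of_real r * cis t)" for t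
    using c n unfolding clean_radius_def by blast+
  have "(\<lambda>t. log_plus (norm (f (of_real r * cis t)))) = 
    (\<lambda>t. max 0 (ln (norm (A (of_real r * cis t) / B (of_real r * cis t)))))"
    using f by (simp add: log_plus_eq)
  moreover have "continuous_on {0..2 * pi} (\<lambda>t. max 0 (ln (norm (A (of_real r * cis t) / B (of_real r * cis t)))))"
    by (intro continuous_intros circle_continuous_entire r) (use q f in \<open>auto simp: quot_rep_def\<close>)
  ultimately have "(\<lambda>t. log_plus (norm (f (of_real r * cis t)))) integrable_on {0..2 * pi}"
    by (simp add: integrable_continuous_real)
  thus ?thesis by (auto simp: nevanlinna_m_def dest: integrable_integral)
qed

text \<open>Since ln |A| and ln |B| are both at most S, the log-plus of |A / B| is at most S - ln
  |B|. The mean of ln |B| is \<open>nu B r\<close>, and its zero count cancels against N(r,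
  f).\<close>

lemma nevanlinna_T_upper:
  assumes q: "quot_rep f A B" and r: "r > 0" and c: "clean_radius f A B r"
    and S: "\<And>z. norm z = r \<Longrightarrow> norm (A z) \<le> exp S" "\<And>z. norm z = r \<Longrightarrow> norm (B z) \<le> exp S"
  shows   "nevanlinna_T r f \<le> S - ln (norm (zor_poly B 0 0))"
proof -
  have B: "nz_entire B" and A: "nz_entire A" using q by (auto simp: quot_rep_def)
  have "2 * pi * nevanlinna_m r f \<le> 2 * pi * (S - nu B r)"
  proof (rule has_integral_le[OF proximity_integrable[OF q r c]])
    have "((\<lambda>_. S) has_integral 2 * pi * S) {0..2 * pi}"
      using has_integral_const_real[of S 0 "2 * pi"] by simp
    from has_integral_diff[OF this jensen[OF B r]] c
    show "((\<lambda>t. S - ln (norm (B (of_real r * cis t)))) has_integral 2 * pi * (S - nu B r)) {0..2 * pi}"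
      by (simp add: clean_radius_def right_diff_distrib)
    fix t
    define z where "z = of_real r * cis t"
    have z: "norm z = r" using r by (simp add: z_def norm_mult)
    have f: "A z \<noteq> 0" "B z \<noteq> 0" "f z = A z / B z" using c z by (auto simp: clean_radius_def)
    have "ln (norm (A z)) \<le> S" "ln (norm (B z)) \<le> S"
      using S[OF z] f by (metis exp_gt_zero ln_exp ln_le_cancel_iff zero_less_norm_iff)+
    moreover have "log_plus (norm (f z)) = max 0 (ln (norm (A z)) - ln (norm (B z)))"
      using f by (simp add: log_plus_eq norm_divide ln_div)
    ultimately show "log_plus (norm (f (of_real r * cis t))) \<le> S - ln (norm (B (of_real r * cis t)))"
      by (simp add: z_def)
  qed
  then have "nevanlinna_m r f \<le> S - nu B r" by simp
  thus ?thesis using nevanlinna_N_quot[OF q r] by (simp add: nevanlinna_T_def nu_def)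
qed

text \<open>By Jensen's formula \<open>nu A r - nu B r\<close> is the mean of ln |f|, hence at most
  m(r, f), while N(r, f) is the zero count of B.\<close>

lemma nu_le_nevanlinna_T:
  assumes q: "quot_rep f A B" and r: "r > 0" and c: "clean_radius f A B r"
  shows   "nu A r \<le> nevanlinna_T r f + ln (norm (zor_poly B 0 0))"
          "nu B r \<le> nevanlinna_T r f + ln (norm (zor_poly B 0 0))"
proof -
  have B: "nz_entire B" and A: "nz_entire A" using q by (auto simp: quot_rep_def)
  show "nu B r \<le> nevanlinna_T r f + ln (norm (zor_poly B 0 0))"
    using nevanlinna_N_quot[OF q r] nevanlinna_m_nonneg[of r f] by (simp add: nevanlinna_T_def nu_def)
  have "2 * pi * nu A r - 2 * pi * nu B r \<le> 2 * pi * nevanlinna_m r f"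
  proof (rule has_integral_le[OF has_integral_diff[OF jensen[OF A r] jensen[OF B r]] proximity_integrable[OF q r c]])
    fix t
    define z where "z = of_real r * cis t"
    have z: "norm z = r" using r by (simp add: z_def norm_mult)
    have f: "A z \<noteq> 0" "B z \<noteq> 0" "f z = A z / B z" using c z by (auto simp: clean_radius_def)
    have "log_plus (norm (f z)) = max 0 (ln (norm (A z)) - ln (norm (B z)))"
      using f by (simp add: log_plus_eq norm_divide ln_div)
    thus "ln (norm (A (of_real r * cis t))) - ln (norm (B (of_real r * cis t)))
       \<le> log_plus (norm (f (of_real r * cis t)))"
      by (simp add: z_def)
  qed (use c in \<open>auto simp: clean_radius_def\<close>)
  then have "2 * pi * (nu A r - nu B r) \<le> 2 * pi * nevanlinna_m r f" by (simp only: right_diff_distrib)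
  then have "nu A r - nu B r \<le> nevanlinna_m r f" by simp
  thus "nu A r \<le> nevanlinna_T r f + ln (norm (zor_poly B 0 0))"
    using nevanlinna_N_quot[OF q r] by (simp add: nevanlinna_T_def nu_def)
qed

text \<open>On clean circles |A| = |f| |B|, so m(R, A) \<le> m(R, f) + C (1 + R)^\<epsilon>, and the
  Poisson bound makes this pointwise. R is taken outside E with R > 2 |z|, which keeps the factor (R
  + |z|) / (R - |z|) at most 3.\<close>

lemma numerator_growth:
  assumes q: "quot_rep f A B" and E: "E \<in> lmeasurable" and cl: "\<And>r. r \<notin> E \<Longrightarrow> clean_radius f A B r"
    and T: "\<And>\<epsilon>. \<epsilon> > 0 \<Longrightarrow> eventually (\<lambda>r. r \<notin> E \<longrightarrow> nevanlinna_T r f \<le> r powr \<epsilon>) at_top"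
    and Bg: "\<And>\<epsilon>. \<epsilon> > 0 \<Longrightarrow> \<exists>C. \<forall>z. norm (B z) \<le> exp (C * (1 + norm z) powr \<epsilon>)"
    and e: "\<epsilon> > 0"
  shows   "\<exists>C. \<forall>z. norm (A z) \<le> exp (C * (1 + norm z) powr \<epsilon>)"
proof -
  have B: "nz_entire B" and A: "nz_entire A" and f: "f meromorphic_on UNIV" using q by (auto simp: quot_rep_def)
  obtain C0 where C0: "\<And>z. norm (B z) \<le> exp (C0 * (1 + norm z) powr \<epsilon>)" using Bg[OF e] by blast
  define C where "C = \<bar>C0\<bar>"
  have C: "norm (B z) \<le> exp (C * (1 + norm z) powr \<epsilon>)" for z
  proof -
    have "C0 * (1 + norm z) powr \<epsilon> \<le> C * (1 + norm z) powr \<epsilon>" by (intro mult_right_mono) (auto simp: C_def)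
    thus ?thesis using C0[of z] by (meson exp_le_cancel_iff order_trans)
  qed
  obtain r0 where r0: "\<And>r. r \<ge> r0 \<Longrightarrow> r \<notin> E \<Longrightarrow> nevanlinna_T r f \<le> r powr \<epsilon>"
    using T[OF e] by (auto simp: eventually_at_top_linorder)
  define L where "L = \<bar>r0\<bar> + measure lebesgue E + 4"
  have L: "L \<ge> 4" "L \<ge> 1" by (auto simp: L_def)
  have "norm (A z) \<le> exp (3 * (1 + C) * L powr \<epsilon> * (1 + norm z) powr \<epsilon>)" for z
  proof -
    obtain R where R: "2 * norm z + \<bar>r0\<bar> + 1 \<le> R" "R \<le> 2 * norm z + \<bar>r0\<bar> + 1 + measure lebesgue E + 1" "R \<notin> E"
      using lmeasurable_avoid[OF E] .
    have Rp: "R > 0" "R \<ge> 1" "norm z < R" "R \<ge> r0" using R(1) norm_ge_zero[of z] by linarith+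
    have RL: "1 + R \<le> L * (1 + norm z)"
    proof -
      have "1 + R \<le> L + 2 * norm z" using R(2) by (simp add: L_def)
      also have "\<dots> \<le> L + L * norm z" using L(1) by (intro add_mono mult_right_mono) auto
      finally show ?thesis by (simp add: algebra_simps)
    qed
    have c: "clean_radius f A B R" using cl[OF R(3)] .
    have "\<not> is_pole A z" for z
      using A nz_entire_analytic analytic_at_imp_no_pole by blast
    \<comment> \<open>Reading A as the quotient A / 1 makes \<open>proximity_integrable\<close>
      available for m(R, A).\<close>
    then have qA: "quot_rep A A (\<lambda>_. 1)"
      using A by (auto simp: quot_rep_def nz_entire_const zorder_const' pord_def nz_entire_meromorphic)
    have cA: "clean_radius A A (\<lambda>_. 1) R" using c by (auto simp: clean_radius_def)
    have "2 * pi * nevanlinna_m R A \<le> 2 * pi * (nevanlinna_m R f + C * (1 + R) powr \<epsilon>)"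
    proof (rule has_integral_le[OF proximity_integrable[OF qA Rp(1) cA]])
      have "((\<lambda>_. C * (1 + R) powr \<epsilon>) has_integral 2 * pi * (C * (1 + R) powr \<epsilon>)) {0..2 * pi}"
        using has_integral_const_real[of "C * (1 + R) powr \<epsilon>" 0 "2 * pi"] by simp
      from has_integral_add[OF proximity_integrable[OF q Rp(1) c] this]
      show "((\<lambda>t. log_plus (norm (f (of_real R * cis t))) + C * (1 + R) powr \<epsilon>) has_integral
          2 * pi * (nevanlinna_m R f + C * (1 + R) powr \<epsilon>)) {0..2 * pi}"
        by (simp only: distrib_left)
      fix t
      define z where "z = of_real R * cis t"
      have z: "norm z = R" using Rp by (simp add: z_def norm_mult)
      have f: "A z \<noteq> 0" "B z \<noteq> 0" "f z = A z / B z" using c z by (auto simp: clean_radius_def)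
      have "ln (norm (B z)) \<le> C * (1 + R) powr \<epsilon>"
        using C[of z] z f by (metis exp_gt_zero ln_exp ln_le_cancel_iff zero_less_norm_iff)
      moreover have "log_plus (norm (f z)) = max 0 (ln (norm (A z)) - ln (norm (B z)))"
        using f by (simp add: log_plus_eq norm_divide ln_div)
      moreover have "log_plus (norm (A z)) = max 0 (ln (norm (A z)))" using f by (simp add: log_plus_eq)
      moreover have "0 \<le> C * (1 + R) powr \<epsilon>" by (simp add: C_def)
      ultimately show "log_plus (norm (A (of_real R * cis t))) \<le> log_plus (norm (f (of_real R * cis t))) + C * (1 + R) powr \<epsilon>"
        by (simp add: z_def)
    qed
    then have "nevanlinna_m R A \<le> nevanlinna_m R f + C * (1 + R) powr \<epsilon>" by simp
    also have "nevanlinna_m R f \<le> nevanlinna_T R f"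
      using nevanlinna_N_nonneg[OF f Rp(2)] by (simp add: nevanlinna_T_def)
    also have "\<dots> \<le> R powr \<epsilon>" using r0 Rp R by blast
    also have "\<dots> \<le> (1 + R) powr \<epsilon>" using Rp e by (intro powr_mono2) auto
    finally have m: "nevanlinna_m R A \<le> (1 + C) * (1 + R) powr \<epsilon>" by (simp add: algebra_simps)
    have "(R + norm z) / (R - norm z) \<le> 3"
      using R(1) Rp by (simp add: divide_le_eq)
    then have "(R + norm z) / (R - norm z) * nevanlinna_m R A \<le> 3 * ((1 + C) * (1 + R) powr \<epsilon>)"
      using m nevanlinna_m_nonneg Rp by (intro mult_mono) (auto simp: C_def)
    also have "\<dots> \<le> 3 * ((1 + C) * (L * (1 + norm z)) powr \<epsilon>)"
      using RL Rp e by (intro mult_left_mono powr_mono2) (auto simp: C_def)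
    also have "\<dots> = 3 * (1 + C) * L powr \<epsilon> * (1 + norm z) powr \<epsilon>"
      using L by (simp add: powr_mult)
    finally have "exp ((R + norm z) / (R - norm z) * nevanlinna_m R A) \<le> exp (3 * (1 + C) * L powr \<epsilon> * (1 + norm z) powr \<epsilon>)"
      by simp
    moreover have "norm (A z) \<le> exp ((R + norm z) / (R - norm z) * nevanlinna_m R A)"
      by (rule poisson_entire[OF A Rp(1) _ Rp(3)]) (use c in \<open>auto simp: clean_radius_def\<close>)
    ultimately show ?thesis by linarith
  qed
  thus ?thesis by blast
qed

section \<open>Sequences of slow growth\<close>

text \<open>Otherwise \<Phi> at least doubles at each step of a sequence of radii outside E whose
  ratios are at most 2 s, and so grows at least like a fixed positive power of the radius.\<close>

lemma slow_growth_radius: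
  fixes \<Phi> :: "real \<Rightarrow> real"
  assumes mono: "\<And>x y. x \<le> y \<Longrightarrow> \<Phi> x \<le> \<Phi> y" and E: "E \<in> lmeasurable"
    and slow: "\<And>\<epsilon>. \<epsilon> > 0 \<Longrightarrow> \<exists>C. \<forall>r\<ge>0. \<Phi> r \<le> C * (1 + r) powr \<epsilon>"
    and unbounded: "filterlim \<Phi> at_top at_top" and s: "s \<ge> 1"
  shows   "\<exists>r\<ge>r0. r \<notin> E \<and> \<Phi> (s * r) \<le> 2 * \<Phi> r"
proof (rule ccontr)
  assume "\<not> ?thesis"
  then have *: "\<Phi> (s * r) > 2 * \<Phi> r" if "r \<ge> r0" "r \<notin> E" for r using that by force
  define L where "L = measure lebesgue E + 1"
  have "eventually (\<lambda>r. \<Phi> r \<ge> 1) at_top"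
    using unbounded by (simp add: filterlim_at_top)
  then obtain r1 where r1: "\<And>r. r \<ge> r1 \<Longrightarrow> \<Phi> r \<ge> 1" by (auto simp: eventually_at_top_linorder)
  \<comment> \<open>The condition r2 \<ge> L makes avoiding E cheap: a radius outside E exists
    between s x and 2 s x.\<close>
  define r2 where "r2 = Max {r0, r1, L, 1}"
  have r2: "r2 \<ge> r0" "r2 \<ge> r1" "r2 \<ge> L" "r2 \<ge> 1" by (auto simp: r2_def)
  have next_pt: "\<exists>y. (y \<ge> r2 \<and> y \<notin> E) \<and> s * x \<le> y \<and> y \<le> 2 * s * x" if "x \<ge> r2 \<and> x \<notin> E" for x
  proof -
    obtain y where y: "s * x \<le> y" "y \<le> s * x + measure lebesgue E + 1" "y \<notin> E"
      by (rule lmeasurable_avoid[OF E])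
    have "x \<le> s * x" using mult_right_mono[of 1 s x] s that r2 by simp
    with y that r2 have "r2 \<le> y" "y \<le> 2 * s * x" unfolding L_def by linarith+
    with y show ?thesis by blast
  qed
  obtain y0 where y0: "y0 \<ge> r2" "y0 \<notin> E" using lmeasurable_avoid[OF E, of r2] by blast
  obtain x where x: "\<And>i. x i \<ge> r2 \<and> x i \<notin> E" "\<And>i. s * x i \<le> x (Suc i) \<and> x (Suc i) \<le> 2 * s * x i"
    using dependent_nat_choice[of "\<lambda>_ x. x \<ge> r2 \<and> x \<notin> E" "\<lambda>_ x y. s * x \<le> y \<and> y \<le> 2 * s * x"]
      y0 next_pt by blast
  have lower: "\<Phi> (x i) \<ge> 2 ^ i" for i
  proof (induction i)
    case 0
    show ?case using x(1)[of 0] r1 r2 by auto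
  next
    case (Suc i)
    have "2 * \<Phi> (x i) \<le> \<Phi> (s * x i)" using *[of "x i"] x(1)[of i] r2 by auto
    also have "\<dots> \<le> \<Phi> (x (Suc i))" using x(2)[of i] by (intro mono) auto
    finally show ?case using Suc by simp
  qed
  have upper: "x i \<le> (2 * s) ^ i * x 0" for i
  proof (induction i)
    case (Suc i)
    have "x (Suc i) \<le> 2 * s * x i" using x(2)[of i] by simp
    also have "\<dots> \<le> 2 * s * ((2 * s) ^ i * x 0)" using Suc s by (intro mult_left_mono) auto
    finally show ?case by simp
  qed simp
  \<comment> \<open>Chosen so that (2 s) powr \<epsilon> = 3/2: slow growth then gives O((3/2)^i) at
    \<open>x i\<close>, against the lower bound 2^i.\<close>
  define \<epsilon> where "\<epsilon> = ln (3 / 2) / ln (2 * s)"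
  have e: "\<epsilon> > 0" using s by (simp add: \<epsilon>_def)
  have e': "(2 * s) powr \<epsilon> = 3 / 2" using s by (simp add: \<epsilon>_def powr_def)
  obtain C where C: "\<And>r. r \<ge> 0 \<Longrightarrow> \<Phi> r \<le> C * (1 + r) powr \<epsilon>" using slow[OF e] by blast
  define D where "D = \<bar>C\<bar> * (2 * x 0) powr \<epsilon>"
  have "(4 / 3) ^ i \<le> D" for i
  proof -
    have xi: "x i \<ge> 1" "x 0 \<ge> 1" using x(1)[of i] x(1)[of 0] r2 by linarith+
    have "2 ^ i \<le> \<Phi> (x i)" by (rule lower)
    also have "\<dots> \<le> C * (1 + x i) powr \<epsilon>" using xi by (intro C) auto
    also have "\<dots> \<le> \<bar>C\<bar> * (2 * x i) powr \<epsilon>" using xi e by (intro mult_mono powr_mono2) auto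
    also have "\<dots> \<le> \<bar>C\<bar> * (2 * ((2 * s) ^ i * x 0)) powr \<epsilon>"
      using xi e upper[of i] by (intro mult_left_mono powr_mono2) auto
    also have "\<dots> = D * ((2 * s) ^ i) powr \<epsilon>"
      using s xi by (simp add: D_def powr_mult mult_ac)
    also have "((2 * s) ^ i) powr \<epsilon> = (3 / 2) ^ i"
      using s power_powr[of "2 * s" i \<epsilon>] by (simp add: e'[symmetric])
    finally have "2 ^ i / (3 / 2) ^ i \<le> D" by (simp add: divide_le_eq)
    thus ?thesis by (simp add: power_divide[symmetric])
  qed
  moreover obtain i where "D < (4 / 3) ^ i" using real_arch_pow[of "4 / 3" D] by auto
  ultimately show False by (meson not_le)
qed

section \<open>Estimates along a sequence of radii of slow growth\<close>

definition wronskian :: "(complex \<Rightarrow> complex) \<Rightarrow> (complex \<Rightarrow> complex) \<Rightarrow> complex \<Rightarrow> complex" where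
  "wronskian u v z = u z * deriv v z - deriv u z * v z"

text \<open>One sequence serves all dilations s and all error bounds, so finitely many asymptotic
  estimates can be used at the same radius. \<open>log_small\<close> makes constants and polynomial
  factors negligible against \<Phi>; \<open>doubling\<close> compensates for affine substitutions,
  which change the radius by a factor.\<close>

locale slow_sequence =
  fixes \<Phi> :: "real \<Rightarrow> real" and \<rho> :: "nat \<Rightarrow> real"
  assumes mono: "x \<le> y \<Longrightarrow> \<Phi> x \<le> \<Phi> y"
    and nonneg: "\<Phi> x \<ge> 0"
    and rho_top: "filterlim \<rho> at_top sequentially"
    and log_small: "\<forall>\<^sub>F j in sequentially. C * ln (\<rho> j) \<le> \<Phi> (\<rho> j)"
    and doubling: "\<forall>\<^sub>F j in sequentially. \<Phi> (s * \<rho> j) \<le> 2 * \<Phi> (\<rho> j)"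
begin

lemma rho_ge: "\<forall>\<^sub>F j in sequentially. \<rho> j \<ge> c"
  using rho_top by (simp add: filterlim_at_top)

lemma const_small:
  assumes "\<epsilon> > 0"
  shows   "\<forall>\<^sub>F j in sequentially. c \<le> \<epsilon> * \<Phi> (\<rho> j)"
  using log_small[of "\<bar>c\<bar> / \<epsilon>"] rho_ge[of "exp 1"]
proof eventually_elim
  case (elim j)
  have "1 \<le> ln (\<rho> j)" using elim(2) by (metis exp_gt_zero ln_exp ln_le_cancel_iff order_less_le_trans)
  then have "\<bar>c\<bar> / \<epsilon> * 1 \<le> \<bar>c\<bar> / \<epsilon> * ln (\<rho> j)" using assms by (intro mult_left_mono) auto
  with elim(1) have "\<bar>c\<bar> / \<epsilon> \<le> \<Phi> (\<rho> j)" by simp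
  thus ?case using assms by (simp add: field_simps)
qed

lemma log_const_small:
  assumes "\<epsilon> > 0"
  shows   "\<forall>\<^sub>F j in sequentially. c + d * ln (\<rho> j) \<le> \<epsilon> * \<Phi> (\<rho> j)"
proof -
  have e: "\<epsilon> / 2 > 0" using assms by simp
  show ?thesis
    using const_small[OF e, of c] log_small[of "d / (\<epsilon> / 2)"]
  proof eventually_elim
    case (elim j)
    have "d / (\<epsilon> / 2) * ln (\<rho> j) * (\<epsilon> / 2) \<le> \<Phi> (\<rho> j) * (\<epsilon> / 2)"
      using elim(2) e by (intro mult_right_mono) auto
    then have "d * ln (\<rho> j) \<le> \<epsilon> / 2 * \<Phi> (\<rho> j)" using assms by (simp add: mult.commute)
    thus ?case using elim(1) by (simp add: field_simps)
  qed
qed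

text \<open>The constant C scales both the value and the argument of \<Phi>, which makes the class
  closed under sums, products and affine substitutions. By \<open>doubling\<close> such a function
  still has logarithm at most O(\<Phi> (\<rho> j)) on discs whose radius is a fixed multiple of
  \<open>\<rho> j\<close>.\<close>

definition controlled :: "(complex \<Rightarrow> complex) \<Rightarrow> bool" where
  "controlled u \<longleftrightarrow> (\<exists>C\<ge>1. \<forall>z. norm (u z) \<le> exp (C * (1 + \<Phi> (C * (1 + norm z)))))"

lemma controlled_mono:
  assumes "norm w \<le> exp (C * (1 + \<Phi> (C * (1 + x))))" "1 \<le> C" "C \<le> D" "0 \<le> x"
  shows   "norm w \<le> exp (D * (1 + \<Phi> (D * (1 + x))))"
proof -
  have "C * (1 + x) \<le> D * (1 + x)" using assms by (intro mult_right_mono) auto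
  then have "C * (1 + \<Phi> (C * (1 + x))) \<le> D * (1 + \<Phi> (D * (1 + x)))"
    using assms nonneg mono by (intro mult_mono add_mono) auto
  thus ?thesis using assms(1) by (meson exp_le_cancel_iff order_trans)
qed

lemma controlled_mult:
  assumes "controlled u" "controlled v"
  shows   "controlled (\<lambda>z. u z * v z)"
proof -
  obtain C D where C: "C \<ge> 1" "\<And>z. norm (u z) \<le> exp (C * (1 + \<Phi> (C * (1 + norm z))))"
    and D: "D \<ge> 1" "\<And>z. norm (v z) \<le> exp (D * (1 + \<Phi> (D * (1 + norm z))))"
    using assms by (auto simp: controlled_def)
  have "norm (u z * v z) \<le> exp ((C + D) * (1 + \<Phi> ((C + D) * (1 + norm z))))" for z
  proof -
    define X where "X = 1 + \<Phi> ((C + D) * (1 + norm z))"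
    have "C * (1 + norm z) \<le> (C + D) * (1 + norm z)" "D * (1 + norm z) \<le> (C + D) * (1 + norm z)"
      using C(1) D(1) by (intro mult_right_mono; simp)+
    then have "C * (1 + \<Phi> (C * (1 + norm z))) \<le> C * X" "D * (1 + \<Phi> (D * (1 + norm z))) \<le> D * X"
      unfolding X_def using C(1) D(1) mono by (auto intro!: mult_left_mono)
    then have "norm (u z) \<le> exp (C * X)" "norm (v z) \<le> exp (D * X)"
      using C(2)[of z] D(2)[of z] by (meson exp_le_cancel_iff order_trans)+
    then have "norm (u z * v z) \<le> exp (C * X) * exp (D * X)"
      unfolding norm_mult by (intro mult_mono) auto
    thus ?thesis unfolding X_def[symmetric] by (simp add: exp_add[symmetric] distrib_right)
  qed
  thus ?thesis unfolding controlled_def using C(1) D(1) by (intro exI[of _ "C + D"]) auto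
qed

lemma controlled_add:
  assumes "controlled u" "controlled v"
  shows   "controlled (\<lambda>z. u z + v z)"
proof -
  obtain C D where C: "C \<ge> 1" "\<And>z. norm (u z) \<le> exp (C * (1 + \<Phi> (C * (1 + norm z))))"
    and D: "D \<ge> 1" "\<And>z. norm (v z) \<le> exp (D * (1 + \<Phi> (D * (1 + norm z))))"
    using assms by (auto simp: controlled_def)
  \<comment> \<open>The extra 1 leaves room for one factor exp X, which absorbs the 2 from the
    triangle inequality.\<close>
  define K where "K = max C D + 1"
  have K: "K \<ge> 1" "C \<le> K - 1" "D \<le> K - 1" "1 \<le> K - 1" using C(1) D(1) by (auto simp: K_def)
  have "norm (u z + v z) \<le> exp (K * (1 + \<Phi> (K * (1 + norm z))))" for z
  proof -
    define X where "X = 1 + \<Phi> (K * (1 + norm z))"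
    define Y where "Y = 1 + \<Phi> ((K - 1) * (1 + norm z))"
    have X: "X \<ge> 1" "Y \<le> X" "Y \<ge> 1" unfolding X_def Y_def using nonneg
      by (auto intro!: mono mult_right_mono)
    have "norm (u z) \<le> exp ((K - 1) * Y)" "norm (v z) \<le> exp ((K - 1) * Y)"
      unfolding Y_def by (rule controlled_mono[OF C(2)] controlled_mono[OF D(2)]; use C(1) D(1) K in simp)+
    moreover have "exp ((K - 1) * Y) \<le> exp ((K - 1) * X)"
      using X K by (simp add: mult_left_mono)
    ultimately have "norm (u z + v z) \<le> 2 * exp ((K - 1) * X)"
      using norm_triangle_ineq[of "u z" "v z"] by linarith
    also have "(2::real) \<le> exp X"
      using exp_ge_add_one_self[of X] X(1) by linarith
    also have "exp X * exp ((K - 1) * X) = exp (K * X)" by (simp add: exp_add[symmetric] algebra_simps)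
    finally show ?thesis by (simp add: X_def)
  qed
  thus ?thesis unfolding controlled_def using K(1) by blast
qed

lemma controlled_const: "controlled (\<lambda>_. c)"
proof -
  define C where "C = 1 + norm c"
  have "norm c \<le> exp (C * (1 + \<Phi> (C * (1 + norm z))))" for z :: complex
  proof -
    have "norm c \<le> exp (C * 1)" using exp_ge_add_one_self[of C] by (simp add: C_def)
    also have "exp (C * 1) \<le> exp (C * (1 + \<Phi> (C * (1 + norm z))))"
      using nonneg by (intro iffD2[OF exp_le_cancel_iff] mult_left_mono) (auto simp: C_def)
    finally show ?thesis by simp
  qed
  thus ?thesis unfolding controlled_def by (intro exI[of _ C]) (auto simp: C_def)
qed

lemma controlled_diff: "controlled u \<Longrightarrow> controlled v \<Longrightarrow> controlled (\<lambda>z. u z - v z)"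
  using controlled_add[of u "\<lambda>z. (- 1) * v z"] controlled_mult[OF controlled_const, of v "- 1"] by simp

lemma controlled_power: "controlled u \<Longrightarrow> controlled (\<lambda>z. u z ^ n)"
  by (induction n) (simp_all add: controlled_const controlled_mult)

lemma controlled_prod: "(\<And>i. i \<in> I \<Longrightarrow> controlled (u i)) \<Longrightarrow> controlled (\<lambda>z. \<Prod>i\<in>I. u i z)"
  by (induction I rule: infinite_finite_induct) (simp_all add: controlled_const controlled_mult)

lemma controlled_sum: "(\<And>i. i \<in> I \<Longrightarrow> controlled (u i)) \<Longrightarrow> controlled (\<lambda>z. \<Sum>i\<in>I. u i z)"
  by (induction I rule: infinite_finite_induct) (simp_all add: controlled_const controlled_add)

lemma controlled_affine:
  assumes "controlled u"
  shows   "controlled (\<lambda>z. u (q * z + c))"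
proof -
  obtain C where C: "C \<ge> 1" "\<And>z. norm (u z) \<le> exp (C * (1 + \<Phi> (C * (1 + norm z))))"
    using assms by (auto simp: controlled_def)
  define D where "D = C * (1 + norm q + norm c)"
  have CD: "C \<le> D" unfolding D_def using C(1) by (simp add: mult_le_cancel_left1)
  have "norm (u (q * z + c)) \<le> exp (D * (1 + \<Phi> (D * (1 + norm z))))" for z
  proof -
    have "norm (q * z + c) \<le> norm q * norm z + norm c" by (metis norm_mult norm_triangle_ineq)
    have "1 + norm (q * z + c) \<le> (1 + norm q + norm c) * (1 + norm z)"
    proof -
      have "(1 + norm q + norm c) * (1 + norm z) = 1 + norm q + norm c + norm z + norm q * norm z + norm c * norm z"
        by (simp add: algebra_simps)
      moreover have "0 \<le> norm c * norm z" "0 \<le> norm z" "0 \<le> norm q" by auto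
      ultimately show ?thesis using \<open>norm (q * z + c) \<le> norm q * norm z + norm c\<close> by linarith
    qed
    then have "C * (1 + norm (q * z + c)) \<le> D * (1 + norm z)"
      unfolding D_def mult.assoc using C(1) by (intro mult_left_mono) auto
    then have "C * (1 + \<Phi> (C * (1 + norm (q * z + c)))) \<le> D * (1 + \<Phi> (D * (1 + norm z)))"
      using CD C(1) nonneg mono by (intro mult_mono add_mono) auto
    thus ?thesis using C(2)[of "q * z + c"] by (meson exp_le_cancel_iff order_trans)
  qed
  thus ?thesis unfolding controlled_def using CD C(1) by (intro exI[of _ D]) auto
qed

lemma nu_upper:
  assumes "nz_entire u" and "\<forall>\<^sub>F j in sequentially. \<forall>z. norm z \<le> 2 * \<rho> j \<longrightarrow> norm (u z) \<le> exp (X j)"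
  shows   "\<forall>\<^sub>F j in sequentially. nu u (\<rho> j) \<le> X j"
  using assms(2) rho_ge[of 1]
proof eventually_elim
  case (elim j)
  thus ?case by (intro nu_le[OF assms(1), of "\<rho> j" "2 * \<rho> j"]) auto
qed

text \<open>\<open>growth_bound\<close> with S of order \<Phi>: first K is fixed to make the Harnack
  loss small, then s to make the convexity loss small. \<open>doubling\<close> keeps S of order
  \<Phi> although the disc has radius 2 s \<open>\<rho> j\<close>.\<close>

lemma max_modulus_le_nu:
  assumes u: "nz_entire u" "controlled u" and \<kappa>: "\<kappa> \<ge> 1" and e: "\<epsilon> > 0"
  shows   "\<forall>\<^sub>F j in sequentially. \<forall>z. norm z \<le> \<kappa> * \<rho> j \<longrightarrow> norm (u z) \<le> exp (nu u (\<rho> j) + \<epsilon> * \<Phi> (\<rho> j))"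
proof -
  obtain C where C: "C \<ge> 1" "\<And>z. norm (u z) \<le> exp (C * (1 + \<Phi> (C * (1 + norm z))))"
    using u(2) by (auto simp: controlled_def)
  \<comment> \<open>Each of the two losses is at most \<eta> and S - \<open>nu u 1\<close> is at
    most (2 C + 1) \<Phi>, so together they amount to at most \<epsilon> \<Phi>.\<close>
  define \<eta> where "\<eta> = \<epsilon> / (2 * (2 * C + 1))"
  have \<eta>: "\<eta> > 0" using e C(1) by (simp add: \<eta>_def)
  define K where "K = max (2 * \<kappa>) (2 * \<kappa> / \<eta>)"
  have K: "2 * \<kappa> \<le> K" "2 * \<kappa> / \<eta> \<le> K" "K > 0" using \<kappa> by (auto simp: K_def)
  have K1: "2 * \<kappa> / K \<le> \<eta>" using K \<eta> by (simp add: field_simps)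
  \<comment> \<open>Solves ln (2 K) / ln (s / (2 K)) = \<eta>.\<close>
  define s where "s = 2 * K * exp (ln (2 * K) / \<eta>)"
  have lnK: "ln (2 * K) > 0" using K(1) \<kappa> by simp
  have s: "2 * K < s" "ln (2 * K) / ln (s / (2 * K)) = \<eta>"
    using lnK K \<eta> by (auto simp: s_def)
  define c where "c = C + \<bar>nu u 1\<bar>"
  show ?thesis
    using doubling[of "C * (1 + 2 * s)"] rho_ge[of 1] const_small[of 1 c, simplified]
  proof eventually_elim
    case (elim j)
    define S where "S = C * (1 + 2 * \<Phi> (\<rho> j))"
    show ?case
    proof (intro allI impI)
      fix z :: complex assume z: "norm z \<le> \<kappa> * \<rho> j"
      have "norm (u z) \<le> exp (nu u (\<rho> j) + (ln (2 * K) / ln (s / (2 * K)) + 2 * \<kappa> / K) * (S - nu u 1))"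
      proof (rule growth_bound[OF u(1) elim(2) \<kappa> K(1) s(1) _ z])
        fix w :: complex assume w: "norm w \<le> 2 * s * \<rho> j"
        have "C * (1 + norm w) \<le> C * (\<rho> j + 2 * s * \<rho> j)" using w elim(2) C(1) by (intro mult_left_mono) auto
        also have "\<dots> = C * (1 + 2 * s) * \<rho> j" by (simp add: algebra_simps)
        finally have "\<Phi> (C * (1 + norm w)) \<le> \<Phi> (C * (1 + 2 * s) * \<rho> j)" by (rule mono)
        also have "\<dots> \<le> 2 * \<Phi> (\<rho> j)" using elim(1) by simp
        finally have "C * (1 + \<Phi> (C * (1 + norm w))) \<le> S" unfolding S_def using C(1) by (intro mult_left_mono) auto
        thus "norm (u w) \<le> exp S" using C(2)[of w] by (meson exp_le_cancel_iff order_trans)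
      qed
      also have "(ln (2 * K) / ln (s / (2 * K)) + 2 * \<kappa> / K) * (S - nu u 1) \<le> \<epsilon> * \<Phi> (\<rho> j)"
      proof -
        have "(ln (2 * K) / ln (s / (2 * K)) + 2 * \<kappa> / K) * (S - nu u 1) \<le> (2 * \<eta>) * ((2 * C + 1) * \<Phi> (\<rho> j))"
        proof (rule order_trans[OF mult_left_mono mult_right_mono])
          show "S - nu u 1 \<le> (2 * C + 1) * \<Phi> (\<rho> j)"
            using elim(3) by (simp add: S_def c_def algebra_simps)
        qed (use K1 s(2) \<eta> \<kappa> K C(1) nonneg in auto)
        also have "\<dots> = \<epsilon> * \<Phi> (\<rho> j)" using C(1) by (simp add: \<eta>_def field_simps)
        finally show ?thesis .
      qed
      finally show "norm (u z) \<le> exp (nu u (\<rho> j) + \<epsilon> * \<Phi> (\<rho> j))" by simp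
    qed
  qed
qed

text \<open>Cauchy's estimate on unit discs bounds the derivatives by the maximum moduli on a
  slightly larger disc, which exceed the means only by a small multiple of \<Phi> in the exponent.
  The disc of radius 3 \<open>\<rho> j\<close> covers 2 \<open>\<rho> j\<close> + 1.\<close>

lemma nu_wronskian_le:
  assumes u: "nz_entire u" "controlled u" and v: "nz_entire v" "controlled v"
    and W: "nz_entire (wronskian u v)" and e: "\<epsilon> > 0"
  shows   "\<forall>\<^sub>F j in sequentially. nu (wronskian u v) (\<rho> j) \<le>
             nu u (\<rho> j) + nu v (\<rho> j) + \<epsilon> * \<Phi> (\<rho> j)"
proof (rule nu_upper[OF W])
  have e3: "\<epsilon> / 3 > 0" using e by simp
  have deriv_bound: "norm (deriv w z) \<le> B" if w: "nz_entire w" and B: "\<And>x. norm x \<le> norm z + 1 \<Longrightarrow> norm (w x) \<le> B" for w z B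
  proof -
    have "norm ((deriv ^^ 1) w z) \<le> fact 1 * B / 1 ^ 1"
    proof (rule Cauchy_inequality)
      show "w holomorphic_on ball z 1" using w nz_entire_holo by blast
      show "continuous_on (cball z 1) w" using w nz_entire_holo holomorphic_on_imp_continuous_on by blast
      show "norm (w x) \<le> B" if "norm (z - x) = 1" for x
        using that norm_triangle_ineq4[of z "z - x"] by (intro B) auto
    qed auto
    thus ?thesis by simp
  qed
  show "\<forall>\<^sub>F j in sequentially. \<forall>z. norm z \<le> 2 * \<rho> j \<longrightarrow> norm (wronskian u v z)
      \<le> exp (nu u (\<rho> j) + nu v (\<rho> j) + \<epsilon> * \<Phi> (\<rho> j))"
    using max_modulus_le_nu[OF u _ e3, of 3, simplified] max_modulus_le_nu[OF v _ e3, of 3, simplified]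
      rho_ge[of 1] const_small[OF e3, of "ln 2"]
  proof eventually_elim
    case (elim j)
    show ?case
    proof (intro allI impI)
      fix z :: complex assume z: "norm z \<le> 2 * \<rho> j"
      define a b where "a = exp (nu u (\<rho> j) + \<epsilon> / 3 * \<Phi> (\<rho> j))" and "b = exp (nu v (\<rho> j) + \<epsilon> / 3 * \<Phi> (\<rho> j))"
      have b: "norm (u x) \<le> a" "norm (v x) \<le> b" if "norm x \<le> norm z + 1" for x
        using elim(1-3) that z by (auto simp: a_def b_def)
      have "norm (u z) \<le> a" "norm (v z) \<le> b" "norm (deriv u z) \<le> a" "norm (deriv v z) \<le> b"
        using b deriv_bound[OF u(1)] deriv_bound[OF v(1)] by auto
      then have "norm (u z * deriv v z) \<le> a * b" "norm (deriv u z * v z) \<le> a * b"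
        unfolding norm_mult by (intro mult_mono; simp add: a_def b_def)+
      then have "norm (wronskian u v z) \<le> 2 * (a * b)"
        unfolding wronskian_def using norm_triangle_ineq4[of "u z * deriv v z" "deriv u z * v z"] by linarith
      also have "\<dots> = exp (ln 2 + (nu u (\<rho> j) + \<epsilon> / 3 * \<Phi> (\<rho> j)) + (nu v (\<rho> j) + \<epsilon> / 3 * \<Phi> (\<rho> j)))"
      proof -
        have "2 * (exp x * exp y) = exp (ln 2 + x + y)" for x y :: real by (simp add: exp_add)
        thus ?thesis unfolding a_def b_def .
      qed
      also have "\<dots> \<le> exp (nu u (\<rho> j) + nu v (\<rho> j) + \<epsilon> * \<Phi> (\<rho> j))"
        using elim(4) by (simp add: field_simps)
      finally show "norm (wronskian u v z) \<le> exp (nu u (\<rho> j) + nu v (\<rho> j) + \<epsilon> * \<Phi> (\<rho> j))" .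
    qed
  qed
qed

text \<open>The leading coefficients at 0 are not determined by the divisors; being constants, they
  go into the error.\<close>

lemma nu_mono_ord:
  assumes "nz_entire u" "nz_entire v" "\<And>z. zorder u z \<le> zorder v z" and e: "\<epsilon> > 0"
  shows   "\<forall>\<^sub>F j in sequentially. nu u (\<rho> j) \<le> nu v (\<rho> j) + \<epsilon> * \<Phi> (\<rho> j)"
  using rho_ge[of 1] const_small[OF e, of "ln (norm (zor_poly u 0 0)) - ln (norm (zor_poly v 0 0))"]
proof eventually_elim
  case (elim j)
  thus ?case using zcount_mono_ord[OF assms(1,2) elim(1) assms(3)] by (simp add: nu_def)
qed

text \<open>The hypothesis on orders says that u v w divides the product of the Wronskian and Y.
  Taking \<open>nu\<close> and inserting \<open>nu_wronskian_le\<close> cancels u and v.\<close>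

lemma wronskian_bound:
  assumes u: "nz_entire u" "controlled u" and v: "nz_entire v" "controlled v" and w: "nz_entire w"
    and W: "nz_entire (wronskian u v)" and Y: "nz_entire Y"
    and ord: "\<And>z. zorder u z + zorder v z + zorder w z \<le> zorder (wronskian u v) z + zorder Y z" and e: "\<epsilon> > 0"
  shows   "\<forall>\<^sub>F j in sequentially. nu w (\<rho> j) \<le> nu Y (\<rho> j) + \<epsilon> * \<Phi> (\<rho> j)"
proof -
  have e2: "\<epsilon> / 2 > 0" using e by simp
  have "zorder (\<lambda>z. u z * v z * w z) z \<le> zorder (\<lambda>z. wronskian u v z * Y z) z" for z
    using ord[of z] zorder_mult'[OF nz_entire_mult[OF u(1) v(1)] w, of z] zorder_mult'[OF u(1) v(1), of z]
      zorder_mult'[OF W Y, of z] by simp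
  from nu_mono_ord[OF nz_entire_mult[OF nz_entire_mult[OF u(1) v(1)] w] nz_entire_mult[OF W Y] this e2]
    nu_wronskian_le[OF u v W e2]
  show ?thesis
  proof eventually_elim
    case (elim j)
    thus ?case
      using nu_mult[OF nz_entire_mult[OF u(1) v(1)] w, of "\<rho> j"] nu_mult[OF u(1) v(1), of "\<rho> j"] nu_mult[OF W Y, of "\<rho> j"]
      by (simp add: field_simps)
  qed
qed

end

section \<open>Wronskians and the abc inequality\<close>

text \<open>Inserting u = (w - z)^m g and v = (w - z)^n h shows the Wronskian to be (w - z)^(m+n-1)
  K. The additional factor w - z on the left avoids the exponent -1 for m = n = 0.\<close>

lemma wronskian_local:
  assumes u: "nz_entire u" and v: "nz_entire v"
  obtains K where "K analytic_on {z}"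
    "eventually (\<lambda>w. (w - z) * wronskian u v w = (w - z) ^ (nat (zorder u z) + nat (zorder v z)) * K w) (at z)"
    "K z = (of_int (zorder v z) - of_int (zorder u z)) * zor_poly u z z * zor_poly v z z"
proof -
  define m n where "m = nat (zorder u z)" and "n = nat (zorder v z)"
  define g h where "g = zor_poly u z" and "h = zor_poly v z"
  have an: "g analytic_on {z}" "h analytic_on {z}" unfolding g_def h_def using zor_poly_nz(4) u v by blast+
  define K where "K = (\<lambda>w. (w - z) * (g w * deriv h w - deriv g w * h w) + (of_nat n - of_nat m) * g w * h w)"
  have loc: "eventually (\<lambda>w. deriv y w * (w - z) = (w - z) ^ nat (zorder y z) * ((w - z) * deriv (zor_poly y z) w + of_nat (nat (zorder y z)) * zor_poly y z w)
      \<and> y w = zor_poly y z w * (w - z) ^ nat (zorder y z)) (at z)"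
    if y: "nz_entire y" for y
  proof -
    define l G where "l = nat (zorder y z)" and "G = zor_poly y z"
    obtain r where r: "r > 0" "\<And>w. w \<in> cball z r \<Longrightarrow> y w = G w * (w - z) ^ l"
      using zor_poly_nz(3)[OF y, of z] by (auto simp: G_def l_def)
    obtain X where X: "open X" "z \<in> X" "G holomorphic_on X"
      using zor_poly_nz(4)[OF y, of z] unfolding G_def by (auto simp: analytic_at)
    have "eventually (\<lambda>w. w \<in> ball z r \<inter> X - {z}) (at z)"
      using r(1) X by (intro eventually_at_in_open) auto
    thus ?thesis
    proof eventually_elim
      case (elim w)
      have G': "(G has_field_derivative deriv G w) (at w)"
        using holomorphic_derivI[OF X(3,1)] elim by auto
      have "((\<lambda>w. G w * (w - z) ^ l) has_field_derivative
              (deriv G w * (w - z) ^ l + G w * (of_nat l * (w - z) ^ (l - 1)))) (at w)"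
        by (auto intro!: derivative_eq_intros G')
      then have "(y has_field_derivative (deriv G w * (w - z) ^ l + G w * (of_nat l * (w - z) ^ (l - 1)))) (at w)"
        by (rule has_field_derivative_transform_within_open[where S = "ball z r"]) (use elim r in auto)
      then have "deriv y w = deriv G w * (w - z) ^ l + G w * (of_nat l * (w - z) ^ (l - 1))"
        by (rule DERIV_imp_deriv)
      moreover have "of_nat l * (w - z) ^ (l - 1) * (w - z) = of_nat l * (w - z) ^ l"
        by (cases l) auto
      ultimately have "deriv y w * (w - z) = (w - z) ^ l * ((w - z) * deriv G w + of_nat l * G w)"
        by (simp add: algebra_simps)
      thus ?case using r(2)[of w] elim by (simp add: G_def l_def)
    qed
  qed
  show ?thesis
  proof
    show "K analytic_on {z}" unfolding K_def by (intro analytic_intros an)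
    show "eventually (\<lambda>w. (w - z) * wronskian u v w = (w - z) ^ (nat (zorder u z) + nat (zorder v z)) * K w) (at z)"
      using loc[OF u] loc[OF v]
    proof eventually_elim
      case (elim w)
      define x where "x = w - z"
      have 1: "deriv u w * x = x ^ m * (x * deriv g w + of_nat m * g w)" "u w = g w * x ^ m"
              "deriv v w * x = x ^ n * (x * deriv h w + of_nat n * h w)" "v w = h w * x ^ n"
        using elim by (auto simp: x_def m_def n_def g_def h_def)
      have "x * wronskian u v w = u w * (deriv v w * x) - (deriv u w * x) * v w"
        by (simp add: wronskian_def algebra_simps)
      also have "\<dots> = x ^ (m + n) * K w"
      proof -
        have "K w = x * (g w * deriv h w - deriv g w * h w) + (of_nat n - of_nat m) * g w * h w"
          by (simp add: K_def x_def)
        thus ?thesis unfolding 1 by (simp only: power_add) (simp add: algebra_simps)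
      qed
      finally show ?case by (simp add: x_def m_def n_def)
    qed
    have "of_nat n = (of_int (zorder v z) :: complex)" "of_nat m = (of_int (zorder u z) :: complex)"
      using zorder_nonneg[OF u, of z] zorder_nonneg[OF v, of z] by (simp_all add: m_def n_def)
    thus "K z = (of_int (zorder v z) - of_int (zorder u z)) * zor_poly u z z * zor_poly v z z"
      by (simp add: K_def g_def h_def)
  qed
qed

text \<open>Differentiation costs one order: in the local form, w - z times the Wronskian is
  divisible by the full power (w - z)^(m+n).\<close>

lemma zorder_wronskian_ge:
  assumes u: "nz_entire u" and v: "nz_entire v" and W: "nz_entire (wronskian u v)"
  shows   "zorder u z + zorder v z \<le> zorder (wronskian u v) z + 1"
proof -
  define N where "N = nat (zorder u z) + nat (zorder v z)"
  obtain K where K: "K analytic_on {z}"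
    "eventually (\<lambda>w. (w - z) * wronskian u v w = (w - z) ^ N * K w) (at z)"
    using wronskian_local[OF u v] unfolding N_def by metis
  have W': "nz_entire (\<lambda>w. (w - z) * wronskian u v w)" by (intro nz_entire_mult nz_entire_linear W)
  have "eventually (\<lambda>w. K w \<noteq> 0) (at z)"
    using K(2) nz_entire_eventually[OF W', of z] by eventually_elim auto
  then have Knz: "frequently (\<lambda>w. K w \<noteq> 0) (at z)" by (simp add: eventually_frequently)
  have "zorder (\<lambda>w. (w - z) * wronskian u v w) z = zorder (\<lambda>w. (w - z) ^ N * K w) z"
    by (rule zorder_cong[OF K(2) refl])
  also have "\<dots> = zorder (\<lambda>w. (w - z) ^ N) z + zorder K z"
    by (intro zorder_mult nz_entire_meromorphic nz_entire_frequently nz_entire_power nz_entire_linear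
          analytic_on_imp_meromorphic_on K Knz)
  also have "zorder (\<lambda>w. (w - z) ^ N) z = int N" by (simp add: zorder_power' nz_entire_linear zorder_linear')
  finally have "1 + zorder (wronskian u v) z = int N + zorder K z"
    by (simp add: zorder_mult' nz_entire_linear W zorder_linear')
  moreover have "zorder K z \<ge> 0" by (rule zorder_ge_0[OF K(1) Knz])
  moreover have "int N = zorder u z + zorder v z"
    using zorder_nonneg[OF u, of z] zorder_nonneg[OF v, of z] by (simp add: N_def)
  ultimately show ?thesis by simp
qed

text \<open>Here K vanishes near z, and its value (n - m) g(z) h(z) at z forces m = n.\<close>

lemma zorder_eq_if_wronskian_0:
  assumes u: "nz_entire u" and v: "nz_entire v" and W: "\<And>w. wronskian u v w = 0"
  shows   "zorder u z = zorder v z"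
proof -
  obtain K where K: "K analytic_on {z}"
    "eventually (\<lambda>w. (w - z) * wronskian u v w = (w - z) ^ (nat (zorder u z) + nat (zorder v z)) * K w) (at z)"
    "K z = (of_int (zorder v z) - of_int (zorder u z)) * zor_poly u z z * zor_poly v z z"
    by (rule wronskian_local[OF u v, of z])
  have "eventually (\<lambda>w. w \<noteq> z) (at z)" by (rule eventually_neq_at_within)
  then have "eventually (\<lambda>w. K w = 0) (at z)" using K(2) by eventually_elim (simp add: W)
  then have "(K \<longlongrightarrow> 0) (at z)" by (rule tendsto_eventually)
  moreover have "(K \<longlongrightarrow> K z) (at z)" using analytic_at_imp_isCont[OF K(1)] by (simp add: isCont_def)
  ultimately have "K z = 0" using tendsto_unique at_neq_bot by metis
  thus ?thesis using K(3) zor_poly_nz(1)[OF u, of z] zor_poly_nz(1)[OF v, of z] by simp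
qed

lemma wronskian_holomorphic: "nz_entire u \<Longrightarrow> nz_entire v \<Longrightarrow> wronskian u v holomorphic_on UNIV"
  unfolding wronskian_def[abs_def] nz_entire_def by (auto intro!: holomorphic_intros)

lemma wronskian_add:
  assumes "nz_entire u" "nz_entire v"
  shows   "wronskian v (\<lambda>z. u z + v z) z = - wronskian u v z" "wronskian u (\<lambda>z. u z + v z) z = wronskian u v z"
proof -
  have "u field_differentiable at z" "v field_differentiable at z"
    using assms by (auto simp: nz_entire_def holomorphic_on_imp_differentiable_at)
  then have "deriv (\<lambda>z. u z + v z) z = deriv u z + deriv v z" by (rule deriv_add)
  thus "wronskian v (\<lambda>z. u z + v z) z = - wronskian u v z" "wronskian u (\<lambda>z. u z + v z) z = wronskian u v z"
    by (simp_all add: wronskian_def algebra_simps)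
qed

text \<open>Common zeros of \<open>u\<close> and \<open>v\<close> are counted by \<open>Y1\<close> with multiplicity, all other zeros of \<open>u\<close>, \<open>v\<close>
  and \<open>u + v\<close> by \<open>Y2\<close> without.\<close>

lemma (in slow_sequence) abc_inequality:
  assumes u: "nz_entire u" "controlled u" and v: "nz_entire v" "controlled v"
    and Y: "nz_entire Y1" "nz_entire Y2"
    and common: "\<And>z. zorder u z \<le> zorder Y1 z \<or> zorder v z \<le> zorder Y1 z"
    and zeros: "\<And>z. Y2 z \<noteq> 0 \<Longrightarrow> u z \<noteq> 0 \<and> v z \<noteq> 0"
      "\<And>z. nz_entire (\<lambda>z. u z + v z) \<Longrightarrow> Y2 z \<noteq> 0 \<Longrightarrow> u z + v z \<noteq> 0"
    and e: "\<epsilon> > 0"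
  shows   "\<forall>\<^sub>F j in sequentially. nu u (\<rho> j) \<le> nu Y1 (\<rho> j) + nu Y2 (\<rho> j) + \<epsilon> * \<Phi> (\<rho> j)"
          "\<forall>\<^sub>F j in sequentially. nu v (\<rho> j) \<le> nu Y1 (\<rho> j) + nu Y2 (\<rho> j) + \<epsilon> * \<Phi> (\<rho> j)"
proof -
  define Y where "Y = (\<lambda>z. Y1 z * Y2 z)"
  have Ye: "nz_entire Y" unfolding Y_def by (intro nz_entire_mult Y)
  have Yo: "zorder Y z = zorder Y1 z + zorder Y2 z" for z unfolding Y_def by (rule zorder_mult'[OF Y])
  have nuY: "nu Y r = nu Y1 r + nu Y2 r" for r unfolding Y_def by (rule nu_mult[OF Y])
  have Y0: "zorder Y1 z \<ge> 0" "zorder Y2 z \<ge> 0" for z using Y zorder_nonneg by blast+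
  have "(\<forall>\<^sub>F j in sequentially. nu u (\<rho> j) \<le> nu Y (\<rho> j) + \<epsilon> * \<Phi> (\<rho> j)) \<and>
        (\<forall>\<^sub>F j in sequentially. nu v (\<rho> j) \<le> nu Y (\<rho> j) + \<epsilon> * \<Phi> (\<rho> j))"
  proof (cases "\<forall>w. wronskian u v w = 0")
    \<comment> \<open>The Wronskian gives nothing here, but u and v have equal orders everywhere, so
      all their zeros are common and counted by Y1.\<close>
    case True
    have eq: "zorder u z = zorder v z" for z using zorder_eq_if_wronskian_0[OF u(1) v(1)] True by blast
    have "zorder u z \<le> zorder Y z" "zorder v z \<le> zorder Y z" for z
      using common[of z] eq[of z] Y0[of z] by (auto simp: Yo)
    thus ?thesis using nu_mono_ord[OF u(1) Ye _ e] nu_mono_ord[OF v(1) Ye _ e] by blast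
  next
    case False
    define s where "s = (\<lambda>z. u z + v z)"
    have W: "nz_entire (wronskian u v)"
      using False wronskian_holomorphic[OF u(1) v(1)] by (auto simp: nz_entire_def)
    have s: "nz_entire s"
    proof (rule ccontr)
      assume "\<not> nz_entire s"
      then have "s = (\<lambda>_. 0)" using u v by (auto simp: nz_entire_def s_def intro!: holomorphic_intros)
      then have "wronskian u s w = 0" for w by (simp add: wronskian_def)
      thus False using False wronskian_add(2)[OF u(1) v(1)] by (auto simp: s_def)
    qed
    have sc: "controlled s" unfolding s_def by (intro controlled_add u v)
    have Wus: "wronskian u s = wronskian u v" unfolding s_def using wronskian_add(2)[OF u(1) v(1)] by blast
    have Wvs: "wronskian v s = (\<lambda>z. - wronskian u v z)" unfolding s_def using wronskian_add(1)[OF u(1) v(1)] by blast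
    have W': "nz_entire (wronskian u s)" "nz_entire (wronskian v s)"
      using W by (auto simp: Wus Wvs nz_entire_def intro!: holomorphic_intros)
    have Weq: "zorder (wronskian v s) z = zorder (wronskian u s) z" for z by (simp add: Wus Wvs)
    \<comment> \<open>A zero of Y2 pays for the order lost by the Wronskian. Y1 pays for that of u
      and v which \<open>common\<close> provides, and the Wronskian of the other one with s pays for
      the remaining two functions.\<close>
    have key: "zorder u z + zorder v z + zorder s z \<le> zorder (wronskian u s) z + zorder Y z" for z
    proof (cases "Y2 z = 0")
      case True
      then have "zorder Y2 z \<ge> 1" using zorder_pos[OF Y(2), of z] by simp
      thus ?thesis
        using common[of z] zorder_wronskian_ge[OF u(1) s W'(1), of z] zorder_wronskian_ge[OF v(1) s W'(2), of z]
          Weq[of z] by (auto simp: Yo)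
    next
      case False
      then have "u z \<noteq> 0" "v z \<noteq> 0" "s z \<noteq> 0" using zeros s by (auto simp: s_def)
      then have "zorder u z = 0" "zorder v z = 0" "zorder s z = 0"
        using zorder_eq_0 u(1) v(1) s by blast+
      thus ?thesis using Y0[of z] zorder_nonneg[OF W'(1), of z] by (simp add: Yo)
    qed
    have 1: "zorder u z + zorder s z + zorder v z \<le> zorder (wronskian u s) z + zorder Y z" for z using key[of z] by simp
    have 2: "zorder v z + zorder s z + zorder u z \<le> zorder (wronskian v s) z + zorder Y z" for z
      using key[of z] Weq[of z] by simp
    show ?thesis
      using wronskian_bound[OF v s sc u(1) W'(2) Ye 2 e] wronskian_bound[OF u s sc v(1) W'(1) Ye 1 e] by blast
  qed
  thus "\<forall>\<^sub>F j in sequentially. nu u (\<rho> j) \<le> nu Y1 (\<rho> j) + nu Y2 (\<rho> j) + \<epsilon> * \<Phi> (\<rho> j)"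
       "\<forall>\<^sub>F j in sequentially. nu v (\<rho> j) \<le> nu Y1 (\<rho> j) + nu Y2 (\<rho> j) + \<epsilon> * \<Phi> (\<rho> j)"
    by (simp_all add: nuY)
qed

section \<open>The degree bound\<close>

text \<open>This is B^n P(A / B) for P with leading coefficient l and roots \<open>rt\<close>
  repeated by multiplicity; the factored form lets \<open>nu\<close> be computed factor by
  factor.\<close>

definition hom_prod :: "complex \<Rightarrow> (nat \<Rightarrow> complex) \<Rightarrow> nat \<Rightarrow> (complex \<Rightarrow> complex) \<Rightarrow> (complex \<Rightarrow> complex) \<Rightarrow> complex \<Rightarrow> complex" where
  "hom_prod l rt n A B z = l * (\<Prod>i<n. A z - rt i * B z)"

text \<open>The numerator of L(A / B) over the common denominator B
  \<open>shift_prod\<close>.\<close>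

definition L_num :: "nat \<Rightarrow> (nat \<Rightarrow> complex) \<Rightarrow> (nat \<Rightarrow> complex) \<Rightarrow> (nat \<Rightarrow> complex) \<Rightarrow>
    (complex \<Rightarrow> complex) \<Rightarrow> (complex \<Rightarrow> complex) \<Rightarrow> complex \<Rightarrow> complex" where
  "L_num k a q c A B z =
     (\<Sum>j\<le>k. a j * (A (q j * z + c j) * B z - A z * B (q j * z + c j)) * (\<Prod>i\<in>{..k}-{j}. B (q i * z + c i)))"

definition shift_prod :: "nat \<Rightarrow> (nat \<Rightarrow> complex) \<Rightarrow> (nat \<Rightarrow> complex) \<Rightarrow> (complex \<Rightarrow> complex) \<Rightarrow> complex \<Rightarrow> complex" where
  "shift_prod k q c B z = (\<Prod>j\<le>k. B (q j * z + c j))"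

context slow_sequence
begin

lemma nu_upper_mult:
  assumes "nz_entire u" and "D \<ge> 0" and e: "\<epsilon> > 0"
    and "\<forall>\<^sub>F j in sequentially. \<forall>z. norm z \<le> 2 * \<rho> j \<longrightarrow> norm (u z) \<le> D * exp (X j)"
  shows   "\<forall>\<^sub>F j in sequentially. nu u (\<rho> j) \<le> X j + \<epsilon> * \<Phi> (\<rho> j)"
proof (rule nu_upper[OF assms(1)])
  show "\<forall>\<^sub>F j in sequentially. \<forall>z. norm z \<le> 2 * \<rho> j \<longrightarrow> norm (u z) \<le> exp (X j + \<epsilon> * \<Phi> (\<rho> j))"
    using assms(4) const_small[OF e, of "ln (1 + D)"]
  proof eventually_elim
    case (elim j)
    show ?case
    proof (intro allI impI)
      fix z :: complex assume "norm z \<le> 2 * \<rho> j"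
      with elim(1) have "norm (u z) \<le> D * exp (X j)" by blast
      also have "\<dots> \<le> exp (ln (1 + D)) * exp (X j)" using assms(2) by (intro mult_right_mono) auto
      also have "\<dots> \<le> exp (\<epsilon> * \<Phi> (\<rho> j)) * exp (X j)" using elim(2) by (intro mult_right_mono) auto
      finally show "norm (u z) \<le> exp (X j + \<epsilon> * \<Phi> (\<rho> j))" by (simp add: exp_add mult.commute)
    qed
  qed
qed

text \<open>A polynomial has mean O(ln r), which is negligible against \<Phi>. It will account for
  the finitely many zeros allowed to the function under study.\<close>

lemma nu_linear_prod:
  assumes "finite Z" and e: "\<epsilon> > 0"
  shows   "\<forall>\<^sub>F j in sequentially. nu (\<lambda>z. \<Prod>x\<in>Z. z - x) (\<rho> j) \<le> \<epsilon> * \<Phi> (\<rho> j)"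
proof -
  have "\<forall>\<^sub>F j in sequentially. nu (\<lambda>z. \<Prod>x\<in>Z. z - x) (\<rho> j) \<le> (\<Sum>x\<in>Z. ln (2 + norm x)) + real (card Z) * ln (\<rho> j)"
  proof (rule nu_upper)
    show "nz_entire (\<lambda>z. \<Prod>x\<in>Z. z - x)" by (intro nz_entire_prod nz_entire_linear)
    show "\<forall>\<^sub>F j in sequentially. \<forall>z. norm z \<le> 2 * \<rho> j \<longrightarrow>
        norm (\<Prod>x\<in>Z. z - x) \<le> exp ((\<Sum>x\<in>Z. ln (2 + norm x)) + real (card Z) * ln (\<rho> j))"
      using rho_ge[of 1]
    proof eventually_elim
      case (elim j)
      show ?case
      proof (intro allI impI)
        fix z :: complex assume z: "norm z \<le> 2 * \<rho> j"
        have "norm (\<Prod>x\<in>Z. z - x) = (\<Prod>x\<in>Z. norm (z - x))" by (simp add: prod_norm)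
        also have "\<dots> \<le> (\<Prod>x\<in>Z. exp (ln (2 + norm x) + ln (\<rho> j)))"
        proof (intro prod_mono conjI)
          fix x :: complex
          have pos: "0 < 2 + norm x" by (rule add_pos_nonneg) auto
          have "norm (z - x) \<le> 2 * \<rho> j + norm x" using norm_triangle_ineq4[of z x] z by linarith
          also have "norm x \<le> norm x * \<rho> j" using mult_left_mono[OF elim, of "norm x"] by simp
          also have "2 * \<rho> j + norm x * \<rho> j = exp (ln (2 + norm x) + ln (\<rho> j))"
            using elim pos by (simp add: exp_add distrib_right)
          finally show "norm (z - x) \<le> exp (ln (2 + norm x) + ln (\<rho> j))" by simp
        qed auto
        also have "\<dots> = exp ((\<Sum>x\<in>Z. ln (2 + norm x)) + real (card Z) * ln (\<rho> j))"
          using assms(1) by (simp add: exp_sum[symmetric] sum.distrib)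
        finally show "norm (\<Prod>x\<in>Z. z - x) \<le> exp ((\<Sum>x\<in>Z. ln (2 + norm x)) + real (card Z) * ln (\<rho> j))" .
      qed
    qed
  qed
  with log_const_small[OF e, of "\<Sum>x\<in>Z. ln (2 + norm x)" "real (card Z)"]
  show ?thesis by eventually_elim linarith
qed

text \<open>A common factor \<kappa> for all substitutions lets one maximum modulus estimate cover
  all of them.\<close>

lemma affine_in_disc:
  fixes k :: nat and q c :: "nat \<Rightarrow> complex"
  shows "\<exists>\<kappa>\<ge>2. \<forall>j\<le>k. \<forall>r\<ge>1. \<forall>z. norm z \<le> 2 * r \<longrightarrow> norm (q j * z + c j) \<le> \<kappa> * r"
proof -
  define \<kappa> where "\<kappa> = 2 + (\<Sum>j\<le>k. 2 * norm (q j) + norm (c j))"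
  have "\<kappa> \<ge> 2" unfolding \<kappa>_def by (simp add: sum_nonneg)
  moreover have "norm (q j * z + c j) \<le> \<kappa> * r" if "j \<le> k" "1 \<le> r" "norm z \<le> 2 * r" for j z r
  proof -
    have "norm (q j * z + c j) \<le> norm (q j) * norm z + norm (c j)" by (metis norm_mult norm_triangle_ineq)
    also have "\<dots> \<le> norm (q j) * (2 * r) + norm (c j) * r"
      using that by (intro add_mono mult_left_mono) (auto simp: mult_le_cancel_left1)
    also have "\<dots> = (2 * norm (q j) + norm (c j)) * r" by (simp add: algebra_simps)
    also have "\<dots> \<le> \<kappa> * r"
    proof (rule mult_right_mono)
      have "2 * norm (q j) + norm (c j) \<le> (\<Sum>j\<le>k. 2 * norm (q j) + norm (c j))"
        using that by (intro member_le_sum) auto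
      thus "2 * norm (q j) + norm (c j) \<le> \<kappa>" by (simp add: \<kappa>_def)
    qed (use that in auto)
    finally show ?thesis .
  qed
  ultimately show ?thesis by blast
qed

text \<open>Every term contains one factor A and k + 1 factors B, shifted or not, and shifted values
  are covered by the maximum modulus on a larger disc. The error counts the factor A, the k + 1
  factors B and the coefficients.\<close>

lemma nu_L_num_le:
  assumes A: "nz_entire A" "controlled A" and B: "nz_entire B" "controlled B"
    and L: "nz_entire (L_num k a q c A B)" and e: "\<epsilon> > 0"
  shows   "\<forall>\<^sub>F j in sequentially. nu (L_num k a q c A B) (\<rho> j) \<le>
             nu A (\<rho> j) + (real k + 1) * nu B (\<rho> j) + (real k + 3) * \<epsilon> * \<Phi> (\<rho> j)"
proof -
  obtain \<kappa> where \<kappa>: "\<kappa> \<ge> 2" "\<And>j z r. j \<le> k \<Longrightarrow> 1 \<le> r \<Longrightarrow> norm z \<le> 2 * r \<Longrightarrow> norm (q j * z + c j) \<le> \<kappa> * r"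
    using affine_in_disc[of k q c] by blast
  have \<kappa>1: "\<kappa> \<ge> 1" using \<kappa> by simp
  define D where "D = (\<Sum>j\<le>k. 2 * norm (a j))"
  have "\<forall>\<^sub>F j in sequentially. nu (L_num k a q c A B) (\<rho> j) \<le>
     (nu A (\<rho> j) + \<epsilon> * \<Phi> (\<rho> j) + (real k + 1) * (nu B (\<rho> j) + \<epsilon> * \<Phi> (\<rho> j))) + \<epsilon> * \<Phi> (\<rho> j)"
  proof (rule nu_upper_mult[OF L _ e])
    show "D \<ge> 0" by (auto simp: D_def intro!: sum_nonneg)
    show "\<forall>\<^sub>F j in sequentially. \<forall>z. norm z \<le> 2 * \<rho> j \<longrightarrow> norm (L_num k a q c A B z) \<le>
        D * exp (nu A (\<rho> j) + \<epsilon> * \<Phi> (\<rho> j) + (real k + 1) * (nu B (\<rho> j) + \<epsilon> * \<Phi> (\<rho> j)))"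
      using max_modulus_le_nu[OF A \<kappa>1 e] max_modulus_le_nu[OF B \<kappa>1 e] rho_ge[of 1]
    proof eventually_elim
      case (elim j)
      define x y where "x = exp (nu A (\<rho> j) + \<epsilon> * \<Phi> (\<rho> j))" and "y = exp (nu B (\<rho> j) + \<epsilon> * \<Phi> (\<rho> j))"
      have xy: "x > 0" "y > 0" by (auto simp: x_def y_def)
      show ?case
      proof (intro allI impI)
        fix z :: complex assume z: "norm z \<le> 2 * \<rho> j"
        have "2 * \<rho> j \<le> \<kappa> * \<rho> j" using \<kappa>(1) elim(3) by (intro mult_right_mono) auto
        then have z': "norm z \<le> \<kappa> * \<rho> j" using z by linarith
        have AB: "norm (A z) \<le> x" "norm (B z) \<le> y"
          "\<And>i. i \<le> k \<Longrightarrow> norm (A (q i * z + c i)) \<le> x" "\<And>i. i \<le> k \<Longrightarrow> norm (B (q i * z + c i)) \<le> y"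
          using elim(1,2) z' \<kappa>(2)[OF _ elim(3) z] by (auto simp: x_def y_def)
        have "norm (L_num k a q c A B z) \<le> (\<Sum>i\<le>k. 2 * norm (a i) * (x * y ^ Suc k))"
          unfolding L_num_def
        proof (rule sum_norm_le)
          fix i assume i: "i \<in> {..k}"
          have 1: "norm (A (q i * z + c i) * B z - A z * B (q i * z + c i)) \<le> 2 * (x * y)"
          proof -
            have "norm (A (q i * z + c i) * B z) \<le> x * y" "norm (A z * B (q i * z + c i)) \<le> x * y"
              unfolding norm_mult using AB i xy by (auto intro!: mult_mono)
            thus ?thesis using norm_triangle_ineq4[of "A (q i * z + c i) * B z" "A z * B (q i * z + c i)"] by linarith
          qed
          have "norm (\<Prod>i\<in>{..k}-{i}. B (q i * z + c i)) = (\<Prod>i\<in>{..k}-{i}. norm (B (q i * z + c i)))"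
            by (simp add: prod_norm)
          also have "\<dots> \<le> (\<Prod>i\<in>{..k}-{i}. y)" using AB(4) by (intro prod_mono) auto
          also have "\<dots> = y ^ k" using i by simp
          finally have 2: "norm (\<Prod>i\<in>{..k}-{i}. B (q i * z + c i)) \<le> y ^ k" .
          have "norm (a i * (A (q i * z + c i) * B z - A z * B (q i * z + c i)) * (\<Prod>i\<in>{..k}-{i}. B (q i * z + c i)))
              \<le> norm (a i) * (2 * (x * y)) * y ^ k"
            unfolding norm_mult[of "a i * _"] norm_mult[of "a i"]
            using 1 2 xy by (intro mult_mono) auto
          thus "norm (a i * (A (q i * z + c i) * B z - A z * B (q i * z + c i)) * (\<Prod>i\<in>{..k}-{i}. B (q i * z + c i)))
              \<le> 2 * norm (a i) * (x * y ^ Suc k)" by (simp add: mult_ac)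
        qed
        also have "\<dots> = D * (x * y ^ Suc k)" by (simp add: D_def sum_distrib_right)
        also have "x * y ^ Suc k = exp (nu A (\<rho> j) + \<epsilon> * \<Phi> (\<rho> j) + (real k + 1) * (nu B (\<rho> j) + \<epsilon> * \<Phi> (\<rho> j)))"
        proof -
          have "y ^ Suc k = exp (real (Suc k) * (nu B (\<rho> j) + \<epsilon> * \<Phi> (\<rho> j)))"
            unfolding y_def by (rule exp_of_nat_mult[symmetric])
          thus ?thesis unfolding x_def by (simp add: exp_add[symmetric] add.commute)
        qed
        finally show "norm (L_num k a q c A B z) \<le>
           D * exp (nu A (\<rho> j) + \<epsilon> * \<Phi> (\<rho> j) + (real k + 1) * (nu B (\<rho> j) + \<epsilon> * \<Phi> (\<rho> j)))" .
      qed
    qed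
  qed
  thus ?thesis by eventually_elim (simp add: algebra_simps)
qed

lemma nu_shift_le:
  assumes B: "nz_entire B" "controlled B" and q: "q \<noteq> 0" and e: "\<epsilon> > 0"
  shows   "\<forall>\<^sub>F j in sequentially. nu (\<lambda>z. B (q * z + c)) (\<rho> j) \<le> nu B (\<rho> j) + \<epsilon> * \<Phi> (\<rho> j)"
proof (rule nu_upper[OF nz_entire_affine[OF B(1) q]])
  obtain \<kappa> where \<kappa>: "\<kappa> \<ge> 2" "\<forall>r\<ge>1. \<forall>z. norm z \<le> 2 * r \<longrightarrow> norm (q * z + c) \<le> \<kappa> * r"
    using affine_in_disc[of 0 "\<lambda>_. q" "\<lambda>_. c"] by blast
  have \<kappa>1: "\<kappa> \<ge> 1" using \<kappa> by simp
  show "\<forall>\<^sub>F j in sequentially. \<forall>z. norm z \<le> 2 * \<rho> j \<longrightarrow> norm (B (q * z + c)) \<le> exp (nu B (\<rho> j) + \<epsilon> * \<Phi> (\<rho> j))"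
    using max_modulus_le_nu[OF B \<kappa>1 e] rho_ge[of 1] by eventually_elim (simp add: \<kappa>(2))
qed

lemma nu_diff_le:
  assumes A: "nz_entire A" "controlled A" and B: "nz_entire B" "controlled B"
    and D: "nz_entire (\<lambda>z. A z - x * B z)" and e: "\<epsilon> > 0"
  shows   "\<forall>\<^sub>F j in sequentially. nu (\<lambda>z. A z - x * B z) (\<rho> j) \<le> max (nu A (\<rho> j)) (nu B (\<rho> j)) + 2 * \<epsilon> * \<Phi> (\<rho> j)"
proof -
  have "\<forall>\<^sub>F j in sequentially. nu (\<lambda>z. A z - x * B z) (\<rho> j) \<le> (max (nu A (\<rho> j)) (nu B (\<rho> j)) + \<epsilon> * \<Phi> (\<rho> j)) + \<epsilon> * \<Phi> (\<rho> j)"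
  proof (rule nu_upper_mult[OF D _ e])
    show "\<forall>\<^sub>F j in sequentially. \<forall>z. norm z \<le> 2 * \<rho> j \<longrightarrow>
       norm (A z - x * B z) \<le> (1 + norm x) * exp (max (nu A (\<rho> j)) (nu B (\<rho> j)) + \<epsilon> * \<Phi> (\<rho> j))"
      using max_modulus_le_nu[OF A _ e, of 2, simplified] max_modulus_le_nu[OF B _ e, of 2, simplified]
    proof eventually_elim
      case (elim j)
      show ?case
      proof (intro allI impI)
        fix z :: complex assume z: "norm z \<le> 2 * \<rho> j"
        define M where "M = exp (max (nu A (\<rho> j)) (nu B (\<rho> j)) + \<epsilon> * \<Phi> (\<rho> j))"
        have "exp (nu A (\<rho> j) + \<epsilon> * \<Phi> (\<rho> j)) \<le> M" "exp (nu B (\<rho> j) + \<epsilon> * \<Phi> (\<rho> j)) \<le> M"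
          unfolding M_def by simp_all
        then have M: "norm (A z) \<le> M" "norm (B z) \<le> M"
          using elim z by (meson order_trans)+
        have "norm (A z - x * B z) \<le> norm (A z) + norm x * norm (B z)"
          by (metis norm_mult norm_triangle_ineq4)
        also have "\<dots> \<le> M + norm x * M" using M by (intro add_mono mult_left_mono) auto
        finally show "norm (A z - x * B z) \<le> (1 + norm x) * exp (max (nu A (\<rho> j)) (nu B (\<rho> j)) + \<epsilon> * \<Phi> (\<rho> j))"
          by (simp add: M_def[symmetric] distrib_right)
      qed
    qed
  qed simp
  thus ?thesis by eventually_elim simp
qed

text \<open>A is (A - x B) + x B, so \<open>nu_diff_le\<close> applies with A - x B in place of A.
  Consequently no A - x B is much smaller on average than A when A dominates B.\<close>

lemma nu_dominant:
  assumes A: "nz_entire A" "controlled A" and B: "nz_entire B" "controlled B"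
    and D: "nz_entire (\<lambda>z. A z - x * B z)" and e: "\<epsilon> > 0"
  shows   "\<forall>\<^sub>F j in sequentially. nu A (\<rho> j) \<le> max (nu (\<lambda>z. A z - x * B z) (\<rho> j)) (nu B (\<rho> j)) + 2 * \<epsilon> * \<Phi> (\<rho> j)"
proof -
  have "controlled (\<lambda>z. A z - x * B z)" by (intro controlled_diff controlled_mult controlled_const A B)
  from nu_diff_le[OF D this B _ e, of "- x"] show ?thesis using A by simp
qed

text \<open>The set F contains all zeros of the cleared function that do not come from denominators.
  By \<open>large\<close> the larger of \<open>nu A\<close> and \<open>nu B\<close> is comparable
  with \<Phi>, so errors that are small against \<Phi> are small against it.\<close>

lemma degree_bound:
  assumes A: "nz_entire A" "controlled A" and B: "nz_entire B" "controlled B"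
    and S: "nz_entire S" "controlled S" and T: "nz_entire T" "controlled T"
    and q: "\<And>j. j \<le> k \<Longrightarrow> q j \<noteq> 0" and coprime: "\<And>z. A z = 0 \<Longrightarrow> B z \<noteq> 0" and l: "l \<noteq> 0"
    and Z: "finite Z" "rt ` {..<n} \<subseteq> Z" "\<And>x. x \<in> Z \<Longrightarrow> nz_entire (\<lambda>z. A z - x * B z)"
    and L: "nz_entire (L_num k a q c A B)" and F: "finite F"
    and zeros: "\<And>z. nz_entire (\<lambda>z. T z * (hom_prod l rt n A B z * L_num k a q c A B z) - S z * (B z ^ Suc n * shift_prod k q c B z)) \<Longrightarrow>
       z \<notin> F \<Longrightarrow> T z \<noteq> 0 \<Longrightarrow> B z \<noteq> 0 \<Longrightarrow> shift_prod k q c B z \<noteq> 0 \<Longrightarrow>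
       T z * (hom_prod l rt n A B z * L_num k a q c A B z) - S z * (B z ^ Suc n * shift_prod k q c B z) \<noteq> 0"
    and small: "\<And>\<epsilon>. \<epsilon> > 0 \<Longrightarrow> \<forall>\<^sub>F j in sequentially. nu S (\<rho> j) \<le> \<epsilon> * \<Phi> (\<rho> j)"
      "\<And>\<epsilon>. \<epsilon> > 0 \<Longrightarrow> \<forall>\<^sub>F j in sequentially. nu T (\<rho> j) \<le> \<epsilon> * \<Phi> (\<rho> j)"
    and large: "\<forall>\<^sub>F j in sequentially. \<Phi> (\<rho> j) \<le> 2 * max (nu A (\<rho> j)) (nu B (\<rho> j))"
  shows "n \<le> card Z + 3 * k + 5" "B = (\<lambda>_. 1) \<Longrightarrow> n \<le> card Z + 1"
proof -
  define m where "m = card Z"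
  define PH where "PH = hom_prod l rt n A B"
  define Lm where "Lm = L_num k a q c A B"
  define Sh where "Sh = shift_prod k q c B"
  define e where "e = (\<lambda>x z. A z - x * B z)"
  have rtZ: "rt i \<in> Z" if "i < n" for i using Z(2) that by auto
  have e_ent: "nz_entire (e x)" if "x \<in> Z" for x using Z(3)[OF that] by (simp add: e_def)
  have PH_eq: "PH = (\<lambda>z. l * (\<Prod>i<n. e (rt i) z))" by (simp add: PH_def hom_prod_def e_def fun_eq_iff)
  have Sh_eq: "Sh = (\<lambda>z. \<Prod>j\<le>k. B (q j * z + c j))" by (simp add: Sh_def shift_prod_def fun_eq_iff)
  have PH: "nz_entire PH" unfolding PH_eq by (intro nz_entire_mult nz_entire_const nz_entire_prod e_ent l) (use rtZ in auto)
  have Lm: "nz_entire Lm" using L by (simp add: Lm_def)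
  have Sh: "nz_entire Sh" unfolding Sh_eq by (intro nz_entire_prod nz_entire_affine B q) auto
  have PHc: "controlled PH" unfolding PH_eq e_def
    by (intro controlled_mult controlled_const controlled_prod controlled_diff A B)
  have Lmc: "controlled Lm" unfolding Lm_def L_num_def[abs_def]
    by (intro controlled_mult controlled_const controlled_prod controlled_diff controlled_sum controlled_affine A B)
  have Shc: "controlled Sh" unfolding Sh_eq by (intro controlled_prod controlled_affine B)
  define u where "u = (\<lambda>z. T z * (PH z * Lm z))"
  define v where "v = (\<lambda>z. (- 1) * (S z * (B z ^ Suc n * Sh z)))"
  \<comment> \<open>Common zeros: where B vanishes, A and hence PH do not, so u has only the order
    of T Lm. Elsewhere B^(n+1) has order 0 and v has only the order of S Sh.\<close>
  define Y1 where "Y1 = (\<lambda>z. Lm z * (Sh z * (S z * T z)))"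
  \<comment> \<open>Vanishes at all zeros of u and v and, unless it is identically zero, of u + v.
    One factor for each element of Z stands for the n factors of PH.\<close>
  define Y2 where "Y2 = (\<lambda>z. (\<Prod>x\<in>Z. e x z) * (B z * (Y1 z * (\<Prod>x\<in>F. z - x))))"
  have uv: "u z + v z = T z * (hom_prod l rt n A B z * L_num k a q c A B z) - S z * (B z ^ Suc n * shift_prod k q c B z)" for z
    by (simp add: u_def v_def PH_def Lm_def Sh_def)
  have u: "nz_entire u" "controlled u" unfolding u_def
    by (intro nz_entire_mult controlled_mult T PH Lm PHc Lmc)+
  have BS: "nz_entire (\<lambda>z. S z * (B z ^ Suc n * Sh z))" "nz_entire (\<lambda>z. B z ^ Suc n * Sh z)" "nz_entire (\<lambda>z. B z ^ Suc n)"
    by (intro nz_entire_mult nz_entire_power S B Sh)+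
  have v: "nz_entire v" "controlled v" unfolding v_def
    by (intro nz_entire_mult controlled_mult nz_entire_power controlled_power nz_entire_const controlled_const S B Sh Shc; simp)+
  have ST: "nz_entire (\<lambda>z. S z * T z)" "nz_entire (\<lambda>z. Sh z * (S z * T z))" by (intro nz_entire_mult S T Sh)+
  have Y1: "nz_entire Y1" unfolding Y1_def by (intro nz_entire_mult Lm ST)
  have Fp: "nz_entire (\<lambda>z. \<Prod>x\<in>F. z - x)" by (intro nz_entire_prod nz_entire_linear)
  have Zp: "nz_entire (\<lambda>z. \<Prod>x\<in>Z. e x z)" by (intro nz_entire_prod e_ent)
  have Y2': "nz_entire (\<lambda>z. Y1 z * (\<Prod>x\<in>F. z - x))" "nz_entire (\<lambda>z. B z * (Y1 z * (\<Prod>x\<in>F. z - x)))"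
    by (intro nz_entire_mult Y1 B Fp)+
  have Y2: "nz_entire Y2" unfolding Y2_def by (intro nz_entire_mult Zp Y2')
  have nonneg_ord: "zorder S z \<ge> 0" "zorder T z \<ge> 0" "zorder Sh z \<ge> 0" "zorder Lm z \<ge> 0" for z
    using S T Sh Lm zorder_nonneg by blast+
  have Y1_ord: "zorder Y1 z = zorder Lm z + zorder Sh z + zorder S z + zorder T z" for z
    unfolding Y1_def using zorder_mult'[OF Lm ST(2), of z] zorder_mult'[OF Sh ST(1), of z] zorder_mult'[OF S(1) T(1), of z] by simp
  have common: "zorder u z \<le> zorder Y1 z \<or> zorder v z \<le> zorder Y1 z" for z
  proof (cases "B z = 0")
    case True
    then have "A z \<noteq> 0" using coprime by blast
    then have "PH z \<noteq> 0" using True l by (simp add: PH_eq e_def)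
    then have "zorder PH z = 0" using zorder_eq_0[OF PH] by blast
    then have "zorder u z = zorder T z + zorder Lm z"
      unfolding u_def using zorder_mult'[OF T(1) nz_entire_mult[OF PH Lm], of z] zorder_mult'[OF PH Lm, of z] by simp
    thus ?thesis using Y1_ord[of z] nonneg_ord[of z] by simp
  next
    case False
    then have "zorder (\<lambda>z. B z ^ Suc n) z = 0" using zorder_eq_0[OF BS(3)] by simp
    then have "zorder v z = zorder S z + zorder Sh z"
      unfolding v_def using zorder_mult'[OF S(1) BS(2), of z] zorder_mult'[OF BS(3) Sh, of z] by (simp add: zorder_cmult)
    thus ?thesis using Y1_ord[of z] nonneg_ord[of z] by simp
  qed
  have Y2nz: "u z \<noteq> 0 \<and> v z \<noteq> 0" if "Y2 z \<noteq> 0" for z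
  proof -
    have "\<And>x. x \<in> Z \<Longrightarrow> e x z \<noteq> 0" using that Z(1) by (auto simp: Y2_def)
    then have "PH z \<noteq> 0" using rtZ l by (simp add: PH_eq)
    thus ?thesis using that by (auto simp: u_def v_def Y2_def Y1_def)
  qed
  have Y2nz': "u z + v z \<noteq> 0" if "nz_entire (\<lambda>z. u z + v z)" "Y2 z \<noteq> 0" for z
  proof -
    have "z \<notin> F" "T z \<noteq> 0" "B z \<noteq> 0" "Sh z \<noteq> 0" using that(2) F by (auto simp: Y2_def Y1_def)
    thus ?thesis using zeros[of z] that(1) unfolding uv Sh_def by blast
  qed
  \<comment> \<open>Makes the sum of all errors equal to X / 4 at a radius where \<Phi> has the
    value X, and \<open>large\<close> bounds this by half of the larger mean.\<close>
  define \<eta> where "\<eta> = 1 / (4 * (2 * real n + 2 * real m + 3 * real k + 20))"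
  have \<eta>: "\<eta> > 0" by (auto simp: \<eta>_def intro!: add_nonneg_pos)
  have abc: "\<forall>\<^sub>F j in sequentially. nu u (\<rho> j) \<le> nu Y1 (\<rho> j) + nu Y2 (\<rho> j) + \<eta> * \<Phi> (\<rho> j)"
            "\<forall>\<^sub>F j in sequentially. nu v (\<rho> j) \<le> nu Y1 (\<rho> j) + nu Y2 (\<rho> j) + \<eta> * \<Phi> (\<rho> j)"
    by (rule abc_inequality[OF u v Y1 Y2 common _ _ \<eta>]; use Y2nz Y2nz' in blast)+
  have E_shift: "\<forall>\<^sub>F j in sequentially. \<forall>i\<in>{..k}. nu (\<lambda>z. B (q i * z + c i)) (\<rho> j) \<le> nu B (\<rho> j) + \<eta> * \<Phi> (\<rho> j)"
    by (intro eventually_ball_finite ballI nu_shift_le B q \<eta>) auto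
  have E_diff: "\<forall>\<^sub>F j in sequentially. \<forall>x\<in>Z. nu (e x) (\<rho> j) \<le> max (nu A (\<rho> j)) (nu B (\<rho> j)) + 2 * \<eta> * \<Phi> (\<rho> j)"
    unfolding e_def by (intro eventually_ball_finite ballI nu_diff_le A B Z(1) Z(3) \<eta>)
  have E_dom: "\<forall>\<^sub>F j in sequentially. \<forall>x\<in>Z. nu A (\<rho> j) \<le> max (nu (e x) (\<rho> j)) (nu B (\<rho> j)) + 2 * \<eta> * \<Phi> (\<rho> j)"
    unfolding e_def by (intro eventually_ball_finite ballI nu_dominant A B Z(1) Z(3) \<eta>)
  \<comment> \<open>At one radius, X is \<Phi>, b is \<open>nu B\<close> and M the larger of
    \<open>nu A\<close> and b. If b is nearly M, the bound for v limits B^(n+1); otherwise M =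
    \<open>nu A\<close>, each A - x B is nearly as large as A, and the bound for u limits the n
    factors. The coefficient 3 k + 4 collects three times k + 1 from Lm and Sh and one b from the
    factor B of Y2.\<close>
  have "\<forall>\<^sub>F j in sequentially. \<exists>X M b. X > 0 \<and> X \<le> 2 * M \<and> b \<le> M \<and> (B = (\<lambda>_. 1) \<longrightarrow> b = 0) \<and>
     ((b \<ge> M - 2 * \<eta> * X \<and> (real n + 1) * b \<le> (real m + 2) * M + (3 * real k + 4) * b + \<eta> * X * (2 * real m + 3 * real k + 13)) \<or>
      real n * (M - 2 * \<eta> * X) \<le> (real m + 1) * M + (3 * real k + 4) * b + \<eta> * X * (2 * real m + 3 * real k + 13))"
    using abc E_shift E_diff E_dom nu_L_num_le[OF A B L \<eta>] nu_linear_prod[OF F \<eta>] small(1)[OF \<eta>] small(2)[OF \<eta>] large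
      const_small[OF zero_less_one, of 1] const_small[OF \<eta>, of "- ln (norm l)"]
  proof eventually_elim
    case (elim j)
    define X where "X = \<Phi> (\<rho> j)"
    define M where "M = max (nu A (\<rho> j)) (nu B (\<rho> j))"
    define b where "b = nu B (\<rho> j)"
    define N where "N = (\<lambda>u. nu u (\<rho> j))"
    have "nu u (\<rho> j) = N T + (ln (norm l) + (\<Sum>i<n. N (e (rt i)))) + N Lm"
    proof -
      have "nu PH (\<rho> j) = ln (norm l) + (\<Sum>i<n. N (e (rt i)))"
      proof -
        have r: "nz_entire (e (rt i))" if "i \<in> {..<n}" for i using rtZ e_ent that by auto
        have "nu (\<lambda>z. \<Prod>i<n. e (rt i) z) (\<rho> j) = (\<Sum>i<n. nu (e (rt i)) (\<rho> j))"
          by (rule nu_prod) (rule r)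
        moreover have "nu (\<lambda>z. l * (\<Prod>i<n. e (rt i) z)) (\<rho> j) = nu (\<lambda>_. l) (\<rho> j) + nu (\<lambda>z. \<Prod>i<n. e (rt i) z) (\<rho> j)"
          by (rule nu_mult[OF nz_entire_const[OF l]]) (intro nz_entire_prod r)
        ultimately show ?thesis by (simp add: PH_eq N_def nu_const[OF l])
      qed
      thus ?thesis
        unfolding u_def N_def using nu_mult[OF T(1) nz_entire_mult[OF PH Lm]] nu_mult[OF PH Lm] by simp
    qed
    moreover have Nv: "nu v (\<rho> j) = N S + (real n + 1) * b + N Sh"
      unfolding v_def N_def b_def
      using nu_mult[OF nz_entire_const BS(1), of "- 1" "\<rho> j"] nu_mult[OF S(1) BS(2), of "\<rho> j"]
        nu_mult[OF BS(3) Sh, of "\<rho> j"] nu_power[OF B(1), of "Suc n" "\<rho> j"]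
      by (simp add: nu_const algebra_simps)
    moreover have NY1: "nu Y1 (\<rho> j) = N Lm + N Sh + N S + N T"
      unfolding Y1_def N_def using nu_mult[OF Lm ST(2), of "\<rho> j"] nu_mult[OF Sh ST(1), of "\<rho> j"] nu_mult[OF S(1) T(1), of "\<rho> j"] by simp
    moreover have "nu Y2 (\<rho> j) = (\<Sum>x\<in>Z. N (e x)) + b + (N Lm + N Sh + N S + N T) + N (\<lambda>z. \<Prod>x\<in>F. z - x)"
      unfolding Y2_def N_def b_def
      using nu_mult[OF Zp Y2'(2), of "\<rho> j"] nu_mult[OF B(1) Y2'(1), of "\<rho> j"] nu_mult[OF Y1 Fp, of "\<rho> j"] NY1
        nu_prod[of Z e "\<rho> j"] e_ent by (simp add: N_def)
    ultimately have I1: "(\<Sum>i<n. N (e (rt i))) \<le> N Lm + 2 * N Sh + 2 * N S + N T + (\<Sum>x\<in>Z. N (e x)) + b + N (\<lambda>z. \<Prod>x\<in>F. z - x) + \<eta> * X - ln (norm l)"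
      and I2: "(real n + 1) * b \<le> 2 * N Lm + N Sh + N S + 2 * N T + (\<Sum>x\<in>Z. N (e x)) + b + N (\<lambda>z. \<Prod>x\<in>F. z - x) + \<eta> * X"
      using elim(1,2) by (simp_all add: X_def)
    have X1: "X > 0" using elim(11) by (simp add: X_def)
    have XM: "X \<le> 2 * M" using elim(10) by (simp add: X_def M_def)
    have bM: "b \<le> M" by (simp add: b_def M_def)
    have b0: "B = (\<lambda>_. 1) \<longrightarrow> b = 0" using nu_const[of 1] by (auto simp: b_def)
    have "N Sh = (\<Sum>i\<le>k. nu (\<lambda>z. B (q i * z + c i)) (\<rho> j))"
      unfolding N_def Sh_eq by (rule nu_prod) (use nz_entire_affine B q in auto)
    also have "\<dots> \<le> (\<Sum>i\<le>k. b + \<eta> * X)" using elim(3) by (intro sum_mono) (auto simp: b_def X_def)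
    finally have bSh: "N Sh \<le> (real k + 1) * b + (real k + 1) * (\<eta> * X)" by (simp add: algebra_simps)
    have "N Lm \<le> nu A (\<rho> j) + (real k + 1) * b + (real k + 3) * (\<eta> * X)"
      using elim(6) by (simp add: N_def Lm_def b_def X_def mult.assoc)
    then have bLm: "N Lm \<le> M + (real k + 1) * b + (real k + 3) * (\<eta> * X)" unfolding M_def by linarith
    have "(\<Sum>x\<in>Z. N (e x)) \<le> (\<Sum>x\<in>Z. M + 2 * (\<eta> * X))"
      using elim(4) by (intro sum_mono) (auto simp: N_def M_def X_def mult.assoc)
    then have bZ: "(\<Sum>x\<in>Z. N (e x)) \<le> real m * M + 2 * real m * (\<eta> * X)" by (simp add: m_def algebra_simps)
    have small': "N S \<le> \<eta> * X" "N T \<le> \<eta> * X" "N (\<lambda>z. \<Prod>x\<in>F. z - x) \<le> \<eta> * X" "- ln (norm l) \<le> \<eta> * X"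
      using elim(7,8,9,12) by (simp_all add: N_def X_def)
    show ?case
    proof (cases "b \<ge> M - 2 * \<eta> * X")
      case True
      have "(real n + 1) * b \<le> 2 * (M + (real k + 1) * b + (real k + 3) * (\<eta> * X)) + ((real k + 1) * b + (real k + 1) * (\<eta> * X))
         + 3 * (\<eta> * X) + (real m * M + 2 * real m * (\<eta> * X)) + b + 2 * (\<eta> * X)"
      proof -
        have "p \<le> 2 * (M + p1 + p2) + (p1 + p3) + 3 * y + (p4 + p5) + b + 2 * y"
          if "p \<le> 2 * L + Sh + S + 2 * T + Z + b + F + y" "L \<le> M + p1 + p2" "Sh \<le> p1 + p3" "Z \<le> p4 + p5"
            "S \<le> y" "T \<le> y" "F \<le> y" for p p1 p2 p3 p4 p5 y L Sh S T Z F :: real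
          using that by (smt (verit))
        from this[OF I2 bLm bSh bZ small'(1-3)] show ?thesis .
      qed
      also have "\<dots> \<le> (real m + 2) * M + (3 * real k + 4) * b + \<eta> * X * (2 * real m + 3 * real k + 13)"
        using X1 \<eta> by (simp add: algebra_simps)
      finally show ?thesis using True X1 XM bM b0 by blast
    next
      case False
      have "real n * (M - 2 * \<eta> * X) = (\<Sum>i<n. M - 2 * \<eta> * X)" by simp
      also have "\<dots> \<le> (\<Sum>i<n. N (e (rt i)))"
      proof (intro sum_mono)
        fix i assume "i \<in> {..<n}"
        then have "nu A (\<rho> j) \<le> max (N (e (rt i))) b + 2 * \<eta> * X"
          using elim(5) rtZ by (auto simp: N_def b_def X_def)
        moreover have "M = nu A (\<rho> j)"
        proof -
          have "2 * \<eta> * X > 0" using \<eta> X1 by simp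
          thus ?thesis using False by (auto simp: M_def b_def max_def)
        qed
        ultimately show "M - 2 * \<eta> * X \<le> N (e (rt i))" using False by linarith
      qed
      also have "\<dots> \<le> (M + (real k + 1) * b + (real k + 3) * (\<eta> * X)) + 2 * ((real k + 1) * b + (real k + 1) * (\<eta> * X))
         + 3 * (\<eta> * X) + (real m * M + 2 * real m * (\<eta> * X)) + b + 3 * (\<eta> * X)"
      proof -
        have "p \<le> (M + p1 + p2) + 2 * (p1 + p3) + 3 * y + (p4 + p5) + b + 3 * y"
          if "p \<le> L + 2 * Sh + 2 * S + T + Z + b + F + y - l" "L \<le> M + p1 + p2" "Sh \<le> p1 + p3" "Z \<le> p4 + p5"
            "S \<le> y" "T \<le> y" "F \<le> y" "- l \<le> y" for p p1 p2 p3 p4 p5 y l L Sh S T Z F :: real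
          using that by (smt (verit))
        from this[OF I1 bLm bSh bZ small'] show ?thesis .
      qed
      also have "\<dots> \<le> (real m + 1) * M + (3 * real k + 4) * b + \<eta> * X * (2 * real m + 3 * real k + 13)"
        using X1 \<eta> by (simp add: algebra_simps)
      finally show ?thesis using X1 XM bM b0 by blast
    qed
  qed
  \<comment> \<open>A single radius is enough, since the claim is an inequality between
    integers.\<close>
  then obtain X M b where *: "X > 0" "X \<le> 2 * M" "b \<le> M" "B = (\<lambda>_. 1) \<longrightarrow> b = 0"
    "(b \<ge> M - 2 * \<eta> * X \<and> (real n + 1) * b \<le> (real m + 2) * M + (3 * real k + 4) * b + \<eta> * X * (2 * real m + 3 * real k + 13)) \<or>
      real n * (M - 2 * \<eta> * X) \<le> (real m + 1) * M + (3 * real k + 4) * b + \<eta> * X * (2 * real m + 3 * real k + 13)"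
    by (auto simp: eventually_sequentially)
  define err where "err = \<eta> * X * (2 * real n + 2 * real m + 3 * real k + 20)"
  have err: "err < M"
  proof -
    have "err = X / 4" by (simp add: err_def \<eta>_def add_nonneg_eq_0_iff) (simp add: field_simps)
    thus ?thesis using *(1,2) by linarith
  qed
  have \<eta>X: "0 < \<eta> * X" using \<eta> *(1) by simp
  have small_err: "\<eta> * X * (2 * real m + 3 * real k + 13) + 2 * \<eta> * X * (real n + 1) \<le> err"
    using \<eta>X by (simp add: err_def algebra_simps)
  have M: "M > 0" using * by linarith
  show "n \<le> card Z + 3 * k + 5"
  proof (rule ccontr)
    assume "\<not> ?thesis"
    \<comment> \<open>An excess is at least 1 because all quantities are integers; it would give M
      \<le> err, against err < M.\<close>
    then have "real n - real m - 3 * real k - 5 \<ge> 1" by (simp add: m_def)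
    then have 1: "1 * M \<le> (real n - real m - 3 * real k - 5) * M" using M by (intro mult_right_mono) auto
    have 2: "(3 * real k + 4) * b \<le> (3 * real k + 4) * M" using *(3) by (intro mult_left_mono) auto
    have 3: "real n * (M - 2 * \<eta> * X) \<le> (real m + 1) * M + (3 * real k + 4) * b + \<eta> * X * (2 * real m + 3 * real k + 13) + 0
        \<or> (real n + 1) * (M - 2 * \<eta> * X) \<le> (real m + 2) * M + (3 * real k + 4) * b + \<eta> * X * (2 * real m + 3 * real k + 13)"
    proof -
      have "(real n + 1) * (M - 2 * \<eta> * X) \<le> (real n + 1) * b" if "b \<ge> M - 2 * \<eta> * X"
        using that by (intro mult_left_mono) auto
      thus ?thesis using *(5) by linarith
    qed
    have "M \<le> \<eta> * X * (2 * real m + 3 * real k + 13) + 2 * \<eta> * X * (real n + 1)"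
      using 1 2 3 \<eta>X by (auto simp: algebra_simps)
    thus False using small_err err by linarith
  qed
  show "n \<le> card Z + 1" if "B = (\<lambda>_. 1)"
  proof (rule ccontr)
    assume "\<not> ?thesis"
    then have "real n - real m - 1 \<ge> 1" by (simp add: m_def)
    then have 1: "1 * M \<le> (real n - real m - 1) * M" using M by (intro mult_right_mono) auto
    have b: "b = 0" using *(4) that by blast
    have "2 * \<eta> * X \<le> err"
    proof -
      have "\<eta> * X * 2 \<le> err" unfolding err_def using \<eta>X by (intro mult_left_mono) auto
      thus ?thesis by simp
    qed
    \<comment> \<open>With b = 0 the first alternative would need M \<le> 2 \<eta> X \<le> err, so
      only the second is left.\<close>
    then have 2: "real n * (M - 2 * \<eta> * X) \<le> (real m + 1) * M + \<eta> * X * (2 * real m + 3 * real k + 13)"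
      using *(5) b err by auto
    have "M \<le> \<eta> * X * (2 * real m + 3 * real k + 13) + 2 * \<eta> * X * (real n + 1)"
      using 1 2 \<eta>X by (simp add: algebra_simps)
    thus False using small_err err by linarith
  qed
qed

end

section \<open>Functions of order zero\<close>

lemma zero_order_bound:
  assumes "zero_order f" "\<epsilon> > 0"
  shows   "eventually (\<lambda>r. nevanlinna_T r f \<le> r powr \<epsilon>) at_top"
proof -
  have "Limsup at_top (\<lambda>r. ereal (log_plus (nevanlinna_T r f) / ln r)) < ereal \<epsilon>"
    using assms by (simp add: zero_order_def)
  then have "eventually (\<lambda>r. ereal (log_plus (nevanlinna_T r f) / ln r) < ereal \<epsilon>) at_top"
    by (rule Limsup_lessD)
  thus ?thesis using eventually_gt_at_top[of 1]
  proof eventually_elim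
    case (elim r)
    have l: "log_plus (nevanlinna_T r f) \<le> \<epsilon> * ln r" using elim by (simp add: divide_less_eq)
    show ?case
    proof (cases "nevanlinna_T r f \<le> 1")
      case True
      moreover have "1 \<le> r powr \<epsilon>" using elim assms by (intro ge_one_powr_ge_zero) auto
      ultimately show ?thesis by linarith
    next
      case False
      then have "nevanlinna_T r f = exp (log_plus (nevanlinna_T r f))" by (simp add: log_plus_def)
      also have "\<dots> \<le> exp (\<epsilon> * ln r)" using l by simp
      also have "\<dots> = r powr \<epsilon>" using elim by (simp add: powr_def)
      finally show ?thesis .
    qed
  qed
qed

lemma nevanlinna_T_nonneg: "f meromorphic_on UNIV \<Longrightarrow> r \<ge> 1 \<Longrightarrow> nevanlinna_T r f \<ge> 0"
  by (simp add: nevanlinna_T_def nevanlinna_m_nonneg nevanlinna_N_nonneg)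

lemma small_function_bound:
  assumes "small_function_of \<alpha> f" "f meromorphic_on UNIV"
  obtains E where "E \<in> lmeasurable"
    "\<And>c. c > 0 \<Longrightarrow> eventually (\<lambda>r. r \<notin> E \<longrightarrow> nevanlinna_T r \<alpha> \<le> c * nevanlinna_T r f) at_top"
proof -
  obtain E where E: "E \<in> lmeasurable"
      "(\<lambda>r. nevanlinna_T r \<alpha>) \<in> o[inf at_top (principal (- E))](\<lambda>r. nevanlinna_T r f)"
    using assms by (auto simp: small_function_of_def)
  have "eventually (\<lambda>r. r \<notin> E \<longrightarrow> nevanlinna_T r \<alpha> \<le> c * nevanlinna_T r f) at_top" if c: "c > 0" for c
  proof -
    have "eventually (\<lambda>r. r \<in> - E \<longrightarrow> norm (nevanlinna_T r \<alpha>) \<le> c * norm (nevanlinna_T r f)) at_top"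
      using landau_o.smallD[OF E(2) c] by (simp add: eventually_inf_principal)
    thus ?thesis using eventually_ge_at_top[of 1]
      by eventually_elim (use nevanlinna_T_nonneg[OF assms(2)] in auto)
  qed
  thus ?thesis using E(1) that by blast
qed

lemma lmeasurable_Un_countable:
  assumes "E \<in> lmeasurable" "countable (X :: real set)"
  shows   "E \<union> X \<in> lmeasurable"
proof -
  have "X \<in> null_sets lebesgue" using countable_imp_null_set_lborel[OF assms(2)] null_sets_completionI by blast
  thus ?thesis using assms(1) by (intro fmeasurable.Un) (auto simp: negligible_iff_null_sets[symmetric] negligible_imp_measurable negligible_iff_measure)
qed

text \<open>The countably many radii that are not clean are added to E, which keeps its measure
  finite.\<close>

lemma numerator_zero_order:
  assumes q: "quot_rep f A B" and E: "E \<in> lmeasurable"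
    and T: "\<And>\<epsilon>. \<epsilon> > 0 \<Longrightarrow> eventually (\<lambda>r. r \<notin> E \<longrightarrow> nevanlinna_T r f \<le> r powr \<epsilon>) at_top"
    and Bg: "\<And>\<epsilon>. \<epsilon> > 0 \<Longrightarrow> \<exists>C. \<forall>z. norm (B z) \<le> exp (C * (1 + norm z) powr \<epsilon>)"
    and e: "\<epsilon> > 0"
  shows   "\<exists>C. \<forall>z. norm (A z) \<le> exp (C * (1 + norm z) powr \<epsilon>)"
proof (rule numerator_growth[OF q _ _ _ Bg e])
  show "E \<union> {r. \<not> clean_radius f A B r} \<in> lmeasurable"
    by (rule lmeasurable_Un_countable[OF E countable_not_clean[OF q]])
  show "clean_radius f A B r" if "r \<notin> E \<union> {r. \<not> clean_radius f A B r}" for r using that by simp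
  show "eventually (\<lambda>r. r \<notin> E \<union> {r. \<not> clean_radius f A B r} \<longrightarrow> nevanlinna_T r f \<le> r powr \<epsilon>) at_top"
    if "\<epsilon> > 0" for \<epsilon>
    using T[OF that] by eventually_elim simp
qed

lemma denominator_zero_order:
  assumes f: "f meromorphic_on UNIV" and E: "E \<in> lmeasurable"
    and T: "\<And>\<epsilon>. \<epsilon> > 0 \<Longrightarrow> eventually (\<lambda>r. r \<notin> E \<longrightarrow> nevanlinna_T r f \<le> r powr \<epsilon>) at_top"
  obtains B where "nz_entire B" "\<And>z. zorder B z = int (pord f z)"
    "\<And>\<epsilon>. \<epsilon> > 0 \<Longrightarrow> \<exists>C. \<forall>z. norm (B z) \<le> exp (C * (1 + norm z) powr \<epsilon>)"
proof (rule canonical_product[of "pord f"])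
  show "finite {z. norm z \<le> R \<and> pord f z \<noteq> 0}" for R
    using finite_poles[OF f, of R] pord_eq_0_iff[OF f] by simp
  show "\<exists>C. \<forall>R\<ge>1. real (\<Sum>z | norm z \<le> R \<and> pord f z \<noteq> 0. pord f z) \<le> C * R powr \<epsilon>" if "\<epsilon> > 0" for \<epsilon>
    by (rule pole_number_growth[OF f E T that])
qed (rule that)

text \<open>Cauchy's inequality kills all Taylor coefficients of index above an integer N \<ge> C.
  Arbitrarily large radii suffice, which is what the negation of an eventual statement
  supplies.\<close>

lemma entire_polynomial_if_log_growth:
  assumes u: "u holomorphic_on UNIV"
    and g: "\<And>r0. \<exists>r\<ge>r0. \<forall>z. norm z = r \<longrightarrow> norm (u z) \<le> exp (C * ln r)"
  shows   "\<exists>p. \<forall>z. u z = poly p z"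
proof -
  obtain N :: nat where N: "C \<le> real N" using real_arch_simple by blast
  define a where "a = (\<lambda>n. (deriv ^^ n) u 0 / fact n)"
  have a0: "a n = 0" if n: "n > N" for n
  proof (rule ccontr)
    assume "a n \<noteq> 0"
    then have pos: "norm ((deriv ^^ n) u 0) > 0" by (simp add: a_def)
    \<comment> \<open>Large enough that r times the modulus of the derivative is at least 2 n!,
      while Cauchy's inequality allows at most n!.\<close>
    define r0 where "r0 = max 1 (2 * fact n / norm ((deriv ^^ n) u 0))"
    obtain r where r: "r \<ge> r0" "\<And>z. norm z = r \<Longrightarrow> norm (u z) \<le> exp (C * ln r)" using g by blast
    have r1: "r \<ge> 1" using r(1) by (simp add: r0_def)
    have "norm ((deriv ^^ n) u 0) \<le> fact n * exp (C * ln r) / r ^ n"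
    proof (rule Cauchy_inequality)
      show "u holomorphic_on ball 0 r" using u holomorphic_on_subset by blast
      show "continuous_on (cball 0 r) u" using u holomorphic_on_imp_continuous_on holomorphic_on_subset by blast
    qed (use r1 r(2) in auto)
    also have "exp (C * ln r) \<le> exp (real N * ln r)" using N r1 by (simp add: mult_right_mono)
    also have "exp (real N * ln r) = r ^ N" using r1 by (simp add: exp_of_nat_mult)
    finally have "norm ((deriv ^^ n) u 0) \<le> fact n * r ^ N / r ^ n" using r1 by (simp add: divide_right_mono)
    also have "\<dots> \<le> fact n / r"
    proof -
      have "r ^ Suc N \<le> r ^ n" using n r1 by (intro power_increasing) auto
      then have "r ^ N * r \<le> r ^ n" by (simp add: mult.commute)
      thus ?thesis using r1 by (simp add: field_simps)
    qed
    finally have "norm ((deriv ^^ n) u 0) * r \<le> fact n" using r1 by (simp add: field_simps)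
    moreover have "2 * fact n \<le> norm ((deriv ^^ n) u 0) * r"
      using r(1) pos by (simp add: r0_def field_simps)
    moreover have "(fact n :: real) > 0" by simp
    ultimately show False by linarith
  qed
  have "u z = poly (\<Sum>n\<le>N. monom (a n) n) z" for z
  proof -
    have "(\<lambda>n. a n * (z - 0) ^ n) sums u z"
      unfolding a_def by (rule holomorphic_power_series[of u 0 "norm z + 1"]) (use u holomorphic_on_subset in auto)
    moreover have "(\<lambda>n. a n * (z - 0) ^ n) sums (\<Sum>n\<le>N. a n * (z - 0) ^ n)"
      by (rule sums_finite) (use a0 in auto)
    ultimately show ?thesis
      by (simp add: sums_unique2 poly_sum poly_monom)
  qed
  thus ?thesis by blast
qed

section \<open>Clearing denominators in P(f) L(f) - \<alpha>\<close>

lemma eventually_affine: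
  assumes "\<And>z. eventually P (at z)" "(q::complex) \<noteq> 0"
  shows   "eventually (\<lambda>w. P (q * w + c)) (at z)"
proof -
  have "filterlim (\<lambda>w. q * w + c) (at (q * z + c)) (at z)"
  proof (rule filterlim_atI)
    show "((\<lambda>w. q * w + c) \<longlongrightarrow> q * z + c) (at z)" by (intro tendsto_intros)
    \<comment> \<open>For q \<noteq> 0 the affine map is injective, so it carries the punctured
      filter to the punctured filter.\<close>
    show "eventually (\<lambda>w. q * w + c \<noteq> q * z + c) (at z)"
      using eventually_neq_at_within[of z] by eventually_elim (use assms(2) in simp)
  qed
  thus ?thesis using assms(1) eventually_compose_filterlim by blast
qed

lemma quot_rep_at:
  assumes "quot_rep f A B"
  shows   "eventually (\<lambda>w. B w \<noteq> 0 \<and> f w = A w / B w) (at z)"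
proof -
  have "eventually (\<lambda>w. f w = A w / B w) (at z)" "eventually (\<lambda>w. B w \<noteq> 0) (at z)"
    using assms nz_entire_eventually by (auto simp: quot_rep_def eventually_cosparse_open_eq)
  thus ?thesis by eventually_elim simp
qed

text \<open>The identity is claimed in punctured neighbourhoods of every point, since f is arbitrary
  at its poles and removable singularities, and so are its shifts at the preimages.\<close>

lemma L_op_quot:
  assumes "quot_rep f A B" "\<forall>j\<le>k. q j \<noteq> 0"
  shows   "eventually (\<lambda>w. B w \<noteq> 0 \<and> shift_prod k q c B w \<noteq> 0 \<and> f w = A w / B w \<and>
             L_op k a q c f w = L_num k a q c A B w / (B w * shift_prod k q c B w)) (at z)"
proof -
  have "eventually (\<lambda>w. \<forall>j\<in>{..k}. B (q j * w + c j) \<noteq> 0 \<and> f (q j * w + c j) = A (q j * w + c j) / B (q j * w + c j)) (at z)"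
    by (intro eventually_ball_finite ballI eventually_affine[where P = "\<lambda>w. B w \<noteq> 0 \<and> f w = A w / B w"] quot_rep_at assms) (use assms(2) in auto)
  with quot_rep_at[OF assms(1), of z] show ?thesis
  proof eventually_elim
    case (elim w)
    have nz: "shift_prod k q c B w \<noteq> 0" using elim by (simp add: shift_prod_def)
    have "L_op k a q c f w = (\<Sum>j\<le>k. a j * (A (q j * w + c j) * B w - A w * B (q j * w + c j)) *
            (\<Prod>i\<in>{..k}-{j}. B (q i * w + c i)) / (B w * shift_prod k q c B w))"
      unfolding L_op_def
    proof (rule sum.cong[OF refl])
      fix j assume j: "j \<in> {..k}"
      define p where "p = (\<Prod>i\<in>{..k}-{j}. B (q i * w + c i))"
      have "shift_prod k q c B w = B (q j * w + c j) * p"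
        unfolding shift_prod_def p_def using j by (intro prod.remove) auto
      moreover have "p \<noteq> 0" "B (q j * w + c j) \<noteq> 0" using elim j by (auto simp: p_def)
      ultimately show "a j * (f (q j * w + c j) - f w) = a j * (A (q j * w + c j) * B w - A w * B (q j * w + c j)) *
            (\<Prod>i\<in>{..k}-{j}. B (q i * w + c i)) / (B w * shift_prod k q c B w)"
      proof -
        have "x * (u / v - s / t) = x * (u * t - s * v) * p / (t * (v * p))" if "v \<noteq> 0" "t \<noteq> 0" for x u v s t :: complex
          using that \<open>p \<noteq> 0\<close> by (simp add: field_simps)
        thus ?thesis using elim j \<open>shift_prod k q c B w = B (q j * w + c j) * p\<close> by (simp add: p_def[symmetric])
      qed
    qed
    thus ?case using elim nz by (simp add: L_num_def sum_divide_distrib)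
  qed
qed

lemma poly_quot:
  assumes "smult l (\<Prod>i<n. [:- rt i, 1:]) = P" "B w \<noteq> 0"
  shows   "poly P (A w / B w) = hom_prod l rt n A B w / B w ^ n"
proof -
  have "poly P (A w / B w) = l * (\<Prod>i<n. A w / B w - rt i)"
    unfolding assms(1)[symmetric] by (simp add: poly_prod)
  also have "(\<Prod>i<n. A w / B w - rt i) = (\<Prod>i<n. (A w - rt i * B w) / B w)"
    by (intro prod.cong refl) (use assms(2) in \<open>simp add: field_simps\<close>)
  also have "\<dots> = (\<Prod>i<n. A w - rt i * B w) / B w ^ n" by (simp add: prod_dividef)
  finally show ?thesis by (simp add: hom_prod_def)
qed

lemma difference_polynomial_quot:
  assumes f: "quot_rep f A B" and \<alpha>: "quot_rep \<alpha> S T" and q: "\<forall>j\<le>k. q j \<noteq> 0"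
    and P: "smult l (\<Prod>i<n. [:- rt i, 1:]) = P"
  shows   "eventually (\<lambda>w. poly P (f w) * L_op k a q c f w - \<alpha> w =
      (T w * (hom_prod l rt n A B w * L_num k a q c A B w) - S w * (B w ^ Suc n * shift_prod k q c B w)) /
      (T w * (B w ^ Suc n * shift_prod k q c B w))) (at z)"
  using L_op_quot[where a = a and c = c and k = k and z = z, OF f q] quot_rep_at[OF \<alpha>, of z]
proof eventually_elim
  case (elim w)
  have "poly P (f w) = hom_prod l rt n A B w / B w ^ n"
    using poly_quot[where A = A and B = B and w = w, OF P] elim by simp
  thus ?case using elim by (simp add: field_simps)
qed

text \<open>Otherwise A = x B, and f is constant off a sparse set, hence rational.\<close>

lemma quot_rep_not_constant:
  assumes f: "quot_rep f A B" "transcendental f"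
  shows   "nz_entire (\<lambda>z. A z - x * B z)"
proof (rule ccontr)
  assume "\<not> ?thesis"
  moreover have "(\<lambda>z. A z - x * B z) holomorphic_on UNIV"
    using f(1) nz_entire_holo by (auto simp: quot_rep_def intro!: holomorphic_intros)
  ultimately have eq: "A z = x * B z" for z by (auto simp: nz_entire_def)
  have "\<forall>\<^sub>\<approx>z\<in>UNIV. f z = poly [:x:] z / poly 1 z"
    unfolding eventually_cosparse_open_eq[OF open_UNIV]
  proof
    fix z
    show "eventually (\<lambda>w. f w = poly [:x:] w / poly 1 w) (at z)"
      using quot_rep_at[OF f(1), of z] by eventually_elim (simp add: eq)
  qed
  then have "rational_function f" unfolding rational_function_def by (intro exI[of _ "[:x:]"] exI[of _ 1]) auto
  thus False using f(2) by (simp add: transcendental_def)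
qed

text \<open>Otherwise A and B have logarithmic growth along arbitrarily large radii, so both are
  polynomials and f is rational.\<close>

lemma quot_rep_log_growth:
  assumes f: "quot_rep f A B" "transcendental f"
    and G: "\<And>z. norm (A z) \<le> exp (\<Phi> (norm z))" "\<And>z. norm (B z) \<le> exp (\<Phi> (norm z))"
  shows   "eventually (\<lambda>r. C * ln r \<le> \<Phi> r) at_top"
proof (rule ccontr)
  assume "\<not> ?thesis"
  then have *: "\<exists>r\<ge>r0. \<Phi> r \<le> C * ln r" for r0
    unfolding eventually_at_top_linorder by (meson less_imp_le not_le)
  have A: "nz_entire A" and B: "nz_entire B" using f(1) by (auto simp: quot_rep_def)
  have "\<exists>p. \<forall>z. u z = poly p z" if u: "nz_entire u" "\<And>z. norm (u z) \<le> exp (\<Phi> (norm z))" for u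
  proof (rule entire_polynomial_if_log_growth[OF nz_entire_holo[OF u(1)]])
    fix r0
    obtain r where r: "r \<ge> r0" "\<Phi> r \<le> C * ln r" using * by blast
    have "norm (u z) \<le> exp (C * ln r)" if "norm z = r" for z
      using u(2)[of z] r(2) that by (meson exp_le_cancel_iff order_trans)
    thus "\<exists>r\<ge>r0. \<forall>z. norm z = r \<longrightarrow> norm (u z) \<le> exp (C * ln r)" using r(1) by blast
  qed
  from this[OF A G(1)] this[OF B G(2)] obtain p1 p2 where p: "\<And>z. A z = poly p1 z" "\<And>z. B z = poly p2 z" by blast
  have "p2 \<noteq> 0" using B p(2) by (auto simp: nz_entire_def)
  moreover have "\<forall>\<^sub>\<approx>z\<in>UNIV. f z = poly p1 z / poly p2 z" using f(1) p by (simp add: quot_rep_def)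
  ultimately have "rational_function f" unfolding rational_function_def by blast
  thus False using f(2) by (simp add: transcendental_def)
qed

section \<open>From finitely many zeros to the degree bound\<close>

lemma transcendental_not_zero: "transcendental f \<Longrightarrow> \<not> identically_zero f"
proof
  assume "transcendental f" "identically_zero f"
  then have "rational_function f"
    unfolding rational_function_def identically_zero_def by (intro exI[of _ 0] exI[of _ 1]) auto
  thus False using \<open>transcendental f\<close> by (simp add: transcendental_def)
qed

text \<open>Supplies the data of \<open>degree_bound\<close>: entire numerators and denominators, a
  growth function and radii outside the exceptional set. The denominator B is left as a parameter,
  so that an entire f can be given the denominator 1.\<close>

lemma finitely_many_zeros_degree_bound:
  fixes P :: "complex poly"
  assumes P: "P \<noteq> 0" and f: "transcendental f" "zero_order f" and \<alpha>: "small_function_of \<alpha> f" "\<not> identically_zero \<alpha>"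
    and q: "\<And>j. j \<le> k \<Longrightarrow> q j \<noteq> 0" and L: "\<not> identically_zero (L_op k a q c f)"
    and fin: "finite {z. isolated_zero (\<lambda>w. poly P (f w) * L_op k a q c f w - \<alpha> w) z}"
    and fq: "quot_rep f A B"
    and Bg: "\<And>\<epsilon>. \<epsilon> > 0 \<Longrightarrow> \<exists>C. \<forall>z. norm (B z) \<le> exp (C * (1 + norm z) powr \<epsilon>)"
  shows "degree P \<le> card {z. poly P z = 0} + 3 * k + 5"
        "B = (\<lambda>_. 1) \<Longrightarrow> degree P \<le> card {z. poly P z = 0} + 1"
proof -
  have f_mero: "f meromorphic_on UNIV" and A: "nz_entire A" and B: "nz_entire B"
    and coprime: "\<And>z. A z = 0 \<Longrightarrow> B z \<noteq> 0"
    using fq by (auto simp: quot_rep_def)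
  have \<alpha>_mero: "\<alpha> meromorphic_on UNIV" using \<alpha>(1) by (simp add: small_function_of_def)
  obtain E where E: "E \<in> lmeasurable"
    "\<And>c. c > 0 \<Longrightarrow> eventually (\<lambda>r. r \<notin> E \<longrightarrow> nevanlinna_T r \<alpha> \<le> c * nevanlinna_T r f) at_top"
    using small_function_bound[OF \<alpha>(1) f_mero] by blast
  have fT: "eventually (\<lambda>r. r \<notin> E \<longrightarrow> nevanlinna_T r f \<le> r powr \<epsilon>) at_top" if "\<epsilon> > 0" for \<epsilon>
    using zero_order_bound[OF f(2) that] by eventually_elim simp
  have \<alpha>T: "eventually (\<lambda>r. r \<notin> E \<longrightarrow> nevanlinna_T r \<alpha> \<le> r powr \<epsilon>) at_top" if "\<epsilon> > 0" for \<epsilon>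
    using fT[OF that] E(2)[of 1, simplified] by eventually_elim auto
  obtain T where T: "nz_entire T" "\<And>z. zorder T z = int (pord \<alpha> z)"
    and Tg: "\<And>\<epsilon>. \<epsilon> > 0 \<Longrightarrow> \<exists>C. \<forall>z. norm (T z) \<le> exp (C * (1 + norm z) powr \<epsilon>)"
    using denominator_zero_order[OF \<alpha>_mero E(1) \<alpha>T] by blast
  obtain S where \<alpha>q: "quot_rep \<alpha> S T" using quot_rep_exists[OF \<alpha>_mero \<alpha>(2) T] by blast
  have S: "nz_entire S" using \<alpha>q by (simp add: quot_rep_def)
  have q': "\<forall>j\<le>k. q j \<noteq> 0" using q by blast
  have Ag: "\<exists>C. \<forall>z. norm (A z) \<le> exp (C * (1 + norm z) powr \<epsilon>)" if "\<epsilon> > 0" for \<epsilon>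
    by (rule numerator_zero_order[OF fq E(1) _ _ that]) (fact fT Bg)+
  have Sg: "\<exists>C. \<forall>z. norm (S z) \<le> exp (C * (1 + norm z) powr \<epsilon>)" if "\<epsilon> > 0" for \<epsilon>
    by (rule numerator_zero_order[OF \<alpha>q E(1) _ _ that]) (fact \<alpha>T Tg)+
  define E' where "E' = E \<union> {r. \<not> clean_radius f A B r} \<union> {r. \<not> clean_radius \<alpha> S T r}"
  have E': "E' \<in> lmeasurable"
    unfolding E'_def by (intro lmeasurable_Un_countable E countable_not_clean fq \<alpha>q)
  define G where "G = (\<lambda>z. norm (A z) + norm (B z) + norm (S z) + norm (T z))"
  \<comment> \<open>The sum of four moduli lets one function control A, B, S and T; adding 1 makes
    the logarithm nonnegative, and \<open>max 0 r\<close> makes \<Phi> monotone on the whole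
    line.\<close>
  define \<Phi> where "\<Phi> = (\<lambda>r. ln (1 + Sup (G ` cball 0 (max 0 r))))"
  have G_cont: "continuous_on X G" for X
    unfolding G_def by (intro continuous_intros holomorphic_on_imp_continuous_on nz_entire_holo A B S T)
  have bdd: "bdd_above (G ` cball 0 r)" for r
    by (intro bounded_imp_bdd_above compact_imp_bounded compact_continuous_image G_cont) auto
  have G_nonneg: "G z \<ge> 0" for z by (simp add: G_def)
  have Sup_nonneg: "Sup (G ` cball 0 (max 0 r)) \<ge> 0" for r
    by (rule order_trans[OF G_nonneg[of 0] cSup_upper]) (auto intro: bdd)
  have G_le: "G z \<le> exp (\<Phi> r)" if "norm z \<le> r" for z r
  proof -
    have "G z \<le> Sup (G ` cball 0 (max 0 r))" using that by (intro cSup_upper bdd) auto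
    also have "\<dots> \<le> exp (\<Phi> r)" using Sup_nonneg[of r] by (simp add: \<Phi>_def)
    finally show ?thesis .
  qed
  have \<Phi>_le: "\<Phi> r \<le> ln (1 + D)" if "r \<ge> 0" "\<And>z. norm z \<le> r \<Longrightarrow> G z \<le> D" for r D
  proof -
    have "Sup (G ` cball 0 (max 0 r)) \<le> D" using that by (intro cSup_least) auto
    thus ?thesis using Sup_nonneg[of r] by (simp add: \<Phi>_def)
  qed
  have \<Phi>_nonneg: "\<Phi> r \<ge> 0" for r using Sup_nonneg[of r] by (simp add: \<Phi>_def)
  have \<Phi>_mono: "\<Phi> r \<le> \<Phi> r'" if "r \<le> r'" for r r'
  proof -
    have "Sup (G ` cball 0 (max 0 r)) \<le> Sup (G ` cball 0 (max 0 r'))"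
      using that by (intro cSup_subset_mono bdd) auto
    thus ?thesis using Sup_nonneg[of r] by (simp add: \<Phi>_def)
  qed
  have ABST: "norm (A z) \<le> exp (\<Phi> r)" "norm (B z) \<le> exp (\<Phi> r)" "norm (S z) \<le> exp (\<Phi> r)" "norm (T z) \<le> exp (\<Phi> r)"
    if "norm z \<le> r" for z r
  proof -
    have "norm (A z) \<le> G z" "norm (B z) \<le> G z" "norm (S z) \<le> G z" "norm (T z) \<le> G z" by (auto simp: G_def)
    with G_le[OF that] show "norm (A z) \<le> exp (\<Phi> r)" "norm (B z) \<le> exp (\<Phi> r)" "norm (S z) \<le> exp (\<Phi> r)" "norm (T z) \<le> exp (\<Phi> r)"
      by linarith+
  qed
  have slow: "\<exists>C. \<forall>r\<ge>0. \<Phi> r \<le> C * (1 + r) powr \<epsilon>" if e: "\<epsilon> > 0" for \<epsilon>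
  proof -
    obtain C1 C2 C3 C4 where C: "\<And>z. norm (A z) \<le> exp (C1 * (1 + norm z) powr \<epsilon>)"
      "\<And>z. norm (B z) \<le> exp (C2 * (1 + norm z) powr \<epsilon>)"
      "\<And>z. norm (S z) \<le> exp (C3 * (1 + norm z) powr \<epsilon>)"
      "\<And>z. norm (T z) \<le> exp (C4 * (1 + norm z) powr \<epsilon>)"
      using Ag[OF e] Bg[OF e] Sg[OF e] Tg[OF e] by blast
    define D where "D = \<bar>C1\<bar> + \<bar>C2\<bar> + \<bar>C3\<bar> + \<bar>C4\<bar>"
    have "\<Phi> r \<le> (ln 5 + D) * (1 + r) powr \<epsilon>" if r: "r \<ge> 0" for r
    proof -
      define x where "x = (1 + r) powr \<epsilon>"
      have x: "x \<ge> 1" using r e by (auto simp: x_def intro!: ge_one_powr_ge_zero)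
      have Dx: "D * x \<ge> 0" using x by (simp add: D_def)
      have "G z \<le> 4 * exp (D * x)" if z: "norm z \<le> r" for z
      proof -
        have "norm w \<le> exp (D * x)" if "norm w \<le> exp (C' * (1 + norm z) powr \<epsilon>)" "\<bar>C'\<bar> \<le> D" for C' and w :: complex
        proof -
          have "C' * (1 + norm z) powr \<epsilon> \<le> D * x"
            unfolding x_def using that(2) z e by (intro mult_mono powr_mono2) auto
          thus ?thesis using that(1) by (meson exp_le_cancel_iff order_trans)
        qed
        from this[OF C(1)] this[OF C(2)] this[OF C(3)] this[OF C(4)]
        have "norm (A z) \<le> exp (D * x)" "norm (B z) \<le> exp (D * x)" "norm (S z) \<le> exp (D * x)" "norm (T z) \<le> exp (D * x)"
          by (auto simp: D_def)
        thus ?thesis by (simp add: G_def)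
      qed
      then have "\<Phi> r \<le> ln (1 + 4 * exp (D * x))" by (rule \<Phi>_le[OF r])
      also have "\<dots> \<le> ln (5 * exp (D * x))"
      proof -
        have "1 \<le> exp (D * x)" using Dx by simp
        thus ?thesis by (intro iffD2[OF ln_le_cancel_iff]) (auto intro: add_pos_pos)
      qed
      also have "\<dots> = ln 5 + D * x" by (simp add: ln_mult)
      also have "\<dots> \<le> (ln 5 + D) * x"
      proof -
        have "ln 5 * 1 \<le> ln 5 * x" using x by (intro mult_left_mono) auto
        thus ?thesis by (simp add: distrib_right)
      qed
      finally show ?thesis by (simp add: x_def)
    qed
    thus ?thesis by blast
  qed
  have log_ev: "eventually (\<lambda>r. C * ln r \<le> \<Phi> r) at_top" for C
    by (rule quot_rep_log_growth[OF fq f(1)]) (use ABST in auto)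
  have unbounded: "filterlim \<Phi> at_top at_top"
    by (rule filterlim_at_top_mono[OF ln_at_top]) (use log_ev[of 1] in simp)
  \<comment> \<open>The dilation factor grows with j, so the resulting sequence eventually handles
    every fixed s.\<close>
  have "\<exists>r\<ge>real j + 1. r \<notin> E' \<and> \<Phi> ((real j + 1) * r) \<le> 2 * \<Phi> r" for j
    by (rule slow_growth_radius[OF \<Phi>_mono E' slow unbounded]) auto
  then obtain \<rho> where \<rho>: "\<And>j. \<rho> j \<ge> real j + 1" "\<And>j. \<rho> j \<notin> E'" "\<And>j. \<Phi> ((real j + 1) * \<rho> j) \<le> 2 * \<Phi> (\<rho> j)"
    by metis
  have \<rho>_top: "filterlim \<rho> at_top sequentially"
    by (rule filterlim_at_top_mono[OF filterlim_real_sequentially]) (auto intro!: always_eventually order_trans[OF _ \<rho>(1)])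
  interpret slow_sequence \<Phi> \<rho>
  proof
    show "\<forall>\<^sub>F j in sequentially. C * ln (\<rho> j) \<le> \<Phi> (\<rho> j)" for C
      by (rule eventually_compose_filterlim[OF log_ev \<rho>_top])
    show "\<forall>\<^sub>F j in sequentially. \<Phi> (s * \<rho> j) \<le> 2 * \<Phi> (\<rho> j)" for s
    proof -
      obtain N where N: "s \<le> real N" using real_arch_simple by blast
      show ?thesis using eventually_ge_at_top[of N]
      proof eventually_elim
        case (elim j)
        have "s * \<rho> j \<le> (real j + 1) * \<rho> j" using N elim \<rho>(1)[of j] by (intro mult_right_mono) auto
        thus ?case using \<Phi>_mono \<rho>(3)[of j] by (meson order_trans)
      qed
    qed
  qed (use \<Phi>_mono \<Phi>_nonneg \<rho>_top in auto)
  have ctrl: "controlled u" if "\<And>z. norm (u z) \<le> exp (\<Phi> (norm z))" for u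
  proof -
    have "norm (u z) \<le> exp (1 * (1 + \<Phi> (1 * (1 + norm z))))" for z
    proof -
      have "\<Phi> (norm z) \<le> 1 * (1 + \<Phi> (1 * (1 + norm z)))" using \<Phi>_mono[of "norm z" "1 + norm z"] by simp
      thus ?thesis using that[of z] by (meson exp_le_cancel_iff order_trans)
    qed
    thus ?thesis unfolding controlled_def by (intro exI[of _ 1]) auto
  qed
  have c: "controlled A" "controlled B" "controlled S" "controlled T" by (rule ctrl; use ABST in auto)+
  have clean: "clean_radius f A B (\<rho> j)" "clean_radius \<alpha> S T (\<rho> j)" "\<rho> j \<notin> E" and \<rho>_pos: "\<rho> j > 0" for j
    using \<rho>(1)[of j] \<rho>(2)[of j] by (auto simp: E'_def)
  define d where "d = ln (norm (zor_poly B 0 0))"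
  define d' where "d' = ln (norm (zor_poly T 0 0))"
  \<comment> \<open>T(r, f) is at most \<Phi> up to a constant on these clean circles, so smallness
    of \<alpha> relative to T(r, f) becomes smallness relative to \<Phi>.\<close>
  have fT_le: "nevanlinna_T (\<rho> j) f \<le> \<Phi> (\<rho> j) - d" for j
    unfolding d_def by (rule nevanlinna_T_upper[OF fq \<rho>_pos clean(1)]) (use ABST in auto)
  have small: "\<forall>\<^sub>F j in sequentially. nu S (\<rho> j) \<le> \<epsilon> * \<Phi> (\<rho> j) \<and> nu T (\<rho> j) \<le> \<epsilon> * \<Phi> (\<rho> j)" if e: "\<epsilon> > 0" for \<epsilon>
  proof -
    have e2: "\<epsilon> / 2 > 0" using e by simp
    show ?thesis
      using eventually_compose_filterlim[OF E(2)[OF e2] \<rho>_top] const_small[OF e2, of "- (\<epsilon> / 2 * d) + d'"]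
    proof eventually_elim
      case (elim j)
      have "nevanlinna_T (\<rho> j) \<alpha> \<le> \<epsilon> / 2 * nevanlinna_T (\<rho> j) f" using elim clean by blast
      also have "\<dots> \<le> \<epsilon> / 2 * (\<Phi> (\<rho> j) - d)" using fT_le e by (intro mult_left_mono) auto
      finally have "nevanlinna_T (\<rho> j) \<alpha> + d' \<le> \<epsilon> * \<Phi> (\<rho> j)" using elim(2) by (simp add: field_simps)
      thus ?case using nu_le_nevanlinna_T[OF \<alpha>q \<rho>_pos clean(2)] by (auto simp: d'_def intro: order_trans)
    qed
  qed
  \<comment> \<open>Each of the four moduli is at most exp of its mean plus \<Phi> / 8, and the
    means of S and T are at most \<Phi> / 8. If neither \<open>nu A\<close> nor \<open>nu B\<close>
    exceeded \<Phi> / 8, then \<Phi> would be at most 3/8 of itself; otherwise it is at most 4/3 of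
    the larger one.\<close>
  have large: "\<forall>\<^sub>F j in sequentially. \<Phi> (\<rho> j) \<le> 2 * max (nu A (\<rho> j)) (nu B (\<rho> j))"
  proof -
    have e: "(1 / 8 :: real) > 0" by simp
    show ?thesis
      using max_modulus_le_nu[OF A c(1) order_refl e] max_modulus_le_nu[OF B c(2) order_refl e]
        max_modulus_le_nu[OF S c(3) order_refl e] max_modulus_le_nu[OF T(1) c(4) order_refl e]
        small[OF e] const_small[OF e, of "ln 5"]
    proof eventually_elim
      case (elim j)
      define X M where "X = \<Phi> (\<rho> j)" and "M = max (nu A (\<rho> j)) (nu B (\<rho> j))"
      define y where "y = max M (X / 8) + X / 8"
      have X0: "X \<ge> 0" using \<Phi>_nonneg by (simp add: X_def)
      have y0: "y \<ge> 0" using X0 by (simp add: y_def)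
      have "G z \<le> 4 * exp y" if z: "norm z \<le> \<rho> j" for z
      proof -
        have w: "norm w \<le> exp y" if "norm w \<le> exp (t + 1 / 8 * \<Phi> (\<rho> j))" "t \<le> max M (X / 8)" for t and w :: complex
        proof -
          have "t + 1 / 8 * \<Phi> (\<rho> j) \<le> y" using that(2) by (simp add: y_def X_def)
          thus ?thesis using that(1) by (meson exp_le_cancel_iff order_trans)
        qed
        have "norm (A z) \<le> exp y" by (rule w[of _ "nu A (\<rho> j)"]) (use elim z in \<open>auto simp: M_def\<close>)
        moreover have "norm (B z) \<le> exp y" by (rule w[of _ "nu B (\<rho> j)"]) (use elim z in \<open>auto simp: M_def\<close>)
        moreover have "norm (S z) \<le> exp y" by (rule w[of _ "nu S (\<rho> j)"]) (use elim z in \<open>auto simp: X_def\<close>)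
        moreover have "norm (T z) \<le> exp y" by (rule w[of _ "nu T (\<rho> j)"]) (use elim z in \<open>auto simp: X_def\<close>)
        ultimately show ?thesis by (simp add: G_def)
      qed
      then have "X \<le> ln (1 + 4 * exp y)" unfolding X_def using \<rho>_pos[of j] by (intro \<Phi>_le) auto
      also have "\<dots> \<le> ln (5 * exp y)"
      proof -
        have "1 \<le> exp y" using y0 by simp
        thus ?thesis by (intro iffD2[OF ln_le_cancel_iff]) (auto intro: add_pos_pos)
      qed
      also have "\<dots> = ln 5 + y" by (simp add: ln_mult)
      finally have *: "X \<le> X / 8 + y" using elim(6) by (simp add: X_def)
      have "ln (5::real) > 0" by simp
      then have "X > 0" using elim(6) unfolding X_def by linarith
      with * have "X \<le> 2 * M" by (auto simp: y_def max_def split: if_splits)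
      thus ?case by (simp add: X_def M_def)
    qed
  qed
  obtain rt where rt: "smult (lead_coeff P) (\<Prod>i<degree P. [:- rt i, 1:]) = P"
    using complex_poly_decompose' by blast
  define l n where "l = lead_coeff P" and "n = degree P"
  have l: "l \<noteq> 0" using P by (simp add: l_def)
  have rtZ: "rt ` {..<n} \<subseteq> {z. poly P z = 0}"
  proof safe
    fix i assume "i < n"
    have "poly P (rt i) = l * (\<Prod>j<n. rt i - rt j)"
      unfolding l_def n_def by (subst rt[symmetric]) (simp add: poly_prod del: lead_coeff_smult)
    also have "(\<Prod>j<n. rt i - rt j) = 0" using \<open>i < n\<close> by (intro prod_zero) auto
    finally show "poly P (rt i) = 0" by simp
  qed
  have Lnz: "nz_entire (L_num k a q c A B)"
  proof (rule ccontr)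
    assume "\<not> ?thesis"
    moreover have "L_num k a q c A B holomorphic_on UNIV"
    proof -
      have "(\<lambda>z. u (q j * z + c j)) holomorphic_on UNIV" if "nz_entire u" "j \<le> k" for u j
        using nz_entire_holo[OF nz_entire_affine[OF that(1) q[OF that(2)]]] .
      thus ?thesis unfolding L_num_def[abs_def] using A B nz_entire_holo
        by (intro holomorphic_intros) auto
    qed
    ultimately have L0: "L_num k a q c A B z = 0" for z by (auto simp: nz_entire_def)
    have "identically_zero (L_op k a q c f)"
      unfolding identically_zero_def eventually_cosparse_open_eq[OF open_UNIV]
    proof
      fix z
      show "eventually (\<lambda>w. L_op k a q c f w = 0) (at z)"
        using L_op_quot[where a = a and c = c and k = k and z = z, OF fq q'] by eventually_elim (simp add: L0)
    qed
    thus False using L by blast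
  qed
  define H where "H = (\<lambda>w. poly P (f w) * L_op k a q c f w - \<alpha> w)"
  define U where "U = (\<lambda>z. T z * (hom_prod l rt n A B z * L_num k a q c A B z) - S z * (B z ^ Suc n * shift_prod k q c B z))"
  define D where "D = (\<lambda>z. T z * (B z ^ Suc n * shift_prod k q c B z))"
  have HUD: "eventually (\<lambda>w. U w / D w = H w) (at z)" for z
    using difference_polynomial_quot[where a = a and c = c and k = k and z = z, OF fq \<alpha>q q' rt]
    unfolding H_def U_def D_def l_def n_def by eventually_elim simp
  have Sh: "nz_entire (shift_prod k q c B)"
    unfolding shift_prod_def[abs_def] by (intro nz_entire_prod nz_entire_affine B q) auto
  have D: "nz_entire D" unfolding D_def by (intro nz_entire_mult nz_entire_power T B Sh)
  \<comment> \<open>Away from the zeros of D, the function H agrees in a punctured neighbourhood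
    with the continuous U / D. A zero of U there is thus an isolated zero of H, whatever value H
    takes at the point.\<close>
  have zeros: "U z \<noteq> 0" if "nz_entire U" "z \<notin> {z. isolated_zero H z}" "T z \<noteq> 0" "B z \<noteq> 0" "shift_prod k q c B z \<noteq> 0" for z
  proof
    assume U0: "U z = 0"
    have D0: "D z \<noteq> 0" using that by (simp add: D_def)
    have "(\<lambda>w. U w / D w) \<midarrow>z\<rightarrow> U z / D z"
      using analytic_at_imp_isCont[OF nz_entire_analytic[OF that(1)]] analytic_at_imp_isCont[OF nz_entire_analytic[OF D]] D0
      by (intro tendsto_divide) (auto simp: isCont_def)
    then have "H \<midarrow>z\<rightarrow> 0" using U0 Lim_transform_eventually[OF _ HUD] by simp
    moreover have "eventually (\<lambda>w. H w \<noteq> 0) (at z)"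
      using HUD[of z] nz_entire_eventually[OF that(1), of z] nz_entire_eventually[OF D, of z]
      by eventually_elim (metis divide_eq_0_iff)
    ultimately show False using that(2) by (simp add: isolated_zero_def)
  qed
  have fin_roots: "finite {z. poly P z = 0}" using P by (rule poly_roots_finite)
  have fin': "finite {z. isolated_zero H z}" using fin by (simp add: H_def)
  have nc: "nz_entire (\<lambda>z. A z - x * B z)" if "x \<in> {z. poly P z = 0}" for x
    by (rule quot_rep_not_constant[OF fq f(1)])
  have small': "\<forall>\<^sub>F j in sequentially. nu S (\<rho> j) \<le> \<epsilon> * \<Phi> (\<rho> j)"
    "\<forall>\<^sub>F j in sequentially. nu T (\<rho> j) \<le> \<epsilon> * \<Phi> (\<rho> j)" if "\<epsilon> > 0" for \<epsilon>
    using small[OF that] by (auto elim: eventually_mono)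
  note facts = A B S T(1) c q coprime l fin_roots rtZ nc Lnz fin' zeros[unfolded U_def] small' large
  show "degree P \<le> card {z. poly P z = 0} + 3 * k + 5"
    unfolding n_def[symmetric]
    by (rule degree_bound(1)[where A = A and B = B and S = S and T = T and k = k and q = q and l = l and rt = rt and n = n and Z = "{z. poly P z = 0}"
          and a = a and c = c and F = "{z. isolated_zero H z}"]; fact facts)
  show "degree P \<le> card {z. poly P z = 0} + 1" if "B = (\<lambda>_. 1)"
    unfolding n_def[symmetric]
    by (rule degree_bound(2)[where A = A and B = B and S = S and T = T and k = k and q = q and l = l and rt = rt and n = n and Z = "{z. poly P z = 0}"
          and a = a and c = c and F = "{z. isolated_zero H z}"]; fact facts that)
qed

text \<open>The bounds m + 3 k + 5 and m + 1, which finitely many zeros would force on n, lie below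
  the thresholds of the two cases.\<close>

theorem theorem2p2:
  fixes k n m :: nat and P :: "complex poly"
    and f \<alpha> :: "complex \<Rightarrow> complex" and a c q :: "nat \<Rightarrow> complex"
  assumes "P \<noteq> 0" and "degree P = n" and "m = card {z. poly P z = 0}"
    and "transcendental f" and "zero_order f"
    and "small_function_of \<alpha> f" and "\<not> identically_zero \<alpha>"
    and "\<And>j. j \<le> k \<Longrightarrow> q j \<noteq> 0"
    and "\<not> identically_zero (L_op k a q c f)"
  shows "(f meromorphic_on UNIV \<and> n > m + 5 * k + 6 \<longrightarrow>
            infinite {z. isolated_zero (\<lambda>w. poly P (f w) * L_op k a q c f w - \<alpha> w) z}) \<and>
         (f holomorphic_on UNIV \<and> n > m + 2 * k + 2 \<longrightarrow>
            infinite {z. isolated_zero (\<lambda>w. poly P (f w) * L_op k a q c f w - \<alpha> w) z})"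
proof (intro conjI impI notI; elim conjE)
  assume f: "f meromorphic_on UNIV" and n: "n > m + 5 * k + 6"
    and fin: "finite {z. isolated_zero (\<lambda>w. poly P (f w) * L_op k a q c f w - \<alpha> w) z}"
  have T: "eventually (\<lambda>r. r \<notin> {} \<longrightarrow> nevanlinna_T r f \<le> r powr \<epsilon>) at_top" if "\<epsilon> > 0" for \<epsilon>
    using zero_order_bound[OF assms(5) that] by simp
  obtain B where B: "nz_entire B" "\<And>z. zorder B z = int (pord f z)"
    and Bg: "\<And>\<epsilon>. \<epsilon> > 0 \<Longrightarrow> \<exists>C. \<forall>z. norm (B z) \<le> exp (C * (1 + norm z) powr \<epsilon>)"
    using denominator_zero_order[OF f fmeasurable.empty_sets T] by blast
  obtain A where fq: "quot_rep f A B"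
    using quot_rep_exists[OF f transcendental_not_zero[OF assms(4)] B] by blast
  have "degree P \<le> card {z. poly P z = 0} + 3 * k + 5"
    by (rule finitely_many_zeros_degree_bound(1)[OF assms(1,4-9) fin fq Bg])
  thus False using n assms(2,3) by simp
next
  assume f: "f holomorphic_on UNIV" and n: "n > m + 2 * k + 2"
    and fin: "finite {z. isolated_zero (\<lambda>w. poly P (f w) * L_op k a q c f w - \<alpha> w) z}"
  have an: "f analytic_on {z}" for z using f analytic_on_holomorphic by blast
  have "nz_entire f"
  proof (rule ccontr)
    assume "\<not> ?thesis"
    then have "f z = 0" for z using f by (auto simp: nz_entire_def)
    then have "identically_zero f" by (simp add: identically_zero_def)
    thus False using transcendental_not_zero assms(4) by blast
  qed
  \<comment> \<open>An entire f is its own numerator over the denominator 1, which gives access to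
    the sharper bound.\<close>
  then have fq: "quot_rep f f (\<lambda>_. 1)"
    using analytic_at_imp_no_pole[OF an]
    by (auto simp: quot_rep_def nz_entire_const zorder_const' pord_def nz_entire_meromorphic)
  have Bg: "\<exists>C. \<forall>z. norm (1::complex) \<le> exp (C * (1 + norm (z::complex)) powr \<epsilon>)" for \<epsilon>
    by (intro exI[of _ 0]) auto
  have "degree P \<le> card {z. poly P z = 0} + 1"
    by (rule finitely_many_zeros_degree_bound(2)[OF assms(1,4-9) fin fq Bg refl])
  thus False using n assms(2,3) by simp
qed

end
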